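(* Let $\beta\in\{1,2,4\}$, $N\ge1$, $\sigma>0$, $c>0$, and set $\lambda=(c/\sigma)^2$. Let $X$ be an $N\times N$ random matrix with independent real ($\beta=1$), complex ($\beta=2$) or quaternion ($\beta=4$) entries whose $\beta$ real components are independent normal random variables with mean $0$ and standard deviation $\sigma$. Then the largest Lyapunov exponent $\mu_1$ of the product $P_m=Y_mY_{m-1}\cdots Y_1$ of independent copies $Y_i$ of the random matrix $I_N+\frac1cX$ is $$\mu_1=\frac12\int_0^\infty\log(t/\lambda)\,f(t;\beta N,\lambda)\,dt,$$ where $$f(t;k,\lambda)=\frac12e^{-(t+\lambda)/2}\Big(\frac t\lambda\Big)^{k/4-1/2}I_{k/2-1}(\sqrt{\lambda t}).$$
   Context: $I_\nu$ denotes the modified Bessel function of the first kind. The largest Lyapunov exponent is the almost surely constant quantity $\mu_1=\sup_{y\ne0}\lim_{m\to\infty}\frac1m\log\|P_my\|$, the supremum being over nonzero column vectors $y$ with entries in the corresponding number system ($\mathbb R$, $\mathbb C$ or the quaternions) and $\|\cdot\|$ the Euclidean norm ($\|y\|^2$ is the sum of the squares of all real components of $y$). Equivalently, by Oseledec's theorem, $e^{\mu_1}$ is the largest eigenvalue of $\lim_{m\to\infty}(P_m^\dagger P_m)^{1/2m}$. *)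

theory Defs
  imports "HOL-Probability.Probability"
begin

section \<open>Quaternions\<close>

datatype quat = Quat (qRe: real) (qI: real) (qJ: real) (qK: real)

lemma quat_eq_iff: "x = y \<longleftrightarrow> qRe x = qRe y \<and> qI x = qI y \<and> qJ x = qJ y \<and> qK x = qK y"
  by (cases x; cases y) simp

instantiation quat :: ring_1
begin

definition "0 = Quat 0 0 0 0"
definition "1 = Quat 1 0 0 0"
definition "x + y = Quat (qRe x + qRe y) (qI x + qI y) (qJ x + qJ y) (qK x + qK y)"
definition "- x = Quat (- qRe x) (- qI x) (- qJ x) (- qK x)"
definition "x - y = Quat (qRe x - qRe y) (qI x - qI y) (qJ x - qJ y) (qK x - qK y)"
definition "x * y = Quat
  (qRe x * qRe y - qI x * qI y - qJ x * qJ y - qK x * qK y)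
  (qRe x * qI y + qI x * qRe y + qJ x * qK y - qK x * qJ y)
  (qRe x * qJ y - qI x * qK y + qJ x * qRe y + qK x * qI y)
  (qRe x * qK y + qI x * qJ y - qJ x * qI y + qK x * qRe y)"

instance
  by standard
    (simp_all add: quat_eq_iff zero_quat_def one_quat_def plus_quat_def uminus_quat_def
      minus_quat_def times_quat_def algebra_simps)

end

instantiation quat :: real_algebra_1
begin

definition "r *\<^sub>R x = Quat (r * qRe x) (r * qI x) (r * qJ x) (r * qK x)"

instance
  by standard
    (simp_all add: quat_eq_iff plus_quat_def times_quat_def scaleR_quat_def algebra_simps)

end

instantiation quat :: real_inner
begin

definition "x \<bullet> y = qRe x * qRe y + qI x * qI y + qJ x * qJ y + qK x * qK y"
definition "norm x = sqrt ((x::quat) \<bullet> x)"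
definition "sgn x = x /\<^sub>R norm (x::quat)"
definition "dist x y = norm (x - y :: quat)"
definition [code del]:
  "(uniformity :: (quat \<times> quat) filter) = (INF e\<in>{0 <..}. principal {(x, y). dist x y < e})"
definition [code del]:
  "open (U :: quat set) \<longleftrightarrow> (\<forall>x\<in>U. eventually (\<lambda>(x', y). x' = x \<longrightarrow> y \<in> U) uniformity)"

instance
proof
  fix x y z :: quat and r :: real
  show "0 \<le> x \<bullet> x"
    by (simp add: inner_quat_def)
  show "x \<bullet> x = 0 \<longleftrightarrow> x = 0"
    by (simp add: inner_quat_def quat_eq_iff zero_quat_def add_nonneg_eq_0_iff)
  show "x \<bullet> y = y \<bullet> x"
    by (simp add: inner_quat_def mult.commute)
  show "(x + y) \<bullet> z = x \<bullet> z + y \<bullet> z"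
    by (simp add: inner_quat_def plus_quat_def algebra_simps)
  show "(r *\<^sub>R x) \<bullet> y = r * (x \<bullet> y)"
    by (simp add: inner_quat_def scaleR_quat_def algebra_simps)
qed (fact norm_quat_def sgn_quat_def dist_quat_def uniformity_quat_def open_quat_def)+

end

instantiation quat :: euclidean_space
begin

definition "Basis = {Quat 1 0 0 0, Quat 0 1 0 0, Quat 0 0 1 0, Quat 0 0 0 1}"

instance
proof
  fix u v x :: quat
  show "(Basis :: quat set) \<noteq> {}" "finite (Basis :: quat set)"
    by (simp_all add: Basis_quat_def)
  show "u \<in> Basis \<Longrightarrow> v \<in> Basis \<Longrightarrow> u \<bullet> v = (if u = v then 1 else 0)"
    unfolding Basis_quat_def by (elim insertE emptyE; simp add: inner_quat_def)
  show "(\<forall>u\<in>Basis. x \<bullet> u = 0) \<longleftrightarrow> x = 0"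
    by (cases x) (auto simp: Basis_quat_def inner_quat_def zero_quat_def)
qed

end


section \<open>Gaussian random matrices and independent copies\<close>

text \<open>The real components of an entry are its coordinates with respect to \<^term>\<open>Basis\<close>, that is
  the standard basis \<open>{1}\<close>, \<open>{1, i}\<close> or \<open>{1, i, j, k}\<close> for real, complex or quaternion entries.\<close>

definition gaussian_matrix ::
    "'v measure \<Rightarrow> real \<Rightarrow> ('v \<Rightarrow> 'a::euclidean_space ^ 'n ^ 'n) \<Rightarrow> bool" where
  "gaussian_matrix M \<sigma> X \<longleftrightarrow>
    prob_space M \<and>
    prob_space.indep_vars M (\<lambda>_. borel) (\<lambda>(i, j, b) \<omega>. (X \<omega> $ i $ j) \<bullet> b) (UNIV \<times> UNIV \<times> Basis) \<and>
    (\<forall>i j. \<forall>b\<in>Basis. distributed M lborel (\<lambda>\<omega>. (X \<omega> $ i $ j) \<bullet> b) (normal_density 0 \<sigma>))"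

text \<open>\<open>Z\<close> may live on a different probability space; the copies are numbered from \<open>1\<close>.\<close>

definition indep_copies ::
    "'w measure \<Rightarrow> (nat \<Rightarrow> 'w \<Rightarrow> 'b::topological_space) \<Rightarrow> 'v measure \<Rightarrow> ('v \<Rightarrow> 'b) \<Rightarrow> bool" where
  "indep_copies M Y M' Z \<longleftrightarrow>
    prob_space M \<and>
    prob_space.indep_vars M (\<lambda>_. borel) Y {1..} \<and>
    (\<forall>i\<ge>1. distr M borel (Y i) = distr M' borel Z)"


section \<open>Largest Lyapunov exponent\<close>

primrec matrix_prod :: "(nat \<Rightarrow> 'a::semiring_1 ^ 'n ^ 'n) \<Rightarrow> nat \<Rightarrow> 'a ^ 'n ^ 'n" where
  "matrix_prod A 0 = mat 1"
| "matrix_prod A (Suc m) = A (Suc m) ** matrix_prod A m"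

definition growth_rate ::
    "(nat \<Rightarrow> 'a::{semiring_1, real_normed_vector} ^ 'n ^ 'n) \<Rightarrow> 'a ^ 'n \<Rightarrow> nat \<Rightarrow> real" where
  "growth_rate P y m = 1 / real m * ln (norm (P m *v y))"

text \<open>The first two conjuncts say that the limits and their supremum exist, so that the
  total operators \<^const>\<open>lim\<close> and \<^const>\<open>Sup\<close> have their intended meaning in the third.\<close>

definition has_largest_lyapunov_exponent ::
    "(nat \<Rightarrow> 'a::{semiring_1, real_normed_vector} ^ 'n ^ 'n) \<Rightarrow> real \<Rightarrow> bool" where
  "has_largest_lyapunov_exponent P \<mu> \<longleftrightarrow>
    (\<forall>y. y \<noteq> 0 \<longrightarrow> convergent (growth_rate P y)) \<and>
    bdd_above ((\<lambda>y. lim (growth_rate P y)) ` {y. y \<noteq> 0}) \<and>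
    \<mu> = (SUP y\<in>{y. y \<noteq> 0}. lim (growth_rate P y))"


section \<open>Modified Bessel function and the density\<close>

text \<open>Series of the modified Bessel function of the first kind, for \<open>x > 0\<close>. The reciprocal
  Gamma function \<^const>\<open>rGamma\<close> vanishes at the poles of Gamma. Since \<open>0 powr 0 = 0\<close>,
  the value at \<open>x = 0\<close> is wrong for \<open>\<nu> = 0\<close>.\<close>

definition bessel_I :: "real \<Rightarrow> real \<Rightarrow> real" where
  "bessel_I \<nu> x = (\<Sum>m. (x / 2) powr (2 * real m + \<nu>) * rGamma (real m + \<nu> + 1) / fact m)"

definition noncentral_chisq_density :: "real \<Rightarrow> real \<Rightarrow> real \<Rightarrow> real" where
  "noncentral_chisq_density t k l =
    1 / 2 * exp (- (t + l) / 2) * (t / l) powr (k / 4 - 1 / 2) * bessel_I (k / 2 - 1) (sqrt (l * t))"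

end

theory Submission
  imports Defs
begin

text \<open>For a flag of coordinate subspaces let \<open>D k A\<close> be the distance of the \<open>k\<close>-th column of \<open>A\<close> from
  the span of the earlier ones, that is, the \<open>k\<close>-th diagonal entry of the triangular factor of \<open>A\<close>.
  Since the law of \<open>I + X/c\<close> is invariant under conjugation by isometries, \<open>D k (Y P)\<close> is distributed
  like \<open>D k Y * D k P\<close> for every fixed invertible \<open>P\<close>; hence the moments of \<open>D k P\<^sub>m\<close> are \<open>m\<close>-th powers, and
  Chernoff's bound gives \<open>1/m * ln (D k P\<^sub>m) \<longrightarrow> E (ln (D k Y))\<close> almost surely. A triangular product whose
  diagonal has exact growth rates, and whose factors grow subexponentially, is Lyapunov regular: every vector
  then has one of these growth rates. This yields the limit for all \<open>y\<close> simultaneously without the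
  multiplicative ergodic theorem. The largest rate belongs to the first vector of the flag; it is
  \<open>E (ln (norm (Y e)))\<close>, and \<open>l * (norm (Y e))\<^sup>2\<close> has the noncentral chi-squared law.\<close>


text \<open>For one fixed \<open>y\<close>, isotropy turns the limit into a law of large numbers,
  but its exceptional null set depends on \<open>y\<close>, while the claim needs one null set for
  uncountably many \<open>y\<close>. Hence probability is applied only to the finitely many pivots
  and to the size of each factor; everything about \<open>y\<close> is deterministic on the
  resulting event. The distance of a column from the earlier ones is encoded as an infimum over
  vectors with leading coordinate 1. This involves no determinants and no commutativity, so one
  argument covers all three number systems. The rates along the flag come in no prescribed order.
  Correcting vectors along the flag produces series whose terms have rate \<delta> of either sign:
  for \<delta> < 0 the sum is taken as limit, otherwise 0 is, and the error has rate \<delta> in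
  both cases. Chernoff's bound needs an exponential moment of |ln pivot|. Given the other columns, a
  pivot is at least |a + c N| with N one real normal variable. Since |y| to the power -1/2 is
  integrable at 0 and |y| to the power -1 is not, the moment of order 1/2 is used.\<close>

section \<open>Exponential growth rates\<close>

text \<open>This is limsup of 1/m * ln |f m| at most \<open>\<mu>\<close>, written without
  logarithms so that zeros of \<open>f\<close> cause no trouble. The constant absorbs the small
  \<open>m\<close>, which is why the bound can be asked for all \<open>m\<close>.\<close>

definition exp_bounded :: "(nat \<Rightarrow> real) \<Rightarrow> real \<Rightarrow> bool" where
  "exp_bounded f \<mu> \<longleftrightarrow> (\<forall>\<epsilon>>0. \<exists>C. \<forall>m. \<bar>f m\<bar> \<le> C * exp ((\<mu> + \<epsilon>) * real m))"

lemma exp_boundedE: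
  assumes "exp_bounded f \<mu>" "\<epsilon> > 0"
  obtains C where "C > 0" "\<And>m. \<bar>f m\<bar> \<le> C * exp ((\<mu> + \<epsilon>) * real m)"
proof -
  obtain C where C: "\<And>m. \<bar>f m\<bar> \<le> C * exp ((\<mu> + \<epsilon>) * real m)"
    using assms unfolding exp_bounded_def by meson
  have "\<bar>f m\<bar> \<le> (\<bar>C\<bar> + 1) * exp ((\<mu> + \<epsilon>) * real m)" for m
    by (rule order_trans[OF C]) (intro mult_right_mono, auto)
  then show ?thesis using that[of "\<bar>C\<bar> + 1"] by auto
qed

text \<open>Larger \<epsilon> only weaken the bound. The restriction to small \<epsilon> keeps
  \<open>\<mu> + \<epsilon>\<close> negative where a convergent geometric series is wanted.\<close>

lemma exp_boundedI_small:
  assumes "\<epsilon>0 > 0" "\<And>\<epsilon>. 0 < \<epsilon> \<Longrightarrow> \<epsilon> < \<epsilon>0 \<Longrightarrow> \<exists>C. \<forall>m. \<bar>f m\<bar> \<le> C * exp ((\<mu> + \<epsilon>) * real m)"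
  shows "exp_bounded f \<mu>"
  unfolding exp_bounded_def
proof (intro allI impI)
  fix \<epsilon> :: real assume "\<epsilon> > 0"
  define d where "d = min \<epsilon> (\<epsilon>0 / 2)"
  have "0 < d" "d < \<epsilon>0" "d \<le> \<epsilon>" using \<open>\<epsilon> > 0\<close> assms(1) by (auto simp: d_def)
  obtain C where C: "\<And>m. \<bar>f m\<bar> \<le> C * exp ((\<mu> + d) * real m)"
    using assms(2)[OF \<open>0 < d\<close> \<open>d < \<epsilon>0\<close>] by auto
  have C0: "C \<ge> 0" using C[of 0] by simp
  have "\<bar>f m\<bar> \<le> C * exp ((\<mu> + \<epsilon>) * real m)" for m
    by (rule order_trans[OF C]) (intro mult_left_mono C0, auto intro!: mult_right_mono \<open>d \<le> \<epsilon>\<close>)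
  then show "\<exists>C. \<forall>m. \<bar>f m\<bar> \<le> C * exp ((\<mu> + \<epsilon>) * real m)" by auto
qed

lemma exp_bounded_mono:
  assumes "exp_bounded f \<mu>" "\<mu> \<le> \<nu>"
  shows "exp_bounded f \<nu>"
  unfolding exp_bounded_def
proof (intro allI impI)
  fix \<epsilon> :: real assume "\<epsilon> > 0"
  then obtain C where C: "C > 0" "\<And>m. \<bar>f m\<bar> \<le> C * exp ((\<mu> + \<epsilon>) * real m)"
    using exp_boundedE[OF assms(1)] by blast
  have "\<bar>f m\<bar> \<le> C * exp ((\<nu> + \<epsilon>) * real m)" for m
    by (rule order_trans[OF C(2)])
      (use C(1) assms(2) in \<open>intro mult_left_mono, auto intro!: mult_right_mono\<close>)
  then show "\<exists>C. \<forall>m. \<bar>f m\<bar> \<le> C * exp ((\<nu> + \<epsilon>) * real m)" by auto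
qed

lemma exp_bounded_le:
  assumes "exp_bounded g \<mu>" "\<And>m. \<bar>f m\<bar> \<le> g m"
  shows "exp_bounded f \<mu>"
  unfolding exp_bounded_def
proof (intro allI impI)
  fix \<epsilon> :: real assume "\<epsilon> > 0"
  then obtain C where C: "C > 0" "\<And>m. \<bar>g m\<bar> \<le> C * exp ((\<mu> + \<epsilon>) * real m)"
    using exp_boundedE[OF assms(1)] by blast
  have "\<bar>f m\<bar> \<le> C * exp ((\<mu> + \<epsilon>) * real m)" for m
    using assms(2)[of m] C(2)[of m] by linarith
  then show "\<exists>C. \<forall>m. \<bar>f m\<bar> \<le> C * exp ((\<mu> + \<epsilon>) * real m)" by auto
qed

lemma exp_bounded_const: "exp_bounded (\<lambda>_. c) 0"
  unfolding exp_bounded_def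
proof (intro allI impI exI)
  fix \<epsilon> :: real and m assume "\<epsilon> > 0"
  then have "\<bar>c\<bar> * 1 \<le> \<bar>c\<bar> * exp ((0 + \<epsilon>) * real m)"
    by (intro mult_left_mono) auto
  then show "\<bar>c\<bar> \<le> \<bar>c\<bar> * exp ((0 + \<epsilon>) * real m)" by simp
qed

lemma exp_bounded_add:
  assumes "exp_bounded f \<mu>" "exp_bounded g \<mu>"
  shows "exp_bounded (\<lambda>m. f m + g m) \<mu>"
  unfolding exp_bounded_def
proof (intro allI impI)
  fix \<epsilon> :: real assume "\<epsilon> > 0"
  obtain C where C: "C > 0" "\<And>m. \<bar>f m\<bar> \<le> C * exp ((\<mu> + \<epsilon>) * real m)"
    using exp_boundedE[OF assms(1) \<open>\<epsilon> > 0\<close>] by blast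
  obtain D where D: "D > 0" "\<And>m. \<bar>g m\<bar> \<le> D * exp ((\<mu> + \<epsilon>) * real m)"
    using exp_boundedE[OF assms(2) \<open>\<epsilon> > 0\<close>] by blast
  have "\<bar>f m + g m\<bar> \<le> (C + D) * exp ((\<mu> + \<epsilon>) * real m)" for m
    using C(2)[of m] D(2)[of m] by (simp add: distrib_right)
  then show "\<exists>C. \<forall>m. \<bar>f m + g m\<bar> \<le> C * exp ((\<mu> + \<epsilon>) * real m)" by auto
qed

lemma exp_bounded_mult:
  assumes "exp_bounded f \<mu>" "exp_bounded g \<nu>"
  shows "exp_bounded (\<lambda>m. f m * g m) (\<mu> + \<nu>)"
  unfolding exp_bounded_def
proof (intro allI impI)
  fix \<epsilon> :: real assume "\<epsilon> > 0"
  then have e: "\<epsilon> / 2 > 0" by simp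
  obtain C where C: "C > 0" "\<And>m. \<bar>f m\<bar> \<le> C * exp ((\<mu> + \<epsilon> / 2) * real m)"
    using exp_boundedE[OF assms(1) e] by blast
  obtain D where D: "D > 0" "\<And>m. \<bar>g m\<bar> \<le> D * exp ((\<nu> + \<epsilon> / 2) * real m)"
    using exp_boundedE[OF assms(2) e] by blast
  have "\<bar>f m * g m\<bar> \<le> (C * D) * exp ((\<mu> + \<nu> + \<epsilon>) * real m)" for m
  proof -
    have "\<bar>f m * g m\<bar> \<le> (C * exp ((\<mu> + \<epsilon> / 2) * real m)) * (D * exp ((\<nu> + \<epsilon> / 2) * real m))"
      unfolding abs_mult using C D by (intro mult_mono) auto
    also have "\<dots> = (C * D) * exp ((\<mu> + \<epsilon> / 2) * real m + (\<nu> + \<epsilon> / 2) * real m)"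
      by (simp add: exp_add)
    also have "(\<mu> + \<epsilon> / 2) * real m + (\<nu> + \<epsilon> / 2) * real m = (\<mu> + \<nu> + \<epsilon>) * real m"
      by (simp add: field_simps)
    finally show ?thesis .
  qed
  then show "\<exists>C. \<forall>m. \<bar>f m * g m\<bar> \<le> C * exp ((\<mu> + \<nu> + \<epsilon>) * real m)" by blast
qed

lemma exp_bounded_cmult: "exp_bounded f \<mu> \<Longrightarrow> exp_bounded (\<lambda>m. c * f m) \<mu>"
  using exp_bounded_mult[OF exp_bounded_const[of c]] by simp

lemma exp_bounded_sum:
  assumes "finite I" "I \<noteq> {}" "\<And>i. i \<in> I \<Longrightarrow> exp_bounded (f i) \<mu>"
  shows "exp_bounded (\<lambda>m. \<Sum>i\<in>I. f i m) \<mu>"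
  using assms by (induction I rule: finite_ne_induct) (auto intro!: exp_bounded_add)

lemma exp_bounded_zero: "exp_bounded (\<lambda>_. 0) \<mu>"
  unfolding exp_bounded_def by (intro allI impI exI[of _ 0]) simp

text \<open>A shift costs a factor \<open>exp \<bar>\<mu> + \<epsilon>\<bar>\<close>, with the
  absolute value because the rate may have either sign. At \<open>m = 0\<close> truncated
  subtraction gives \<open>f 0\<close>.\<close>

lemma exp_bounded_pred:
  assumes "exp_bounded f \<mu>"
  shows "exp_bounded (\<lambda>m. f (m - 1)) \<mu>"
  unfolding exp_bounded_def
proof (intro allI impI)
  fix \<epsilon> :: real assume "\<epsilon> > 0"
  obtain C where C: "C > 0" "\<And>m. \<bar>f m\<bar> \<le> C * exp ((\<mu> + \<epsilon>) * real m)"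
    using exp_boundedE[OF assms(1) \<open>\<epsilon> > 0\<close>] by blast
  have "\<bar>f (m - 1)\<bar> \<le> (C * exp \<bar>\<mu> + \<epsilon>\<bar>) * exp ((\<mu> + \<epsilon>) * real m)" for m
  proof (cases m)
    case 0
    have "\<bar>f 0\<bar> \<le> C * 1" using C(2)[of 0] by simp
    also have "\<dots> \<le> C * exp \<bar>\<mu> + \<epsilon>\<bar>" using C(1) by (intro mult_left_mono) auto
    finally show ?thesis using 0 by simp
  next
    case (Suc k)
    have "\<bar>f k\<bar> \<le> C * exp ((\<mu> + \<epsilon>) * real k)" by (rule C)
    also have "\<dots> \<le> C * exp (\<bar>\<mu> + \<epsilon>\<bar> + (\<mu> + \<epsilon>) * real m)"
      using C(1) Suc by (intro mult_left_mono) (auto simp: algebra_simps)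
    finally show ?thesis using Suc by (simp add: exp_add)
  qed
  then show "\<exists>C. \<forall>m. \<bar>f (m - 1)\<bar> \<le> C * exp ((\<mu> + \<epsilon>) * real m)" by blast
qed

lemma sum_exp_le:
  fixes \<theta> :: real
  assumes "\<theta> > 0"
  shows "(\<Sum>s\<le>m. exp (\<theta> * real s)) \<le> exp (\<theta> * real m) / (1 - exp (- \<theta>))"
proof (induction m)
  case 0
  then show ?case using assms by (simp add: field_simps)
next
  case (Suc m)
  have p: "1 - exp (- \<theta>) > 0" using assms by simp
  have e: "exp (\<theta> * real m) = exp (\<theta> * real (Suc m)) * exp (- \<theta>)"
    by (simp add: exp_add[symmetric] algebra_simps)
  have "(\<Sum>s\<le>Suc m. exp (\<theta> * real s)) \<le> exp (\<theta> * real m) / (1 - exp (- \<theta>)) + exp (\<theta> * real (Suc m))"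
    using Suc by simp
  also have "\<dots> = exp (\<theta> * real (Suc m)) / (1 - exp (- \<theta>))"
    unfolding e using p by (simp add: field_simps)
  finally show ?case .
qed

text \<open>For \<delta> \<ge> 0 a geometric sum is comparable to its last term, so the partial sums
  have rate \<delta> and \<open>L = 0\<close> serves. For \<delta> < 0 the series converges,
  \<open>L\<close> is its sum and the error is a geometric tail.\<close>

lemma exp_bounded_partial_sum:
  fixes c :: "nat \<Rightarrow> 'b::banach"
  assumes c: "exp_bounded (\<lambda>m. norm (c m)) \<delta>"
  shows "\<exists>L. exp_bounded (\<lambda>m. norm (L - (\<Sum>s\<le>m. c s))) \<delta>"
proof (cases "\<delta> \<ge> 0")
  case True
  have "exp_bounded (\<lambda>m. norm (0 - (\<Sum>s\<le>m. c s))) \<delta>"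
    unfolding exp_bounded_def
  proof (intro allI impI)
    fix \<epsilon> :: real assume e: "\<epsilon> > 0"
    obtain C where C: "C > 0" "\<And>m. \<bar>norm (c m)\<bar> \<le> C * exp ((\<delta> + \<epsilon>) * real m)"
      using exp_boundedE[OF c e] by blast
    have "\<bar>norm (0 - (\<Sum>s\<le>m. c s))\<bar> \<le> (C / (1 - exp (- (\<delta> + \<epsilon>)))) * exp ((\<delta> + \<epsilon>) * real m)" for m
    proof -
      have "\<bar>norm (0 - (\<Sum>s\<le>m. c s))\<bar> \<le> (\<Sum>s\<le>m. norm (c s))" by (simp add: norm_sum)
      also have "\<dots> \<le> (\<Sum>s\<le>m. C * exp ((\<delta> + \<epsilon>) * real s))"
        using C(2) by (intro sum_mono) auto
      also have "\<dots> = C * (\<Sum>s\<le>m. exp ((\<delta> + \<epsilon>) * real s))" by (simp add: sum_distrib_left)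
      also have "\<dots> \<le> C * (exp ((\<delta> + \<epsilon>) * real m) / (1 - exp (- (\<delta> + \<epsilon>))))"
        using C(1) True e by (intro mult_left_mono sum_exp_le) auto
      finally show ?thesis by simp
    qed
    then show "\<exists>C. \<forall>m. \<bar>norm (0 - (\<Sum>s\<le>m. c s))\<bar> \<le> C * exp ((\<delta> + \<epsilon>) * real m)" by blast
  qed
  then show ?thesis by blast
next
  case False
  have geo: "summable (\<lambda>m. C * exp ((\<delta> + \<epsilon>) * real m))" if "\<delta> + \<epsilon> < 0" for C \<epsilon>
  proof -
    have "exp ((\<delta> + \<epsilon>) * real m) = exp (\<delta> + \<epsilon>) ^ m" for m
      by (simp add: exp_of_nat_mult[symmetric] mult.commute)
    then show ?thesis using that by (intro summable_mult) (simp add: summable_geometric)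
  qed
  have sm: "summable (\<lambda>m. norm (c m))"
  proof -
    \<comment> \<open>The choice \<epsilon> = -\<delta>/2 leaves the rate \<delta>/2, which is still
      negative.\<close>
    obtain C where C: "C > 0" "\<And>m. \<bar>norm (c m)\<bar> \<le> C * exp ((\<delta> + - \<delta> / 2) * real m)"
      using exp_boundedE[OF c, of "- \<delta> / 2"] False by auto
    show ?thesis
      by (rule summable_comparison_test'[OF geo[of "- \<delta> / 2" C]]) (use C False in auto)
  qed
  have "exp_bounded (\<lambda>m. norm (suminf c - (\<Sum>s\<le>m. c s))) \<delta>"
  proof (rule exp_boundedI_small[of "- \<delta>"])
    show "0 < - \<delta>" using False by simp
    fix \<epsilon> :: real assume e: "\<epsilon> > 0" "\<epsilon> < - \<delta>"
    obtain C where C: "C > 0" "\<And>m. \<bar>norm (c m)\<bar> \<le> C * exp ((\<delta> + \<epsilon>) * real m)"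
      using exp_boundedE[OF c e(1)] by blast
    have "\<bar>norm (suminf c - (\<Sum>s\<le>m. c s))\<bar> \<le> (C * suminf (\<lambda>k. exp ((\<delta> + \<epsilon>) * real k))) * exp ((\<delta> + \<epsilon>) * real m)" for m
    proof -
      have sc: "summable (\<lambda>k. C * exp ((\<delta> + \<epsilon>) * real m) * exp ((\<delta> + \<epsilon>) * real k))"
        by (rule geo) (use e in auto)
      have tail: "norm (c (k + Suc m)) \<le> C * exp ((\<delta> + \<epsilon>) * real m) * exp ((\<delta> + \<epsilon>) * real k)" for k
      proof -
        have "norm (c (k + Suc m)) \<le> C * exp ((\<delta> + \<epsilon>) * real (k + Suc m))"
          using C(2)[of "k + Suc m"] by simp
        also have "\<dots> \<le> C * exp ((\<delta> + \<epsilon>) * real m + (\<delta> + \<epsilon>) * real k)"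
          using C(1) e by (intro mult_left_mono) (auto simp: algebra_simps)
        finally show ?thesis by (simp add: exp_add mult_ac)
      qed
      have ssm: "summable (\<lambda>k. norm (c (k + Suc m)))"
        using sm by (subst summable_iff_shift)
      have "suminf c - (\<Sum>s\<le>m. c s) = (\<Sum>k. c (k + Suc m))"
        using suminf_split_initial_segment[OF summable_norm_cancel[OF sm], of "Suc m"]
        by (simp add: lessThan_Suc_atMost)
      then have "norm (suminf c - (\<Sum>s\<le>m. c s)) \<le> (\<Sum>k. norm (c (k + Suc m)))"
        using summable_norm[OF ssm] by simp
      also have "\<dots> \<le> (\<Sum>k. C * exp ((\<delta> + \<epsilon>) * real m) * exp ((\<delta> + \<epsilon>) * real k))"
        by (rule suminf_le[OF tail ssm sc])
      also have "\<dots> = C * exp ((\<delta> + \<epsilon>) * real m) * (\<Sum>k. exp ((\<delta> + \<epsilon>) * real k))"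
        using geo[of \<epsilon> 1] e by (intro suminf_mult) auto
      finally show ?thesis by (simp add: mult_ac)
    qed
    then show "\<exists>C. \<forall>m. \<bar>norm (suminf c - (\<Sum>s\<le>m. c s))\<bar> \<le> C * exp ((\<delta> + \<epsilon>) * real m)" by blast
  qed
  then show ?thesis by blast
qed

lemma exp_bounded_limit_ln:
  assumes f: "exp_bounded f \<mu>" "exp_bounded (\<lambda>m. 1 / f m) (- \<mu>)" and pos: "\<And>m. f m > 0"
  shows "(\<lambda>m. 1 / real m * ln (f m)) \<longlonglongrightarrow> \<mu>"
proof (rule LIMSEQ_I)
  fix e :: real assume "e > 0"
  then have e: "e / 3 > 0" by simp
  obtain C where C: "C > 0" "\<And>m. \<bar>f m\<bar> \<le> C * exp ((\<mu> + e / 3) * real m)"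
    using exp_boundedE[OF f(1) e] by blast
  obtain D where D: "D > 0" "\<And>m. \<bar>1 / f m\<bar> \<le> D * exp ((- \<mu> + e / 3) * real m)"
    using exp_boundedE[OF f(2) e] by blast
  \<comment> \<open>Beyond \<open>m0\<close> the constants cost less than \<open>e / 3 * m\<close>,
    and the rates cost another \<open>e / 3 * m\<close>.\<close>
  obtain m0 :: nat where m0: "(\<bar>ln C\<bar> + \<bar>ln D\<bar>) / (e / 3) < m0" using reals_Archimedean2 by blast
  show "\<exists>no. \<forall>m\<ge>no. norm (1 / real m * ln (f m) - \<mu>) < e"
  proof (intro exI allI impI)
    fix m assume m: "m \<ge> Suc m0"
    then have mp: "real m > 0" by simp
    have "(\<bar>ln C\<bar> + \<bar>ln D\<bar>) < e / 3 * m0" using m0 e by (simp add: field_simps)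
    also have "\<dots> \<le> e / 3 * m" using m e by (intro mult_left_mono) auto
    finally have b: "\<bar>ln C\<bar> + \<bar>ln D\<bar> < e / 3 * m" .
    have "ln (f m) \<le> ln (C * exp ((\<mu> + e / 3) * real m))"
      using C(1) C(2)[of m] pos[of m] by (subst ln_le_cancel_iff) auto
    then have u: "ln (f m) \<le> ln C + (\<mu> + e / 3) * m" using C(1) by (simp add: ln_mult)
    have "ln (1 / f m) \<le> ln (D * exp ((- \<mu> + e / 3) * real m))"
      using D(1) D(2)[of m] pos[of m] by (subst ln_le_cancel_iff) auto
    then have l: "- ln (f m) \<le> ln D + (- \<mu> + e / 3) * m" using D(1) pos[of m] by (simp add: ln_mult ln_div)
    have "\<bar>ln (f m) - \<mu> * m\<bar> < e * m"
    proof -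
      have "0 < e * m" using e mp by simp
      moreover have "ln (f m) \<le> ln C + \<mu> * m + e * m / 3" using u by (simp add: algebra_simps)
      moreover have "- ln (f m) \<le> ln D - \<mu> * m + e * m / 3" using l by (simp add: algebra_simps)
      moreover have "\<bar>ln C\<bar> + \<bar>ln D\<bar> < e * m / 3" using b by simp
      ultimately show ?thesis by linarith
    qed
    moreover have "1 / real m * ln (f m) - \<mu> = (ln (f m) - \<mu> * m) / m" using mp by (simp add: field_simps)
    ultimately show "norm (1 / real m * ln (f m) - \<mu>) < e" using mp by (simp add: field_simps)
  qed
qed

section \<open>Right scalar multiplication, coordinate flags and pivots\<close>

definition vmult :: "'a::times ^ 'n \<Rightarrow> 'a \<Rightarrow> 'a ^ 'n" where
  "vmult x c = (\<chi> i. x $ i * c)"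

lemma vmult_nth [simp]: "vmult x c $ i = x $ i * c"
  by (simp add: vmult_def)

lemma norm_vmult:
  fixes x :: "'a::real_normed_div_algebra ^ 'n"
  shows "norm (vmult x c) = norm x * norm c"
  unfolding norm_vec_def by (simp add: norm_mult L2_set_left_distrib)

text \<open>Matrices act from the left and scalars from the right, so the two commute by
  associativity alone, also over the quaternions.\<close>

lemma matrix_vector_mult_vmult:
  fixes A :: "'a::semiring_1 ^ 'n ^ 'm"
  shows "A *v vmult x c = vmult (A *v x) c"
  by (simp add: vec_eq_iff matrix_vector_mult_def sum_distrib_right mult.assoc)

lemma matrix_vector_mult_sum:
  fixes A :: "'a::ring_1 ^ 'n ^ 'm"
  shows "A *v (\<Sum>i\<in>I. f i) = (\<Sum>i\<in>I. A *v f i)"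
  by (induction I rule: infinite_finite_induct) (auto simp: matrix_vector_right_distrib)

definition below :: "('n \<Rightarrow> nat) \<Rightarrow> nat \<Rightarrow> ('a::zero ^ 'n) set" where
  "below r n = {x. \<forall>j. n \<le> r j \<longrightarrow> x $ j = 0}"

text \<open>For injective \<open>r\<close> this is \<open>axis k 1\<close> plus
  \<open>below r (r k)\<close>, so its image under \<open>A\<close> is the \<open>k\<close>-th
  column plus the right span of the columns of smaller rank. The ranking \<open>r\<close> is a
  parameter because any chosen coordinate must later be placed first.\<close>

definition lead :: "('n \<Rightarrow> nat) \<Rightarrow> 'n \<Rightarrow> ('a::zero_neq_one ^ 'n) set" where
  "lead r k = {x. x $ k = 1 \<and> (\<forall>j. r k < r j \<longrightarrow> x $ j = 0)}"

definition pivot :: "('n \<Rightarrow> nat) \<Rightarrow> 'n \<Rightarrow> 'a::real_normed_div_algebra ^ 'n ^ 'n \<Rightarrow> real" where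
  "pivot r k A = (INF x\<in>lead r k. norm (A *v x))"

lemma axis_in_lead: "axis k 1 \<in> lead r k"
  by (auto simp: lead_def axis_def)

lemma pivot_bdd: "bdd_below ((\<lambda>x. norm (A *v x)) ` S)"
  for A :: "'a::real_normed_div_algebra ^ 'n ^ 'n"
  by (rule bdd_belowI[of _ 0]) auto

lemma pivot_nonneg: "pivot r k A \<ge> 0"
  unfolding pivot_def using axis_in_lead by (intro cINF_greatest) auto

lemma pivot_le_lead: "x \<in> lead r k \<Longrightarrow> pivot r k A \<le> norm (A *v x)"
  unfolding pivot_def by (rule cINF_lower[OF pivot_bdd])

text \<open>If the coordinate \<open>x $ k\<close> is nonzero, dividing by it on the right puts
  \<open>x\<close> into \<open>lead r k\<close>.\<close>

lemma pivot_le: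
  fixes A :: "'a::real_normed_div_algebra ^ 'n ^ 'n"
  assumes "x \<in> below r (Suc (r k))"
  shows "norm (x $ k) * pivot r k A \<le> norm (A *v x)"
proof (cases "x $ k = 0")
  case False
  have "vmult x (inverse (x $ k)) \<in> lead r k"
    using assms False by (auto simp: lead_def below_def)
  from pivot_le_lead[OF this, of A] have "pivot r k A \<le> norm (A *v x) * inverse (norm (x $ k))"
    by (simp add: matrix_vector_mult_vmult norm_vmult norm_inverse)
  then show ?thesis using False by (simp add: field_simps)
qed simp

text \<open>If \<open>t\<close> is the nonzero coordinate of \<open>y\<close> of highest rank, the
  pivot at \<open>t\<close> bounds \<open>norm (A *v y)\<close> from below.\<close>

lemma pivot_pos_imp_inj:
  fixes A :: "'a::real_normed_div_algebra ^ 'n ^ 'n"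
  assumes pivot_pos: "\<And>k. pivot r k A > 0" and y: "y \<noteq> 0"
  shows "A *v y \<noteq> 0"
proof -
  have "{i. y $ i \<noteq> 0} \<noteq> {}" using y by (auto simp: vec_eq_iff)
  then have "Max (r ` {i. y $ i \<noteq> 0}) \<in> r ` {i. y $ i \<noteq> 0}" by (intro Max_in) auto
  then obtain t where t: "y $ t \<noteq> 0" "Max (r ` {i. y $ i \<noteq> 0}) = r t" by blast
  have "y \<in> below r (Suc (r t))"
  proof (unfold below_def, intro CollectI allI impI, rule ccontr)
    fix j assume "Suc (r t) \<le> r j" "y $ j \<noteq> 0"
    moreover from this have "r j \<le> r t" unfolding t(2)[symmetric] by (intro Max_ge) auto
    ultimately show False by simp
  qed
  from pivot_le[OF this, of A] show ?thesis
    using mult_pos_pos[OF _ pivot_pos[of t], of "norm (y $ t)"] t(1) by auto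
qed

text \<open>Vectors whose leading coordinates are 1 at different places form a basis: subtracting
  \<open>vmult (v t) (z $ t)\<close> removes the coordinate of highest rank without creating a
  higher one.\<close>

lemma below_expand:
  fixes v :: "'n::finite \<Rightarrow> 'a::real_normed_div_algebra ^ 'n"
  assumes r: "inj r" and v: "\<And>i. r i < n \<Longrightarrow> v i \<in> lead r i" and z: "z \<in> below r n"
  shows "\<exists>c. z = (\<Sum>i | r i < n. vmult (v i) (c i))"
  using v z
proof (induction n arbitrary: z)
  case 0
  then show ?case by (auto simp: below_def vec_eq_iff)
next
  case (Suc n)
  show ?case
  \<comment> \<open>\<open>r\<close> is only injective, so no index need have rank
    \<open>n\<close>.\<close>
  proof (cases "\<exists>t. r t = n")
    case False
    then have eq: "r i < Suc n \<longleftrightarrow> r i < n" "Suc n \<le> r i \<longleftrightarrow> n \<le> r i" for i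
      by (metis less_Suc_eq, metis Suc_leD le_antisym not_less_eq_eq)
    show ?thesis unfolding eq using Suc.prems by (intro Suc.IH) (auto simp: below_def eq)
  next
    case True
    then obtain t where t: "r t = n" by blast
    have S: "{i. r i < Suc n} = insert t {i. r i < n}"
      using t r by (auto simp: less_Suc_eq dest: injD)
    have "z - vmult (v t) (z $ t) \<in> below r n"
      unfolding below_def
    proof (intro CollectI allI impI)
      fix j assume "n \<le> r j"
      show "(z - vmult (v t) (z $ t)) $ j = 0"
      proof (cases "j = t")
        case True
        then show ?thesis using Suc.prems(1)[of t] t by (auto simp: lead_def)
      next
        case False
        then have "r t < r j" "Suc n \<le> r j" using \<open>n \<le> r j\<close> t r by (metis injD le_neq_implies_less, metis Suc_leI injD le_neq_implies_less t)
        then show ?thesis using Suc.prems(1)[of t] Suc.prems(2) t by (auto simp: lead_def below_def)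
      qed
    qed
    then obtain c where c: "z - vmult (v t) (z $ t) = (\<Sum>i | r i < n. vmult (v i) (c i))"
      using Suc.IH Suc.prems(1) by (metis less_Suc_eq)
    have "(\<Sum>i | r i < Suc n. vmult (v i) ((c(t := z $ t)) i)) =
        vmult (v t) (z $ t) + (\<Sum>i | r i < n. vmult (v i) ((c(t := z $ t)) i))"
      unfolding S using t by (subst sum.insert) auto
    also have "(\<Sum>i | r i < n. vmult (v i) ((c(t := z $ t)) i)) = (\<Sum>i | r i < n. vmult (v i) (c i))"
      using t by (intro sum.cong) auto
    also have "vmult (v t) (z $ t) + \<dots> = z" using c by (simp add: algebra_simps)
    finally show ?thesis by metis
  qed
qed

section \<open>Regularity: one sample path with exact pivot rates and subexponential factors\<close>

locale triangular_exponents =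
  fixes r :: "'n::finite \<Rightarrow> nat" and P :: "nat \<Rightarrow> 'a::{euclidean_space, real_normed_div_algebra} ^ 'n ^ 'n"
    and \<mu> :: "'n \<Rightarrow> real" and a :: "nat \<Rightarrow> real"
  assumes r: "inj r"
    and pivot_pos: "\<And>k m. pivot r k (P m) > 0"
    and upper: "\<And>k. exp_bounded (\<lambda>m. pivot r k (P m)) (\<mu> k)"
    and lower: "\<And>k. exp_bounded (\<lambda>m. 1 / pivot r k (P m)) (- \<mu> k)"
    and step: "\<And>m x. norm (P (Suc m) *v x) \<le> a (Suc m) * norm (P m *v x)"
    and a: "exp_bounded a 0"
begin

text \<open>The coefficients are read off from the top of the flag. The top one is the coordinate
  \<open>z m $ t\<close>, which is at most \<open>norm (P m *v z m)\<close> divided by the pivot,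
  hence of rate \<open>\<nu> - \<mu> t\<close>. Its term has image of rate
  \<open>(\<nu> - \<mu> t) + \<mu> t = \<nu>\<close>, so removing it keeps the hypothesis on
  \<open>z\<close>, and the next coefficient can be read off.\<close>

lemma coefficient_bound:
  assumes v: "\<And>i. r i < n \<Longrightarrow> v i \<in> lead r i"
    and ev: "\<And>i. r i < n \<Longrightarrow> exp_bounded (\<lambda>m. norm (P m *v v i)) (\<mu> i)"
    and z: "\<And>m. z m = (\<Sum>i | r i < n. vmult (v i) (c i m))"
    and ez: "exp_bounded (\<lambda>m. norm (P m *v z m)) \<nu>"
    and i: "r i < n"
  shows "exp_bounded (\<lambda>m. norm (c i m)) (\<nu> - \<mu> i)"
  using v ev z ez i
proof (induction n arbitrary: z i)
  case (Suc n)
  show ?case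
  proof (cases "\<exists>t. r t = n")
    case False
    then have eq: "r i < Suc n \<longleftrightarrow> r i < n" for i by (metis less_Suc_eq)
    show ?thesis by (rule Suc.IH[of z]) (use Suc.prems in \<open>auto simp: eq\<close>)
  next
    case True
    then obtain t where t: "r t = n" by blast
    have S: "{i. r i < Suc n} = insert t {i. r i < n}"
      using t r by (auto simp: less_Suc_eq dest: injD)
    have vt: "v t \<in> lead r t" using Suc.prems(1) t by simp
    have zin: "z m \<in> below r (Suc (r t))" for m
      unfolding below_def
    proof (intro CollectI allI impI)
      fix j assume "Suc (r t) \<le> r j"
      then have "v i $ j = 0" if "r i < Suc n" for i
        using Suc.prems(1)[OF that] that t by (auto simp: lead_def)
      then show "z m $ j = 0" unfolding Suc.prems(3) by (auto simp: sum_component intro!: sum.neutral)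
    qed
    have zt: "z m $ t = c t m" for m
    proof -
      have "(\<Sum>i | r i < n. vmult (v i) (c i m)) $ t = 0"
        using Suc.prems(1) t by (auto simp: sum_component lead_def intro!: sum.neutral)
      then show ?thesis unfolding Suc.prems(3) S using t vt by (subst sum.insert) (auto simp: lead_def)
    qed
    have ct: "exp_bounded (\<lambda>m. norm (c t m)) (\<nu> - \<mu> t)"
    proof -
      have "exp_bounded (\<lambda>m. norm (P m *v z m) * (1 / pivot r t (P m))) (\<nu> + - \<mu> t)"
        by (intro exp_bounded_mult Suc.prems lower)
      then show ?thesis
      proof (rule exp_bounded_le[OF exp_bounded_mono])
        fix m show "\<bar>norm (c t m)\<bar> \<le> norm (P m *v z m) * (1 / pivot r t (P m))"
          using pivot_le[OF zin, of m "P m"] pivot_pos[of t m] by (simp add: zt field_simps)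
      qed simp
    qed
    define z' where "z' m = z m - vmult (v t) (c t m)" for m
    have z': "z' m = (\<Sum>i | r i < n. vmult (v i) (c i m))" for m
      unfolding z'_def Suc.prems(3) S using t by (subst sum.insert) auto
    have "exp_bounded (\<lambda>m. norm (P m *v z m) + norm (P m *v v t) * norm (c t m)) \<nu>"
      using exp_bounded_mult[OF Suc.prems(2)[of t] ct] t by (intro exp_bounded_add Suc.prems) auto
    then have ez': "exp_bounded (\<lambda>m. norm (P m *v z' m)) \<nu>"
    proof (rule exp_bounded_le)
      fix m
      have "norm (P m *v z' m) \<le> norm (P m *v z m) + norm (P m *v vmult (v t) (c t m))"
        unfolding z'_def matrix_vector_mult_diff_distrib by (rule norm_triangle_ineq4)
      then show "\<bar>norm (P m *v z' m)\<bar> \<le> norm (P m *v z m) + norm (P m *v v t) * norm (c t m)"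
        by (simp add: matrix_vector_mult_vmult norm_vmult)
    qed
    show ?thesis
    proof (cases "i = t")
      case False
      then have "r i < n" using Suc.prems(5) t r by (metis injD less_Suc_eq)
      then show ?thesis using Suc.IH[of z' i] Suc.prems z' ez' by simp
    qed (simp add: ct)
  qed
qed simp

text \<open>At each time \<open>m\<close> choose a near-minimiser \<open>w m\<close> of the pivot.
  The increment \<open>z m\<close> lies lower in the flag and its image at time \<open>m\<close> has
  rate \<open>\<mu> k\<close>, because one factor stretches subexponentially. Its coefficients in
  the adapted vectors found before have rates \<open>\<mu> k - \<mu> i\<close>. Replacing their
  partial sums by the constants of \<open>exp_bounded_partial_sum\<close> gives one vector
  \<open>u\<close> that is as good as \<open>w m\<close> at every time \<open>m\<close>.\<close>

lemma adapted_vector: "\<exists>v \<in> lead r k. exp_bounded (\<lambda>m. norm (P m *v v)) (\<mu> k)"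
proof (induction "r k" arbitrary: k rule: less_induct)
  case less
  have "\<exists>v. \<forall>i. r i < r k \<longrightarrow> v i \<in> lead r i \<and> exp_bounded (\<lambda>m. norm (P m *v v i)) (\<mu> i)"
    using less by (intro choice) blast
  then obtain v where v: "\<And>i. r i < r k \<Longrightarrow> v i \<in> lead r i"
    and ev: "\<And>i. r i < r k \<Longrightarrow> exp_bounded (\<lambda>m. norm (P m *v v i)) (\<mu> i)" by blast
  \<comment> \<open>The factor 2 leaves room above the infimum, the pivot being positive, so
    attainment is not at issue.\<close>
  have "\<exists>w. w \<in> lead r k \<and> norm (P m *v w) < 2 * pivot r k (P m)" for m
  proof -
    have "Inf ((\<lambda>x. norm (P m *v x)) ` lead r k) < 2 * pivot r k (P m)"
      using pivot_pos[of k m] by (simp add: pivot_def)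
    from cInf_lessD[OF _ this] axis_in_lead show ?thesis by (metis (no_types, lifting) empty_iff imageE image_is_empty)
  qed
  then obtain w where w: "\<And>m. w m \<in> lead r k" "\<And>m. norm (P m *v w m) < 2 * pivot r k (P m)" by metis
  \<comment> \<open>With \<open>z 0 = 0\<close> the formula
    \<open>w m = w 0 + (\<Sum>s\<le>m. z s)\<close> also holds at \<open>m = 0\<close>.\<close>
  define z where "z m = (if m = 0 then 0 else w m - w (m - 1))" for m
  have zin: "z m \<in> below r (r k)" for m
    using w(1)[of m] w(1)[of "m - 1"] r
    by (auto simp: z_def below_def lead_def dest: injD le_neq_implies_less) (metis eq_iff_diff_eq_0 injD le_neq_implies_less)
  have "\<exists>c. z m = (\<Sum>i | r i < r k. vmult (v i) (c i))" for m
    by (rule below_expand[OF r v zin])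
  then obtain c' where c': "\<And>m. z m = (\<Sum>i | r i < r k. vmult (v i) (c' m i))" by metis
  define c where "c i m = c' m i" for i m
  have c: "z m = (\<Sum>i | r i < r k. vmult (v i) (c i m))" for m unfolding c_def by (rule c')
  have "exp_bounded (\<lambda>m. 2 * pivot r k (P m) + (2 * a m) * pivot r k (P (m - 1))) (\<mu> k)"
    using exp_bounded_mult[OF exp_bounded_cmult[OF a, of 2] exp_bounded_pred[OF upper[of k]]]
    by (intro exp_bounded_add exp_bounded_cmult upper) auto
  then have ez: "exp_bounded (\<lambda>m. norm (P m *v z m)) (\<mu> k)"
  \<comment> \<open>The extra summand with \<open>\<bar>a 0\<bar>\<close> serves
    \<open>m = 0\<close> only: there \<open>m - 1 = 0\<close>, the value \<open>a 0\<close> may be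
    negative, and the bound must still be nonnegative.\<close>
  proof (rule exp_bounded_le[OF exp_bounded_add[OF _ exp_bounded_cmult[OF upper[of k], of "2 * \<bar>a 0\<bar>"]]])
    fix m
    show "\<bar>norm (P m *v z m)\<bar> \<le> 2 * pivot r k (P m) + (2 * a m) * pivot r k (P (m - 1)) + 2 * \<bar>a 0\<bar> * pivot r k (P m)"
    proof (cases m)
      case 0
      have "- (\<bar>a 0\<bar> * pivot r k (P 0)) \<le> a 0 * pivot r k (P 0)"
        using mult_right_mono[of "- \<bar>a 0\<bar>" "a 0", OF _ pivot_nonneg[of r k "P 0"]] by simp
      then show ?thesis using 0 pivot_nonneg[of r k "P 0"] by (simp add: z_def mult.assoc)
    next
      case (Suc l)
      have x: "w l \<in> lead r k" by (rule w)
      have "norm (P (Suc l) *v w l) > 0"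
        using pivot_le_lead[OF x, of "P (Suc l)"] pivot_pos[of k "Suc l"] by linarith
      then have "0 < a (Suc l) * norm (P l *v w l)" using step[of l "w l"] by linarith
      \<comment> \<open>For positive indices positivity of \<open>a\<close> follows from
        \<open>step\<close>, applied to a vector that \<open>P (Suc l)\<close> does not
        annihilate.\<close>
      then have a0: "0 < a (Suc l)" by (metis norm_ge_zero zero_less_mult_pos2 order_le_less mult_zero_right less_irrefl)
      have "norm (P m *v z m) \<le> norm (P m *v w m) + norm (P m *v w l)"
        unfolding z_def Suc by (simp add: matrix_vector_mult_diff_distrib norm_triangle_ineq4)
      also have "\<dots> \<le> 2 * pivot r k (P m) + a m * (2 * pivot r k (P l))"
        using w(2)[of m] step[of l "w l"] mult_left_mono[OF less_imp_le[OF w(2)[of l]] less_imp_le[OF a0]] Suc by simp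
      also have "\<dots> \<le> 2 * pivot r k (P m) + a m * (2 * pivot r k (P l)) + 2 * \<bar>a 0\<bar> * pivot r k (P m)"
        using pivot_nonneg[of r k "P m"] by simp
      finally show ?thesis using Suc by simp
    qed
  qed
  have ec: "exp_bounded (\<lambda>m. norm (c i m)) (\<mu> k - \<mu> i)" if "r i < r k" for i
    by (rule coefficient_bound[OF v ev c ez that])
  have "\<exists>L. \<forall>i. r i < r k \<longrightarrow> exp_bounded (\<lambda>m. norm (L i - (\<Sum>s\<le>m. c i s))) (\<mu> k - \<mu> i)"
    by (intro choice) (use exp_bounded_partial_sum[OF ec] in blast)
  then obtain L where L: "\<And>i. r i < r k \<Longrightarrow> exp_bounded (\<lambda>m. norm (L i - (\<Sum>s\<le>m. c i s))) (\<mu> k - \<mu> i)" by blast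
  define u where "u = w 0 + (\<Sum>i | r i < r k. vmult (v i) (L i))"
  have wsum: "w m = w 0 + (\<Sum>i | r i < r k. vmult (v i) (\<Sum>s\<le>m. c i s))" for m
  proof -
    have "w m = w 0 + (\<Sum>s\<le>m. z s)" by (induction m) (auto simp: z_def)
    also have "(\<Sum>s\<le>m. z s) = (\<Sum>i | r i < r k. \<Sum>s\<le>m. vmult (v i) (c i s))"
      unfolding c by (rule sum.swap)
    also have "\<dots> = (\<Sum>i | r i < r k. vmult (v i) (\<Sum>s\<le>m. c i s))"
      by (intro sum.cong) (auto simp: vec_eq_iff sum_distrib_left sum_component)
    finally show ?thesis .
  qed
  have "u \<in> lead r k"
  proof -
    have "(\<Sum>i | r i < r k. vmult (v i) (L i)) $ j = 0" if "r k \<le> r j" for j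
      using v that by (auto simp: sum_component lead_def intro!: sum.neutral)
    then show ?thesis using w(1)[of 0] by (auto simp: u_def lead_def)
  qed
  moreover have "exp_bounded (\<lambda>m. norm (P m *v u)) (\<mu> k)"
  proof (rule exp_bounded_le)
    let ?g = "\<lambda>m. 2 * pivot r k (P m) + (\<Sum>i | r i < r k. norm (P m *v v i) * norm (L i - (\<Sum>s\<le>m. c i s)))"
    show "exp_bounded ?g (\<mu> k)"
    proof (cases "{i. r i < r k} = {}")
      case True
      then show ?thesis by (simp add: exp_bounded_cmult[OF upper])
    next
      case False
      have "exp_bounded (\<lambda>m. norm (P m *v v i) * norm (L i - (\<Sum>s\<le>m. c i s))) (\<mu> k)" if "r i < r k" for i
        using exp_bounded_mult[OF ev[OF that] L[OF that]] by simp
      then show ?thesis using False by (intro exp_bounded_add exp_bounded_cmult upper exp_bounded_sum) auto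
    qed
    fix m
    \<comment> \<open>The error \<open>L i - (\<Sum>s\<le>m. c i s)\<close> has rate
      \<open>\<mu> k - \<mu> i\<close>, which turns the rate \<open>\<mu> i\<close> of
      \<open>P m *v v i\<close> into \<open>\<mu> k\<close>.\<close>
    have "u = w m + (\<Sum>i | r i < r k. vmult (v i) (L i - (\<Sum>s\<le>m. c i s)))"
      unfolding u_def wsum[of m] by (simp add: vec_eq_iff sum_component algebra_simps sum_subtractf)
    then have "P m *v u = P m *v w m + (\<Sum>i | r i < r k. vmult (P m *v v i) (L i - (\<Sum>s\<le>m. c i s)))"
      by (simp only: matrix_vector_right_distrib matrix_vector_mult_sum matrix_vector_mult_vmult)
    then have "norm (P m *v u) \<le> norm (P m *v w m) + norm (\<Sum>i | r i < r k. vmult (P m *v v i) (L i - (\<Sum>s\<le>m. c i s)))"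
      by (simp only: norm_triangle_ineq)
    also have "\<dots> \<le> 2 * pivot r k (P m) + (\<Sum>i | r i < r k. norm (vmult (P m *v v i) (L i - (\<Sum>s\<le>m. c i s))))"
      using w(2)[of m] by (intro add_mono norm_sum) auto
    finally show "\<bar>norm (P m *v u)\<bar> \<le> ?g m" by (simp add: norm_vmult)
  qed
  ultimately show ?case by blast
qed

text \<open>Expand \<open>y\<close> in adapted vectors. The rate is the largest
  \<open>\<mu> i\<close> among nonzero coefficients: the triangle inequality gives the upper bound,
  and \<open>coefficient_bound\<close> excludes cancellation.\<close>

theorem exponents_exist:
  assumes y: "y \<noteq> 0"
  shows "\<exists>k. growth_rate P y \<longlonglongrightarrow> \<mu> k"
proof -
  have "\<exists>v. \<forall>i. v i \<in> lead r i \<and> exp_bounded (\<lambda>m. norm (P m *v v i)) (\<mu> i)"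
    using adapted_vector by (intro choice) blast
  then obtain v where v: "\<And>i. v i \<in> lead r i"
    and ev: "\<And>i. exp_bounded (\<lambda>m. norm (P m *v v i)) (\<mu> i)" by blast
  define n where "n = Suc (Max (range r))"
  have n: "r i < n" for i by (simp add: n_def less_Suc_eq_le)
  obtain c where c: "y = (\<Sum>i | r i < n. vmult (v i) (c i))"
    using below_expand[OF r v, where z=y and n=n] n by (auto simp: below_def not_le[symmetric])
  have "{i. c i \<noteq> 0} \<noteq> {}"
  proof
    assume "{i. c i \<noteq> 0} = {}"
    then have "y = 0" unfolding c by (intro sum.neutral) (auto simp: vec_eq_iff)
    with y show False by simp
  qed
  then have "Max (\<mu> ` {i. c i \<noteq> 0}) \<in> \<mu> ` {i. c i \<noteq> 0}" by (intro Max_in) auto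
  then obtain k where k: "c k \<noteq> 0" "Max (\<mu> ` {i. c i \<noteq> 0}) = \<mu> k" by blast
  have kmax: "\<mu> i \<le> \<mu> k" if "c i \<noteq> 0" for i
    using that unfolding k(2)[symmetric] by (intro Max_ge) auto
  have up: "exp_bounded (\<lambda>m. norm (P m *v y)) (\<mu> k)"
  proof (rule exp_bounded_le)
    show "exp_bounded (\<lambda>m. \<Sum>i | r i < n. norm (c i) * norm (P m *v v i)) (\<mu> k)"
    proof (rule exp_bounded_sum)
      show "{i. r i < n} \<noteq> {}" using n by auto
      fix i
      show "exp_bounded (\<lambda>m. norm (c i) * norm (P m *v v i)) (\<mu> k)"
      proof (cases "c i = 0")
        case True
        then show ?thesis by (simp add: exp_bounded_zero)
      next
        case False
        then show ?thesis by (intro exp_bounded_cmult exp_bounded_mono[OF ev] kmax)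
      qed
    qed simp
    fix m
    have "norm (P m *v y) \<le> (\<Sum>i | r i < n. norm (P m *v vmult (v i) (c i)))"
      unfolding c matrix_vector_mult_sum by (rule norm_sum)
    then show "\<bar>norm (P m *v y)\<bar> \<le> (\<Sum>i | r i < n. norm (c i) * norm (P m *v v i))"
      by (simp add: matrix_vector_mult_vmult norm_vmult mult.commute)
  qed
  have pos: "norm (P m *v y) > 0" for m
    using pivot_pos_imp_inj[OF pivot_pos y] by simp
  have low: "exp_bounded (\<lambda>m. 1 / norm (P m *v y)) (- \<mu> k)"
  proof -
    define d where "d m = (1 / norm (P m *v y))" for m
    \<comment> \<open>Scaling makes the image at time \<open>m\<close> a unit vector, of rate 0. The
      \<open>k\<close>-th coefficient is then \<open>c k\<close> divided by
      \<open>norm (P m *v y)\<close>, and its rate \<open>0 - \<mu> k\<close> is the lower bound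
      sought.\<close>
    define z where "z m = vmult y (of_real (d m))" for m
    have z: "z m = (\<Sum>i | r i < n. vmult (v i) (c i * of_real (d m)))" for m
      unfolding z_def c by (simp add: vec_eq_iff sum_component sum_distrib_right mult.assoc)
    have "norm (P m *v z m) = 1" for m
      using pos[of m] by (simp add: z_def matrix_vector_mult_vmult norm_vmult d_def del: of_real_divide)
    then have "exp_bounded (\<lambda>m. norm (P m *v z m)) 0" by (simp add: exp_bounded_const)
    from coefficient_bound[OF v ev z this n] have "exp_bounded (\<lambda>m. norm (c k * of_real (d m))) (0 - \<mu> k)" .
    then have "exp_bounded (\<lambda>m. (1 / norm (c k)) * norm (c k * of_real (d m))) (- \<mu> k)"
      by (intro exp_bounded_cmult) simp
    then show ?thesis using k(1) by (simp add: norm_mult d_def del: of_real_divide)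
  qed
  have "growth_rate P y \<longlonglongrightarrow> \<mu> k"
    unfolding growth_rate_def by (rule exp_bounded_limit_ln[OF up low pos])
  then show ?thesis by blast
qed

end


section \<open>The Gaussian measure on a Euclidean space\<close>

lemma lborel_distr_minus_left: "distr lborel borel (\<lambda>x::'b::euclidean_space. t - x) = lborel"
  using lborel_affine[of "-1" t] by (simp add: density_1)

text \<open>A Fubini argument in place of determinants. With \<open>g\<close> the indicator of the
  unit ball, which \<open>T\<close> preserves, the double integral of
  \<open>f (T x) * g (T x + y)\<close> is evaluated in two ways. This gives that the integrals of
  \<open>f (T x)\<close> and of \<open>f\<close> agree after multiplication by the volume of the
  ball, which is positive and finite.\<close>

lemma lborel_distr_orthogonal_transformation:
  fixes T :: "'b::euclidean_space \<Rightarrow> 'b"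
  assumes T: "orthogonal_transformation T"
  shows "distr lborel borel T = lborel"
proof (rule measure_eqI)
  have "linear T" using T by (rule orthogonal_transformation_linear)
  then have [measurable]: "T \<in> borel_measurable borel"
    by (intro borel_measurable_continuous_onI linear_continuous_on linear_conv_bounded_linear[THEN iffD1])
  fix A :: "'b set" assume "A \<in> sets (distr lborel borel T)"
  then have [measurable]: "A \<in> sets borel" by simp
  define f :: "'b \<Rightarrow> ennreal" where "f = indicator A"
  define g :: "'b \<Rightarrow> ennreal" where "g = indicator (ball 0 1)"
  have [measurable]: "f \<in> borel_measurable borel" "g \<in> borel_measurable borel"
    by (auto simp: f_def g_def intro!: borel_measurable_indicator borel_open)
  have gT: "g (T x) = g x" for x
    using orthogonal_transformation_norm[OF T, of x] by (simp add: g_def indicator_def)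
  have shift: "(\<integral>\<^sup>+x. h x \<partial>lborel) = (\<integral>\<^sup>+x. h (c + x) \<partial>lborel)" if [measurable]: "h \<in> borel_measurable borel"
    for h :: "'b \<Rightarrow> ennreal" and c
    by (subst lborel_distr_plus[of c, symmetric]) (simp add: nn_integral_distr)
  have I1: "(\<integral>\<^sup>+x. f (T x) * (\<integral>\<^sup>+y. g y \<partial>lborel) \<partial>lborel) = (\<integral>\<^sup>+x. \<integral>\<^sup>+y. f (T x) * g (T x + y) \<partial>lborel \<partial>lborel)"
  proof (rule nn_integral_cong)
    fix x
    show "f (T x) * (\<integral>\<^sup>+y. g y \<partial>lborel) = (\<integral>\<^sup>+y. f (T x) * g (T x + y) \<partial>lborel)"
      by (subst shift[of g "T x"]) (auto simp: nn_integral_cmult)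
  qed
  also have "\<dots> = (\<integral>\<^sup>+y. \<integral>\<^sup>+x. f (T x) * g (T x + y) \<partial>lborel \<partial>lborel)"
    by (rule lborel_pair.Fubini') measurable
  also have "\<dots> = (\<integral>\<^sup>+y. \<integral>\<^sup>+x. f (T x - y) * g (T x) \<partial>lborel \<partial>lborel)"
  proof (rule nn_integral_cong)
    fix y :: 'b
    \<comment> \<open>For fixed \<open>y\<close>, translating \<open>x\<close> by a preimage of
      \<open>y\<close> moves the shift from \<open>g\<close> to \<open>f\<close>.\<close>
    obtain c where c: "T c = y" using orthogonal_transformation_surj[OF T] by (metis surjD)
    have e: "T (- c + x) = T x - y" for x using \<open>linear T\<close> c by (simp add: linear_diff)
    show "(\<integral>\<^sup>+x. f (T x) * g (T x + y) \<partial>lborel) = (\<integral>\<^sup>+x. f (T x - y) * g (T x) \<partial>lborel)"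
      using shift[of "\<lambda>x. f (T x) * g (T x + y)" "- c"] by (simp only: e diff_add_cancel) measurable
  qed
  also have "\<dots> = (\<integral>\<^sup>+x. \<integral>\<^sup>+y. f (T x - y) * g (T x) \<partial>lborel \<partial>lborel)"
    by (rule lborel_pair.Fubini') measurable
  also have "\<dots> = (\<integral>\<^sup>+x. (\<integral>\<^sup>+y. f y \<partial>lborel) * g x \<partial>lborel)"
  proof (rule nn_integral_cong)
    fix x
    have "(\<integral>\<^sup>+y. f (T x - y) * g (T x) \<partial>lborel) = (\<integral>\<^sup>+y. f (T x - y) \<partial>lborel) * g x"
      unfolding gT by (rule nn_integral_multc) measurable
    also have "(\<integral>\<^sup>+y. f (T x - y) \<partial>lborel) = (\<integral>\<^sup>+y. f y \<partial>distr lborel borel (\<lambda>y. T x - y))"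
      by (simp add: nn_integral_distr)
    finally show "(\<integral>\<^sup>+y. f (T x - y) * g (T x) \<partial>lborel) = (\<integral>\<^sup>+y. f y \<partial>lborel) * g x"
      by (simp add: lborel_distr_minus_left)
  qed
  finally have eq: "(\<integral>\<^sup>+x. f (T x) \<partial>lborel) * (\<integral>\<^sup>+y. g y \<partial>lborel) = (\<integral>\<^sup>+y. f y \<partial>lborel) * (\<integral>\<^sup>+x. g x \<partial>lborel)"
    by (simp add: nn_integral_multc nn_integral_cmult)
  have g1: "(\<integral>\<^sup>+y. g y \<partial>lborel) = emeasure lborel (ball (0::'b) 1)" by (simp add: g_def)
  have "emeasure lborel (ball (0::'b) 1) < \<infinity>" by (rule emeasure_bounded_finite) simp
  moreover have "emeasure lborel (ball (0::'b) 1) \<noteq> 0"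
    using content_ball_pos[of 1 "0::'b"] by (auto simp: measure_def)
  ultimately have "(\<integral>\<^sup>+x. f (T x) \<partial>lborel) = (\<integral>\<^sup>+y. f y \<partial>lborel)"
    using eq unfolding g1 by (metis mult_divide_eq_ennreal less_top infinity_ennreal_def)
  moreover have "(\<integral>\<^sup>+x. f (T x) \<partial>lborel) = (\<integral>\<^sup>+x. f x \<partial>distr lborel borel T)" by (simp add: nn_integral_distr)
  ultimately show "emeasure (distr lborel borel T) A = emeasure lborel A"
    by (simp add: f_def)
qed simp

definition gauss :: "real \<Rightarrow> 'b::euclidean_space measure" where
  "gauss \<sigma> = density lborel (\<lambda>x. ennreal (\<Prod>b\<in>Basis. normal_density 0 \<sigma> (x \<bullet> b)))"

lemma sets_gauss [simp, measurable_cong]: "sets (gauss \<sigma>) = sets borel"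
  and space_gauss [simp]: "space (gauss \<sigma>) = UNIV"
  by (simp_all add: gauss_def)

text \<open>The density is radial. Together with the invariance of \<open>lborel\<close> this yields
  the invariance of \<open>gauss \<sigma>\<close> under every isometry.\<close>

lemma prod_normal_density_eq:
  fixes x :: "'b::euclidean_space"
  shows "(\<Prod>b\<in>Basis. normal_density 0 \<sigma> (x \<bullet> b)) =
    (1 / sqrt (2 * pi * \<sigma>\<^sup>2)) ^ DIM('b) * exp (- (norm x)\<^sup>2 / (2 * \<sigma>\<^sup>2))"
proof -
  have "(\<Prod>b\<in>Basis. normal_density 0 \<sigma> (x \<bullet> b)) =
      (1 / sqrt (2 * pi * \<sigma>\<^sup>2)) ^ DIM('b) * exp (\<Sum>b\<in>Basis. - (x \<bullet> b)\<^sup>2 / (2 * \<sigma>\<^sup>2))"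
    by (simp add: normal_density_def exp_sum prod.distrib prod_dividef power_divide)
  also have "(\<Sum>b\<in>Basis. - (x \<bullet> b)\<^sup>2 / (2 * \<sigma>\<^sup>2)) = - (\<Sum>b\<in>Basis. (x \<bullet> b)\<^sup>2) / (2 * \<sigma>\<^sup>2)"
    by (simp add: sum_divide_distrib sum_negf)
  also have "(\<Sum>b\<in>Basis. (x \<bullet> b)\<^sup>2) = (norm x)\<^sup>2"
    using euclidean_inner[of x x] unfolding power2_norm_eq_inner by (simp only: power2_eq_square)
  finally show ?thesis .
qed

lemma gauss_eq:
  "gauss \<sigma> = density lborel (\<lambda>x::'b::euclidean_space.
    ennreal ((1 / sqrt (2 * pi * \<sigma>\<^sup>2)) ^ DIM('b) * exp (- (norm x)\<^sup>2 / (2 * \<sigma>\<^sup>2))))"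
  unfolding gauss_def prod_normal_density_eq ..

lemma orthogonal_transformation_measurable:
  fixes T :: "'b::euclidean_space \<Rightarrow> 'b"
  assumes "orthogonal_transformation T" shows "T \<in> borel_measurable borel"
  using orthogonal_transformation_linear[OF assms]
  by (intro borel_measurable_continuous_onI linear_continuous_on linear_conv_bounded_linear[THEN iffD1])

lemma distr_gauss_orthogonal_transformation:
  fixes T :: "'b::euclidean_space \<Rightarrow> 'b"
  assumes T: "orthogonal_transformation T"
  shows "distr (gauss \<sigma>) borel T = gauss \<sigma>"
proof -
  note [measurable] = orthogonal_transformation_measurable[OF T]
  have "gauss \<sigma> = density (distr lborel borel T) (\<lambda>x::'b. ennreal ((1 / sqrt (2 * pi * \<sigma>\<^sup>2)) ^ DIM('b) * exp (- (norm x)\<^sup>2 / (2 * \<sigma>\<^sup>2))))"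
    unfolding lborel_distr_orthogonal_transformation[OF T] gauss_eq ..
  also have "\<dots> = distr (gauss \<sigma>) borel T"
    by (subst density_distr) (simp_all add: gauss_eq orthogonal_transformation_norm[OF T])
  finally show ?thesis by simp
qed

lemma nn_integral_gauss_orthogonal_transformation:
  fixes T :: "'b::euclidean_space \<Rightarrow> 'b"
  assumes T: "orthogonal_transformation T" and [measurable]: "h \<in> borel_measurable borel"
  shows "(\<integral>\<^sup>+x. h (T x) \<partial>gauss \<sigma>) = (\<integral>\<^sup>+x. h x \<partial>gauss \<sigma>)"
proof -
  note [measurable] = orthogonal_transformation_measurable[OF T]
  have "(\<integral>\<^sup>+x. h x \<partial>gauss \<sigma>) = (\<integral>\<^sup>+x. h x \<partial>distr (gauss \<sigma>) borel T)"
    by (simp add: distr_gauss_orthogonal_transformation[OF T])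
  then show ?thesis by (simp add: nn_integral_distr)
qed

text \<open>The coordinate map carries product Lebesgue measure to \<open>lborel\<close>, so
  densities can be transported along it. This links the radial description with independence of
  coordinates.\<close>

lemma gauss_eq_PiM:
  assumes "\<sigma> > 0"
  shows "gauss \<sigma> = distr (\<Pi>\<^sub>M b\<in>Basis. density lborel (normal_density 0 \<sigma>)) borel
    (\<lambda>f. \<Sum>b\<in>Basis. f b *\<^sub>R b :: 'b::euclidean_space)"
proof -
  interpret L: product_sigma_finite "\<lambda>_::'b. lborel :: real measure" ..
  interpret N: prob_space "density lborel (normal_density 0 \<sigma>)"
    using assms by (rule prob_space_normal_density)
  interpret D: product_sigma_finite "\<lambda>_::'b. density lborel (normal_density 0 \<sigma>)" ..
  have PD: "density (\<Pi>\<^sub>M b\<in>(Basis::'b set). lborel) (\<lambda>f. \<Prod>b\<in>Basis. ennreal (normal_density 0 \<sigma> (f b))) =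
      (\<Pi>\<^sub>M b\<in>Basis. density lborel (normal_density 0 \<sigma>))"
  proof (rule D.PiM_eqI)
    show "sets (density (\<Pi>\<^sub>M b\<in>(Basis::'b set). lborel) (\<lambda>f. \<Prod>b\<in>Basis. ennreal (normal_density 0 \<sigma> (f b)))) =
      sets (\<Pi>\<^sub>M b\<in>Basis. density lborel (normal_density 0 \<sigma>))"
      by (simp cong: sets_PiM_cong)
    fix A :: "'b \<Rightarrow> real set"
    assume "\<And>i. i \<in> Basis \<Longrightarrow> A i \<in> sets (density lborel (normal_density 0 \<sigma>))"
    then have [measurable]: "\<And>i. i \<in> Basis \<Longrightarrow> A i \<in> sets borel" by simp
    have "emeasure (density (\<Pi>\<^sub>M b\<in>(Basis::'b set). lborel) (\<lambda>f. \<Prod>b\<in>Basis. ennreal (normal_density 0 \<sigma> (f b)))) (Pi\<^sub>E Basis A)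
      = (\<integral>\<^sup>+f. (\<Prod>b\<in>Basis. ennreal (normal_density 0 \<sigma> (f b))) * indicator (Pi\<^sub>E Basis A) f \<partial>(\<Pi>\<^sub>M b\<in>(Basis::'b set). lborel))"
      by (rule emeasure_density) (auto intro!: sets_PiM_I_finite)
    also have "\<dots> = (\<integral>\<^sup>+f. (\<Prod>b\<in>Basis. ennreal (normal_density 0 \<sigma> (f b)) * indicator (A b) (f b)) \<partial>(\<Pi>\<^sub>M b\<in>(Basis::'b set). lborel))"
    proof (intro nn_integral_cong)
      fix f assume "f \<in> space (\<Pi>\<^sub>M b\<in>(Basis::'b set). (lborel::real measure))"
      then have e: "f \<in> extensional Basis" by (auto simp: space_PiM PiE_def)
      \<comment> \<open>Points of the product space are extensional, so membership in the box is a
        condition on the coordinates alone.\<close>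
      have "indicator (Pi\<^sub>E Basis A) f = (\<Prod>b\<in>Basis. indicator (A b) (f b) :: ennreal)"
        using e by (cases "f \<in> Pi\<^sub>E Basis A") (auto simp: PiE_def Pi_def prod_zero_iff indicator_def)
      then show "(\<Prod>b\<in>Basis. ennreal (normal_density 0 \<sigma> (f b))) * indicator (Pi\<^sub>E Basis A) f =
          (\<Prod>b\<in>Basis. ennreal (normal_density 0 \<sigma> (f b)) * indicator (A b) (f b))"
        by (simp add: prod.distrib)
    qed
    also have "\<dots> = (\<Prod>b\<in>Basis. \<integral>\<^sup>+x. ennreal (normal_density 0 \<sigma> x) * indicator (A b) x \<partial>lborel)"
      by (rule L.product_nn_integral_prod) auto
    also have "\<dots> = (\<Prod>b\<in>Basis. emeasure (density lborel (normal_density 0 \<sigma>)) (A b))"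
      by (intro prod.cong) (auto simp: emeasure_density)
    finally show "emeasure (density (\<Pi>\<^sub>M b\<in>(Basis::'b set). lborel) (\<lambda>f. \<Prod>b\<in>Basis. ennreal (normal_density 0 \<sigma> (f b)))) (Pi\<^sub>E Basis A)
      = (\<Prod>b\<in>Basis. emeasure (density lborel (normal_density 0 \<sigma>)) (A b))" .
  qed simp
  have "gauss \<sigma> = density (distr (\<Pi>\<^sub>M b\<in>(Basis::'b set). lborel) borel (\<lambda>f. \<Sum>b\<in>Basis. f b *\<^sub>R b))
      (\<lambda>x. ennreal (\<Prod>b\<in>Basis. normal_density 0 \<sigma> (x \<bullet> b)))"
    unfolding gauss_def lborel_eq[symmetric] ..
  also have "\<dots> = distr (density (\<Pi>\<^sub>M b\<in>(Basis::'b set). lborel) (\<lambda>f. \<Prod>b\<in>Basis. ennreal (normal_density 0 \<sigma> (f b)))) borel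
      (\<lambda>f. \<Sum>b\<in>Basis. f b *\<^sub>R b)"
    by (subst density_distr) (auto simp: prod_ennreal)
  also have "\<dots> = distr (\<Pi>\<^sub>M b\<in>(Basis::'b set). density lborel (normal_density 0 \<sigma>)) borel
      (\<lambda>f. \<Sum>b\<in>Basis. f b *\<^sub>R b)"
    unfolding PD ..
  finally show ?thesis .
qed

lemma prob_space_gauss:
  assumes "\<sigma> > 0" shows "prob_space (gauss \<sigma> :: 'b::euclidean_space measure)"
proof -
  have N: "prob_space (density lborel (normal_density 0 \<sigma>))"
    using assms by (rule prob_space_normal_density)
  then interpret prob_space "\<Pi>\<^sub>M b\<in>(Basis::'b set). density lborel (normal_density 0 \<sigma>)"
    by (intro prob_space_PiM)
  have [measurable_cong]: "sets (\<Pi>\<^sub>M b\<in>(Basis::'b set). density lborel (normal_density 0 \<sigma>)) = sets (\<Pi>\<^sub>M b\<in>Basis. borel)"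
    by (simp cong: sets_PiM_cong)
  show ?thesis unfolding gauss_eq_PiM[OF assms] by (rule prob_space_distr) measurable
qed

lemma distr_gauss_Basis:
  fixes b :: "'b::euclidean_space"
  assumes "\<sigma> > 0" and b: "b \<in> Basis"
  shows "distr (gauss \<sigma>) borel (\<lambda>x. x \<bullet> b) = density lborel (normal_density 0 \<sigma>)"
proof -
  have N: "prob_space (density lborel (normal_density 0 \<sigma>))"
    using assms by (intro prob_space_normal_density)
  have [measurable_cong]: "sets (\<Pi>\<^sub>M b\<in>(Basis::'b set). density lborel (normal_density 0 \<sigma>)) = sets (\<Pi>\<^sub>M b\<in>Basis. borel)"
    by (simp cong: sets_PiM_cong)
  have "distr (gauss \<sigma>) borel (\<lambda>x. x \<bullet> b) = distr (\<Pi>\<^sub>M b\<in>(Basis::'b set). density lborel (normal_density 0 \<sigma>)) borel (\<lambda>f. f b)"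
    unfolding gauss_eq_PiM[OF assms(1)] using b by (subst distr_distr) (auto simp: comp_def)
  also have "\<dots> = distr (\<Pi>\<^sub>M b\<in>(Basis::'b set). density lborel (normal_density 0 \<sigma>)) (density lborel (normal_density 0 \<sigma>)) (\<lambda>f. f b)"
    by (rule distr_cong) auto
  also have "\<dots> = density lborel (normal_density 0 \<sigma>)"
    using distr_PiM_component[OF N b] by simp
  finally show ?thesis .
qed

text \<open>Squared norms add over pairs. Two independent Gaussians can therefore be rotated jointly
  as a single one.\<close>

lemma gauss_pair:
  assumes "\<sigma> > 0"
  shows "(gauss \<sigma> :: 'b::euclidean_space measure) \<Otimes>\<^sub>M (gauss \<sigma> :: 'c::euclidean_space measure) = gauss \<sigma>"
proof -
  let ?K = "1 / sqrt (2 * pi * \<sigma>\<^sup>2)"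
  interpret prob_space "gauss \<sigma> :: 'c measure" using assms by (rule prob_space_gauss)
  have sf: "sigma_finite_measure (density lborel (\<lambda>x::'c. ennreal (?K ^ DIM('c) * exp (- (norm x)\<^sup>2 / (2 * \<sigma>\<^sup>2)))))"
    unfolding gauss_eq[symmetric] ..
  have "(gauss \<sigma> :: 'b measure) \<Otimes>\<^sub>M (gauss \<sigma> :: 'c measure) = density (lborel \<Otimes>\<^sub>M lborel)
      (\<lambda>(x::'b, y::'c). ennreal (?K ^ DIM('b) * exp (- (norm x)\<^sup>2 / (2 * \<sigma>\<^sup>2))) * ennreal (?K ^ DIM('c) * exp (- (norm y)\<^sup>2 / (2 * \<sigma>\<^sup>2))))"
    unfolding gauss_eq by (rule pair_measure_density[OF _ _ _ sf]) (auto intro: sigma_finite_lborel)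
  also have "\<dots> = density lborel (\<lambda>z::'b \<times> 'c. ennreal (?K ^ DIM('b \<times> 'c) * exp (- (norm z)\<^sup>2 / (2 * \<sigma>\<^sup>2))))"
    unfolding lborel_prod
  proof (intro arg_cong[where f="density lborel"] ext)
    fix z :: "'b \<times> 'c"
    obtain x y where z: "z = (x, y)" by fastforce
    have "exp (- (norm z)\<^sup>2 / (2 * \<sigma>\<^sup>2)) = exp (- (norm x)\<^sup>2 / (2 * \<sigma>\<^sup>2)) * exp (- (norm y)\<^sup>2 / (2 * \<sigma>\<^sup>2))"
      by (simp add: z norm_Pair exp_add[symmetric] diff_divide_distrib)
    then show "(case z of (x, y) \<Rightarrow> ennreal (?K ^ DIM('b) * exp (- (norm x)\<^sup>2 / (2 * \<sigma>\<^sup>2))) * ennreal (?K ^ DIM('c) * exp (- (norm y)\<^sup>2 / (2 * \<sigma>\<^sup>2))))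
      = ennreal (?K ^ DIM('b \<times> 'c) * exp (- (norm z)\<^sup>2 / (2 * \<sigma>\<^sup>2)))"
      by (simp add: z ennreal_mult'[symmetric] power_add mult_ac)
  qed
  finally show ?thesis unfolding gauss_eq[symmetric] .
qed


section \<open>Isometries of a vector space over a division algebra\<close>

lemma gaussian_matrix_distr:
  fixes X :: "'v \<Rightarrow> 'a::euclidean_space ^ 'n ^ 'n"
  assumes gm: "gaussian_matrix M \<sigma> X" and \<sigma>: "\<sigma> > 0"
  shows gaussian_matrix_measurable: "X \<in> borel_measurable M" and "distr M borel X = gauss \<sigma>"
proof -
  let ?I = "UNIV \<times> UNIV \<times> Basis :: ('n \<times> 'n \<times> 'a) set"
  let ?C = "\<lambda>(i, j, b) \<omega>. (X \<omega> $ i $ j) \<bullet> b"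
  interpret prob_space M using gm by (simp add: gaussian_matrix_def)
  have ind: "indep_vars (\<lambda>_. borel) ?C ?I"
    and dist: "\<And>i j b. b \<in> Basis \<Longrightarrow> distributed M lborel (\<lambda>\<omega>. (X \<omega> $ i $ j) \<bullet> b) (normal_density 0 \<sigma>)"
    using gm by (auto simp: gaussian_matrix_def)
  \<comment> \<open>\<open>g\<close> translates a basis vector of the matrix space into its triple
    of row, column and component; since \<open>v\<close> is recovered from \<open>g v\<close>, it is
    injective on \<open>Basis\<close>.\<close>
  have "\<forall>v\<in>Basis. \<exists>t. t \<in> ?I \<and> v = (case t of (i, j, b) \<Rightarrow> axis i (axis j b))"
    by (auto simp: Basis_vec_def)
  then obtain g where g: "\<And>v. v \<in> Basis \<Longrightarrow> g v \<in> ?I"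
      "\<And>v. v \<in> Basis \<Longrightarrow> v = (case g v of (i, j, b) \<Rightarrow> axis i (axis j b))"
    by metis
  have inner: "?C (g v) \<omega> = X \<omega> \<bullet> v" if "v \<in> Basis" for v \<omega>
    by (subst (2) g(2)[OF that]) (auto simp: inner_axis split: prod.splits)
  have D: "distributed M lborel (\<lambda>\<omega>. X \<omega> \<bullet> v) (normal_density 0 \<sigma>)" if "v \<in> Basis" for v
  proof -
    obtain i j b where t: "g v = (i, j, b)" "b \<in> Basis" using g(1)[OF \<open>v \<in> Basis\<close>] by auto
    show ?thesis using dist[OF t(2), of i j] inner[OF that] by (simp add: t(1))
  qed
  have comp: "(\<lambda>\<omega>. X \<omega> \<bullet> v) \<in> borel_measurable M" if "v \<in> Basis" for v
    using distributed_measurable[OF D[OF that]] by simp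
  show [measurable]: "X \<in> borel_measurable M"
    by (rule borel_measurable_euclidean_space[THEN iffD2]) (use comp in blast)
  have iv: "indep_vars (\<lambda>_. borel) (\<lambda>v \<omega>. X \<omega> \<bullet> v) Basis"
  proof -
    \<comment> \<open>Restriction to the disjoint singletons \<open>{g v}\<close> reindexes the
      independent family.\<close>
    have "indep_vars (\<lambda>v. PiM {g v} (\<lambda>_. borel)) (\<lambda>v \<omega>. restrict (\<lambda>t. ?C t \<omega>) {g v}) Basis"
    proof (rule indep_vars_restrict[OF ind])
      show "disjoint_family_on (\<lambda>v. {g v}) Basis"
        by (auto simp: disjoint_family_on_def) (metis g(2))
    qed (use g(1) in auto)
    then have "indep_vars (\<lambda>_. borel) (\<lambda>v \<omega>. (restrict (\<lambda>t. ?C t \<omega>) {g v}) (g v)) Basis"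
      by (rule indep_vars_compose2) auto
    then show ?thesis
      by (rule indep_vars_cong[THEN iffD1, rotated -1]) (auto simp: inner[symmetric])
  qed
  have "distr M (\<Pi>\<^sub>M v\<in>Basis. borel) (\<lambda>\<omega>. \<lambda>v\<in>Basis. X \<omega> \<bullet> v) = (\<Pi>\<^sub>M v\<in>Basis. distr M borel (\<lambda>\<omega>. X \<omega> \<bullet> v))"
    by (rule indep_vars_iff_distr_eq_PiM'[THEN iffD1, OF _ _ iv]) (use comp in auto)
  also have "\<dots> = (\<Pi>\<^sub>M v\<in>Basis. density lborel (normal_density 0 \<sigma>))"
  proof (rule PiM_cong)
    fix v :: "'a ^ 'n ^ 'n" assume "v \<in> Basis"
    then show "distr M borel (\<lambda>\<omega>. X \<omega> \<bullet> v) = density lborel (normal_density 0 \<sigma>)"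
      using distributed_distr_eq_density[OF D] by (simp cong: distr_cong)
  qed simp
  finally have "gauss \<sigma> = distr (distr M (\<Pi>\<^sub>M v\<in>Basis. borel) (\<lambda>\<omega>. \<lambda>v\<in>Basis. X \<omega> \<bullet> v)) borel (\<lambda>f. \<Sum>b\<in>Basis. f b *\<^sub>R b)"
    by (simp add: gauss_eq_PiM[OF \<sigma>])
  also have "\<dots> = distr M borel ((\<lambda>f. \<Sum>b\<in>Basis. f b *\<^sub>R b) \<circ> (\<lambda>\<omega>. \<lambda>v\<in>Basis. X \<omega> \<bullet> v))"
    by (rule distr_distr) auto
  also have "(\<lambda>f. \<Sum>b\<in>Basis. f b *\<^sub>R b) \<circ> (\<lambda>\<omega>. \<lambda>v\<in>Basis. X \<omega> \<bullet> v) = X"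
    by (auto simp: fun_eq_iff euclidean_representation)
  finally show "distr M borel X = gauss \<sigma>" by simp
qed

section \<open>The Frobenius norm and isometries\<close>

lemma power2_norm_vec: "(norm x)\<^sup>2 = (\<Sum>i\<in>UNIV. (norm (x $ i))\<^sup>2)"
  by (simp add: norm_vec_def L2_set_def sum_nonneg)

lemma norm_matrix_vector_mult_le:
  fixes A :: "'a::real_normed_div_algebra ^ 'n ^ 'm"
  shows "norm (A *v x) \<le> norm A * norm x"
proof -
  have "norm ((A *v x) $ i) \<le> norm (A $ i) * norm x" for i
  proof -
    have "norm ((A *v x) $ i) \<le> (\<Sum>j\<in>UNIV. norm (A $ i $ j) * norm (x $ j))"
      unfolding matrix_vector_mult_def vec_lambda_beta by (rule sum_norm_le) (simp add: norm_mult)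
    also have "\<dots> \<le> norm (A $ i) * norm x"
      using L2_set_mult_ineq[of "\<lambda>j. norm (A $ i $ j)" "\<lambda>j. norm (x $ j)" UNIV]
      by (simp add: norm_vec_def[symmetric])
    finally show ?thesis .
  qed
  then have "norm (A *v x) \<le> L2_set (\<lambda>i. norm (A $ i) * norm x) UNIV"
    unfolding norm_vec_def[of "A *v x"] by (intro L2_set_mono) auto
  also have "\<dots> = norm A * norm x"
    by (simp add: L2_set_left_distrib[symmetric] norm_vec_def[of A])
  finally show ?thesis .
qed

lemma matrix_vector_mult_axis:
  fixes A :: "'a::semiring_1 ^ 'n ^ 'm"
  shows "A *v axis j 1 = column j A"
  by (simp add: vec_eq_iff matrix_vector_mult_def column_def axis_def if_distrib[where f="\<lambda>x. _ * x"] cong: if_cong)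

lemma power2_norm_matrix_columns:
  fixes A :: "'a::real_normed_div_algebra ^ 'n ^ 'm"
  shows "(norm A)\<^sup>2 = (\<Sum>j\<in>UNIV. (norm (A *v axis j 1))\<^sup>2)"
  unfolding power2_norm_vec[of A] power2_norm_vec[of "_ $ _"] power2_norm_vec[of "A *v _"]
  by (subst sum.swap) (simp add: matrix_vector_mult_axis column_def)

lemma axis_eq_vmult: "axis i u = vmult (axis i 1) u" for u :: "'a::semiring_1"
  by (simp add: vec_eq_iff axis_def)

text \<open>Right multiplication by \<open>c\<close> scales all norms by \<open>norm c\<close>, so
  polarisation gives its effect on the real inner product without any use of conjugation.\<close>

lemma inner_vmult:
  fixes x y :: "'a::{euclidean_space, real_normed_div_algebra} ^ 'n"
  shows "vmult x c \<bullet> vmult y c = (norm c)\<^sup>2 * (x \<bullet> y)"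
proof -
  have "vmult x c + vmult y c = vmult (x + y) c" by (simp add: vec_eq_iff distrib_right)
  then show ?thesis by (simp add: dot_norm norm_vmult power_mult_distrib algebra_simps)
qed

text \<open>The real basis meets each column \<open>DIM('a)\<close> times, through unit scalars that
  preserve its length. The Frobenius norm thereby becomes the Hilbert-Schmidt norm of a real linear
  map, up to a constant.\<close>

lemma power2_norm_matrix_Basis:
  fixes A :: "'a::{euclidean_space, real_normed_div_algebra} ^ 'n ^ 'm"
  shows "(\<Sum>b\<in>Basis. (norm (A *v b))\<^sup>2) = real DIM('a) * (norm A)\<^sup>2"
proof -
  let ?f = "\<lambda>b. (norm (A *v b))\<^sup>2"
  have B: "Basis = (\<lambda>(i, u). axis i u) ` (UNIV \<times> (Basis :: 'a set))"
    by (auto simp: Basis_vec_def)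
  have I: "inj_on (\<lambda>(i, u). axis i u :: 'a ^ 'n) (UNIV \<times> Basis)"
    by (auto simp: inj_on_def axis_eq_axis dest: nonzero_Basis)
  have "sum ?f Basis = sum ?f ((\<lambda>(i, u). axis i u) ` (UNIV \<times> (Basis :: 'a set)))"
    by (rule arg_cong[OF B])
  also have "\<dots> = (\<Sum>(i, u)\<in>UNIV \<times> (Basis :: 'a set). (norm (A *v axis i u))\<^sup>2)"
    by (subst sum.reindex[OF I]) (simp add: case_prod_unfold)
  also have "\<dots> = (\<Sum>i\<in>UNIV. \<Sum>u\<in>(Basis :: 'a set). (norm (A *v axis i u))\<^sup>2)"
    by (rule sum.cartesian_product[symmetric])
  also have "\<dots> = (\<Sum>i\<in>UNIV. real DIM('a) * (norm (A *v axis i 1))\<^sup>2)"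
  proof (rule sum.cong)
    fix i
    have "(\<Sum>u\<in>(Basis :: 'a set). (norm (A *v axis i u))\<^sup>2) = (\<Sum>u\<in>(Basis :: 'a set). (norm (A *v axis i 1))\<^sup>2)"
      by (intro sum.cong refl, subst axis_eq_vmult) (simp add: matrix_vector_mult_vmult norm_vmult)
    then show "(\<Sum>u\<in>(Basis :: 'a set). (norm (A *v axis i u))\<^sup>2) = real DIM('a) * (norm (A *v axis i 1))\<^sup>2"
      by simp
  qed simp
  finally show ?thesis by (simp add: power2_norm_matrix_columns sum_distrib_left)
qed

text \<open>Parseval's identity twice, with the two sums exchanged.\<close>

lemma sum_norm_Basis_adjoint:
  fixes f :: "'b::euclidean_space \<Rightarrow> 'c::euclidean_space"
  assumes f: "linear f"
  shows "(\<Sum>b\<in>Basis. (norm (f b))\<^sup>2) = (\<Sum>c\<in>Basis. (norm (adjoint f c))\<^sup>2)"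
proof -
  have n: "(norm z)\<^sup>2 = (\<Sum>c\<in>Basis. (z \<bullet> c)\<^sup>2)" for z :: "'d::euclidean_space"
    using euclidean_inner[of z z] unfolding power2_norm_eq_inner by (simp only: power2_eq_square)
  have "(\<Sum>b\<in>Basis. (norm (f b))\<^sup>2) = (\<Sum>b\<in>Basis. \<Sum>c\<in>Basis. (b \<bullet> adjoint f c)\<^sup>2)"
    by (simp add: n adjoint_works[OF f])
  also have "\<dots> = (\<Sum>c\<in>Basis. \<Sum>b\<in>Basis. (b \<bullet> adjoint f c)\<^sup>2)" by (rule sum.swap)
  finally show ?thesis by (simp add: n inner_commute)
qed

lemma sum_norm_Basis_orthogonal_transformation:
  fixes f :: "'b::euclidean_space \<Rightarrow> 'c::euclidean_space"
  assumes f: "linear f" and T: "orthogonal_transformation (T :: 'b \<Rightarrow> 'b)"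
  shows "(\<Sum>b\<in>Basis. (norm (f (T b)))\<^sup>2) = (\<Sum>b\<in>Basis. (norm (f b))\<^sup>2)"
proof -
  have lT: "linear T" using T by (rule orthogonal_transformation_linear)
  have l: "linear (\<lambda>x. f (T x))" using linear_compose[OF lT f] by (simp add: comp_def)
  have adj: "adjoint T (T x) = x" for x
    by (rule vector_eq_rdot[THEN iffD1], intro allI)
      (use T in \<open>simp add: adjoint_clauses[OF lT] orthogonal_transformation_def inner_commute\<close>)
  have nadj: "norm (adjoint T z) = norm z" for z
    using adj orthogonal_transformation_surj[OF T] orthogonal_transformation_norm[OF T] by (metis surjD)
  have "adjoint (\<lambda>x. f (T x)) c = adjoint T (adjoint f c)" for c
    by (rule vector_eq_ldot[THEN iffD1], intro allI)
      (simp add: adjoint_works[OF l] adjoint_works[OF f] adjoint_works[OF lT])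
  then show ?thesis by (simp add: sum_norm_Basis_adjoint[OF l] sum_norm_Basis_adjoint[OF f] nadj)
qed

text \<open>Left multiplication preserves the length of every column. For right multiplication the
  Hilbert-Schmidt norm is used: passing to the adjoint turns an isometry on the right into one on
  the left.\<close>

lemma norm_matrix_mult_isometry:
  fixes A U :: "'a::{euclidean_space, real_normed_div_algebra} ^ 'n ^ 'n"
  assumes U: "\<And>x. norm (U *v x) = norm x"
  shows "norm (U ** A) = norm A" "norm (A ** U) = norm A"
proof -
  have "(norm (U ** A))\<^sup>2 = (norm A)\<^sup>2"
    by (simp add: power2_norm_matrix_columns matrix_vector_mul_assoc[symmetric] U)
  then show "norm (U ** A) = norm A" by simp
  have "orthogonal_transformation ((*v) U)" using U by (simp add: orthogonal_transformation)
  from sum_norm_Basis_orthogonal_transformation[OF matrix_vector_mul_linear this, of A]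
  have "(norm (A ** U))\<^sup>2 = (norm A)\<^sup>2"
    by (simp add: matrix_vector_mul_assoc power2_norm_matrix_Basis)
  then show "norm (A ** U) = norm A" by simp
qed

text \<open>A real-linear isometry of a finite-dimensional space is onto, so preimages of the unit
  vectors form the columns of a right inverse \<open>W\<close>; injectivity of \<open>U\<close>
  makes it a left inverse.\<close>

lemma isometry_matrix_inverse:
  fixes U :: "'a::{euclidean_space, real_normed_div_algebra} ^ 'n ^ 'n"
  assumes U: "\<And>x. norm (U *v x) = norm x"
  obtains W where "W ** U = mat 1" "\<And>x. norm (W *v x) = norm x"
proof -
  have T: "orthogonal_transformation ((*v) U)" using U by (simp add: orthogonal_transformation)
  have "\<exists>w. \<forall>j. U *v w j = axis j 1"
    by (intro choice) (metis surjD[OF orthogonal_transformation_surj[OF T]])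
  then obtain w where w: "\<And>j. U *v w j = axis j 1" by blast
  define W where "W = (\<chi> i j. w j $ i)"
  have UW: "U ** W = mat 1"
    unfolding vec_eq_iff
  proof (intro allI)
    fix i j
    have "(U ** W) $ i $ j = (U *v w j) $ i"
      by (simp add: matrix_matrix_mult_def matrix_vector_mult_def W_def)
    then show "(U ** W) $ i $ j = mat 1 $ i $ j" by (simp add: w axis_def mat_def)
  qed
  have nW: "norm (W *v x) = norm x" for x
    using U[of "W *v x"] by (simp add: matrix_vector_mul_assoc UW)
  have "U *v (W *v (U *v x)) = U *v x" for x
    by (simp add: matrix_vector_mul_assoc matrix_mul_assoc UW)
  then have "W *v (U *v x) = x" for x
    using orthogonal_transformation_inj[OF T] by (simp add: inj_eq)
  then have "W ** U = mat 1" by (simp add: matrix_eq matrix_vector_mul_assoc[symmetric])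
  then show ?thesis using that nW by blast
qed

section \<open>Gram-Schmidt along a flag\<close>

lemma subspace_below: "subspace (below r n :: ('a::euclidean_space ^ 'n) set)"
  by (auto simp: subspace_def below_def)

text \<open>This is the factorisation \<open>P = U R\<close> with \<open>R\<close> triangular and
  positive real diagonal \<open>\<rho>\<close>. The second conclusion records the effect of
  \<open>R\<close> on \<open>lead r k\<close>, the form in which pivots see it.\<close>

lemma isometry_adapted_to_flag:
  fixes P :: "'a::{euclidean_space, real_normed_div_algebra} ^ 'n ^ 'n"
  assumes r: "inj r" and inj: "\<And>x. P *v x = 0 \<Longrightarrow> x = 0"
  obtains U where "\<And>x. norm (U *v x) = norm x"
    "\<And>k. \<exists>\<rho>>0. (*v) P ` lead r k = (\<lambda>x. \<rho> *\<^sub>R (U *v x)) ` lead r k"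
proof -
  have injP: "inj ((*v) P)" using inj by (simp add: linear_injective_0)
  define E where "E n = (*v) P ` below r n" for n
  have sE: "subspace (E n)" for n
    unfolding E_def by (rule linear_subspace_image[OF matrix_vector_mul_linear subspace_below])
  have vE: "vmult y c \<in> E n" if "y \<in> E n" for y c n
  proof -
    obtain x where "x \<in> below r n" "y = P *v x" using \<open>y \<in> E n\<close> by (auto simp: E_def)
    then have "vmult x c \<in> below r n" "vmult y c = P *v vmult x c"
      by (auto simp: below_def matrix_vector_mult_vmult)
    then show ?thesis by (auto simp: E_def)
  qed
  have monoE: "E m \<subseteq> E n" if "m \<le> n" for m n
    using that unfolding E_def by (intro image_mono) (auto simp: below_def)
  \<comment> \<open>\<open>p\<close> is the projection of the \<open>j\<close>-th column to the span
    of the earlier ones; the remainder is nonzero by injectivity, and its length is \<rho>.\<close>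
  have "\<exists>p u \<rho>. p \<in> E (r j) \<and> (\<forall>w\<in>E (r j). u \<bullet> w = 0) \<and> norm u = 1 \<and> \<rho> > 0 \<and> P *v axis j 1 = p + \<rho> *\<^sub>R u" for j
  proof -
    obtain p z where p: "p \<in> span (E (r j))" and z: "\<And>w. w \<in> span (E (r j)) \<Longrightarrow> orthogonal z w"
      and e: "P *v axis j 1 = p + z" 
      using orthogonal_subspace_decomp_exists[of "E (r j)" "P *v axis j 1"] by metis
    have sp: "span (E (r j)) = E (r j)" using sE by (simp add: span_eq_iff)
    have "z \<noteq> 0"
    proof
      assume "z = 0"
      then have "P *v axis j 1 \<in> E (r j)" using e p sp by simp
      then have "(axis j 1 :: 'a ^ 'n) \<in> below r (r j)" unfolding E_def using injP by (simp add: inj_image_mem_iff)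
      then show False by (auto simp: below_def axis_def)
    qed
    then show ?thesis using p z e sp
      by (intro exI[of _ p] exI[of _ "z /\<^sub>R norm z"] exI[of _ "norm z"]) (auto simp: orthogonal_def)
  qed
  then obtain p u \<rho> where p: "\<And>j. p j \<in> E (r j)" and u: "\<And>j w. w \<in> E (r j) \<Longrightarrow> u j \<bullet> w = 0"
    and nu: "\<And>j. norm (u j) = 1" and \<rho>: "\<And>j. \<rho> j > 0" and e: "\<And>j. P *v axis j 1 = p j + \<rho> j *\<^sub>R u j"
    by metis
  have uE: "u j \<in> E (Suc (r j))" for j
  proof -
    have "(axis j 1 :: 'a ^ 'n) \<in> below r (Suc (r j))" by (auto simp: below_def axis_def)
    then have "P *v axis j 1 \<in> E (Suc (r j))" by (auto simp: E_def)
    then have "(P *v axis j 1 - p j) /\<^sub>R \<rho> j \<in> E (Suc (r j))"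
      using p[of j] monoE[of "r j" "Suc (r j)"] sE by (intro subspace_scale subspace_diff) auto
    then show ?thesis using \<rho>[of j] by (simp add: e)
  qed
  \<comment> \<open>\<open>E\<close> is closed under right multiplication, so \<open>w\<close> is
    itself a right multiple by \<open>a\<close>. Real orthogonality to \<open>E\<close> thus extends
    to all right multiples of \<open>u j\<close>.\<close>
  have orth: "vmult (u j) a \<bullet> w = 0" if "w \<in> E (r j)" for j a w
  proof (cases "a = 0")
    case True
    then have "vmult (u j) a = 0" by (simp add: vec_eq_iff)
    then show ?thesis by simp
  next
    case False
    then have "w = vmult (vmult w (inverse a)) a" by (simp add: vec_eq_iff mult.assoc)
    then have "vmult (u j) a \<bullet> w = (norm a)\<^sup>2 * (u j \<bullet> vmult w (inverse a))" by (metis inner_vmult)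
    then show ?thesis using u vE that by simp
  qed
  define U where "U = (\<chi> i j. u j $ i)"
  have U: "U *v x = (\<Sum>j\<in>UNIV. vmult (u j) (x $ j))" for x
    by (simp add: vec_eq_iff matrix_vector_mult_def U_def sum_component)
  have nU: "norm (U *v x) = norm x" for x
  proof -
    have "pairwise (\<lambda>i j. orthogonal (vmult (u i) (x $ i)) (vmult (u j) (x $ j))) UNIV"
    proof (rule pairwiseI)
      fix i j :: 'n assume "i \<noteq> j"
      then consider "r i < r j" | "r j < r i" using r by (metis injD nat_neq_iff)
      then show "orthogonal (vmult (u i) (x $ i)) (vmult (u j) (x $ j))"
      proof cases
        case 1
        then have "vmult (u i) (x $ i) \<in> E (r j)" using vE[OF uE] monoE[of "Suc (r i)" "r j"] by auto
        from orth[OF this, of "x $ j"] show ?thesis by (simp add: orthogonal_def inner_commute)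
      next
        case 2
        then have "vmult (u j) (x $ j) \<in> E (r i)" using vE[OF uE] monoE[of "Suc (r j)" "r i"] by auto
        from orth[OF this] show ?thesis by (simp add: orthogonal_def)
      qed
    qed
    then have "(norm (U *v x))\<^sup>2 = (\<Sum>j\<in>UNIV. (norm (vmult (u j) (x $ j)))\<^sup>2)"
      unfolding U by (intro norm_sum_Pythagorean) auto
    also have "\<dots> = (norm x)\<^sup>2" by (simp add: norm_vmult nu power2_norm_vec[of x])
    finally show ?thesis by simp
  qed
  then have T: "orthogonal_transformation ((*v) U)" by (simp add: orthogonal_transformation)
  \<comment> \<open>One inclusion holds by construction of the \<open>u j\<close>, and the real
    dimensions agree because both maps are injective.\<close>
  have UE: "(*v) U ` below r n = E n" for n
  proof (rule subspace_dim_equal)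
    show "subspace ((*v) U ` below r n)" by (rule linear_subspace_image[OF matrix_vector_mul_linear subspace_below])
    show "(*v) U ` below r n \<subseteq> E n"
    proof (rule image_subsetI)
      fix x :: "'a ^ 'n" assume x: "x \<in> below r n"
      show "U *v x \<in> E n"
        unfolding U
      proof (rule subspace_sum[OF sE])
        fix j
        show "vmult (u j) (x $ j) \<in> E n"
        proof (cases "r j < n")
          case True
          then show ?thesis using vE[OF uE] monoE[of "Suc (r j)" n] by auto
        next
          case False
          then have "vmult (u j) (x $ j) = 0" using x by (auto simp: below_def vec_eq_iff)
          then show ?thesis using subspace_0[OF sE] by simp
        qed
      qed
    qed
    have "dim ((*v) U ` below r n) = dim (below r n :: ('a ^ 'n) set)"
      by (rule dim_image_eq[OF matrix_vector_mul_linear]) (use orthogonal_transformation_inj[OF T] in \<open>blast intro: inj_on_subset\<close>)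
    moreover have "dim (E n) = dim (below r n :: ('a ^ 'n) set)"
      unfolding E_def by (rule dim_image_eq[OF matrix_vector_mul_linear]) (use injP in \<open>blast intro: inj_on_subset\<close>)
    ultimately show "dim (E n) \<le> dim ((*v) U ` below r n)" by simp
  qed (rule sE)
  have lead_split: "x - axis k 1 \<in> below r (r k)" if "x \<in> lead r k" for x :: "'a ^ 'n" and k
    using that r by (auto simp: below_def lead_def axis_def dest: injD le_neq_implies_less)
  have lead_add: "axis k 1 + y \<in> lead r k" if "y \<in> below r (r k)" for y :: "'a ^ 'n" and k
    using that by (auto simp: below_def lead_def axis_def)
  have Uaxis: "U *v axis j 1 = u j" for j
    by (simp add: matrix_vector_mult_axis column_def U_def vec_eq_iff)
  have "(*v) P ` lead r k = (\<lambda>x. \<rho> k *\<^sub>R (U *v x)) ` lead r k" for k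
  proof (intro equalityI image_subsetI)
    fix x :: "'a ^ 'n" assume x: "x \<in> lead r k"
    have "p k + P *v (x - axis k 1) \<in> E (r k)"
      using p lead_split[OF x] sE by (intro subspace_add) (auto simp: E_def)
    then obtain y where y: "y \<in> below r (r k)" "p k + P *v (x - axis k 1) = U *v y"
      unfolding UE[symmetric] by auto
    have "P *v x = P *v axis k 1 + P *v (x - axis k 1)"
      by (simp add: matrix_vector_right_distrib[symmetric])
    also have "\<dots> = \<rho> k *\<^sub>R u k + U *v y" using y(2) by (simp add: e algebra_simps)
    also have "\<dots> = \<rho> k *\<^sub>R (U *v (axis k 1 + y /\<^sub>R \<rho> k))"
      using \<rho>[of k] by (simp add: matrix_vector_right_distrib Uaxis scaleR_right_distrib linear_scale[OF matrix_vector_mul_linear])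
    finally show "P *v x \<in> (\<lambda>x. \<rho> k *\<^sub>R (U *v x)) ` lead r k"
      using lead_add[of "y /\<^sub>R \<rho> k" k] y(1) subspace_scale[OF subspace_below] by blast
  next
    fix x :: "'a ^ 'n" assume x: "x \<in> lead r k"
    have "\<rho> k *\<^sub>R (U *v (x - axis k 1)) - p k \<in> E (r k)"
      using p lead_split[OF x] sE by (intro subspace_diff subspace_scale) (auto simp: UE[symmetric])
    then obtain y where y: "y \<in> below r (r k)" "\<rho> k *\<^sub>R (U *v (x - axis k 1)) - p k = P *v y"
      by (auto simp: E_def)
    have "\<rho> k *\<^sub>R (U *v x) = \<rho> k *\<^sub>R (U *v axis k 1) + \<rho> k *\<^sub>R (U *v (x - axis k 1))"
      by (simp add: matrix_vector_right_distrib[symmetric] scaleR_right_distrib[symmetric])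
    also have "\<dots> = P *v (axis k 1 + y)"
      unfolding matrix_vector_right_distrib e Uaxis y(2)[symmetric] by simp
    finally show "\<rho> k *\<^sub>R (U *v x) \<in> (*v) P ` lead r k" using lead_add[OF y(1)] by blast
  qed
  then show ?thesis using that[OF nU] \<rho> by blast
qed


section \<open>Pivots of a Gaussian perturbation of the identity\<close>

lemma norm_axis: "norm (axis k u) = norm (u :: 'a::real_normed_vector)"
  by (simp add: norm_vec_def L2_set_def axis_def if_distrib[where f=norm] if_distrib[where f="\<lambda>x. x\<^sup>2"] cong: if_cong)

lemma pivot_mat_1: "pivot r k (mat 1 :: 'a::real_normed_div_algebra ^ 'n ^ 'n) = 1"
proof (rule antisym)
  show "pivot r k (mat 1 :: 'a ^ 'n ^ 'n) \<le> 1"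
    using pivot_le_lead[OF axis_in_lead, of r k "mat 1 :: 'a ^ 'n ^ 'n"] by (simp add: norm_axis)
  show "1 \<le> pivot r k (mat 1 :: 'a ^ 'n ^ 'n)"
    unfolding pivot_def
  proof (rule cINF_greatest)
    show "lead r k \<noteq> ({} :: ('a ^ 'n) set)" using axis_in_lead by blast
    fix x :: "'a ^ 'n" assume "x \<in> lead r k"
    then show "1 \<le> norm (mat 1 *v x)" using Finite_Cartesian_Product.norm_nth_le[of x k] by (simp add: lead_def)
  qed
qed

lemma pivot_isometry_mult:
  assumes "\<And>x. norm (W *v x) = norm x"
  shows "pivot r k (W ** A) = pivot r k A"
  by (simp add: pivot_def matrix_vector_mul_assoc[symmetric] assms)

text \<open>\<open>P\<close> maps \<open>lead r k\<close> onto the \<rho>-multiple of its image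
  under \<open>U\<close>, so \<rho> factors out of the infimum for every \<open>A\<close>. The case
  \<open>A = mat 1\<close> identifies \<rho> as \<open>pivot r k P\<close>, isometries having all
  pivots 1. One \<open>U\<close> serves all \<open>k\<close> and \<open>A\<close>.\<close>

lemma pivot_mult_eq:
  fixes P :: "'a::{euclidean_space, real_normed_div_algebra} ^ 'n ^ 'n"
  assumes r: "inj r" and inj: "\<And>x. P *v x = 0 \<Longrightarrow> x = 0"
  obtains U where "\<And>x. norm (U *v x) = norm x" "\<And>k. pivot r k P > 0"
    "\<And>A k. pivot r k (A ** P) = pivot r k P * pivot r k (A ** U)"
proof -
  obtain U where U: "\<And>x. norm (U *v x) = norm x"
    and L: "\<And>k. \<exists>\<rho>>0. (*v) P ` lead r k = (\<lambda>x. \<rho> *\<^sub>R (U *v x)) ` lead r k"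
    using isometry_adapted_to_flag[OF r inj] by metis
  have "\<exists>\<rho>>0. \<forall>A. pivot r k (A ** P) = \<rho> * pivot r k (A ** U)" for k
  proof -
    obtain \<rho> where \<rho>: "\<rho> > 0" and e: "(*v) P ` lead r k = (\<lambda>x. \<rho> *\<^sub>R (U *v x)) ` lead r k" using L by blast
    have ne: "lead r k \<noteq> ({} :: ('a ^ 'n) set)" using axis_in_lead by blast
    have sc: "norm (A *v (\<rho> *\<^sub>R (U *v x))) = \<rho> * norm ((A ** U) *v x)" for A :: "'a ^ 'n ^ 'n" and x
      using \<rho> by (simp add: linear_scale[OF matrix_vector_mul_linear] matrix_vector_mul_assoc)
    have "pivot r k (A ** P) = \<rho> * pivot r k (A ** U)" for A
    proof (rule antisym)
      have "pivot r k (A ** P) / \<rho> \<le> pivot r k (A ** U)"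
        unfolding pivot_def[of _ _ "A ** U"]
      proof (rule cINF_greatest[OF ne])
        fix x :: "'a ^ 'n" assume "x \<in> lead r k"
        then have "\<rho> *\<^sub>R (U *v x) \<in> (*v) P ` lead r k" using e by blast
        then obtain x' where x': "x' \<in> lead r k" "\<rho> *\<^sub>R (U *v x) = P *v x'" by blast
        have "pivot r k (A ** P) \<le> norm (A *v (P *v x'))"
          using pivot_le_lead[OF x'(1), of "A ** P"] by (simp add: matrix_vector_mul_assoc)
        also have "\<dots> = \<rho> * norm ((A ** U) *v x)" unfolding x'(2)[symmetric] by (rule sc)
        finally show "pivot r k (A ** P) / \<rho> \<le> norm ((A ** U) *v x)" using \<rho> by (simp add: field_simps)
      qed
      then show "pivot r k (A ** P) \<le> \<rho> * pivot r k (A ** U)" using \<rho> by (simp add: field_simps)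
      show "\<rho> * pivot r k (A ** U) \<le> pivot r k (A ** P)"
        unfolding pivot_def[of _ _ "A ** P"]
      proof (rule cINF_greatest[OF ne])
        fix x :: "'a ^ 'n" assume "x \<in> lead r k"
        then have "P *v x \<in> (\<lambda>x. \<rho> *\<^sub>R (U *v x)) ` lead r k" using e by blast
        then obtain x' where x': "x' \<in> lead r k" "P *v x = \<rho> *\<^sub>R (U *v x')" by blast
        have "\<rho> * pivot r k (A ** U) \<le> \<rho> * norm ((A ** U) *v x')"
          using \<rho> by (intro mult_left_mono pivot_le_lead x') auto
        also have "\<dots> = norm (A *v (P *v x))" unfolding x'(2) by (rule sc[symmetric])
        finally show "\<rho> * pivot r k (A ** U) \<le> norm ((A ** P) *v x)" by (simp add: matrix_vector_mul_assoc)
      qed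
    qed
    then show ?thesis using \<rho> by blast
  qed
  then obtain \<rho> where \<rho>: "\<And>k. \<rho> k > 0" "\<And>k A. pivot r k (A ** P) = \<rho> k * pivot r k (A ** U)" by metis
  have "pivot r k P = \<rho> k" for k
  proof -
    have "pivot r k P = \<rho> k * pivot r k U" using \<rho>(2)[of k "mat 1"] by simp
    moreover have "pivot r k U = 1" using pivot_isometry_mult[OF U, of r k "mat 1"] by (simp add: pivot_mat_1)
    ultimately show ?thesis by simp
  qed
  then show ?thesis using that[OF U] \<rho> by simp
qed

lemma continuous_matrix_vector_mult_left:
  "continuous_on UNIV (\<lambda>A. (A :: 'a::real_normed_algebra_1 ^ 'n ^ 'm) *v x)"
  unfolding matrix_vector_mult_def by (intro continuous_intros)

text \<open>The infimum is over an uncountable set, but of continuous functions of \<open>A\<close>: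
  its strict sublevel sets are unions of open sets.\<close>

lemma borel_measurable_pivot [measurable]:
  "pivot r k \<in> borel_measurable (borel :: ('a::{euclidean_space, real_normed_div_algebra} ^ 'n ^ 'n) measure)"
proof (rule borel_measurable_iff_less[THEN iffD2], intro allI)
  fix a
  have ne: "lead r k \<noteq> ({} :: ('a ^ 'n) set)" using axis_in_lead by blast
  have "{A \<in> space borel. pivot r k A < a} = (\<Union>x\<in>lead r k. {A :: 'a ^ 'n ^ 'n. norm (A *v x) < a})"
    using ne by (auto simp: pivot_def cINF_less_iff pivot_bdd)
  also have "open \<dots>"
    by (intro open_UN ballI open_Collect_less continuous_on_norm continuous_matrix_vector_mult_left continuous_on_const)
  finally show "{A \<in> space borel. pivot r k A < a} \<in> sets (borel :: ('a ^ 'n ^ 'n) measure)" by (auto intro: borel_open)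
qed

lemma matrix_add_rdistrib:
  fixes A B C :: "'a::ring_1 ^ 'n ^ 'n"
  shows "(A + B) ** C = A ** C + B ** C"
  by (simp add: vec_eq_iff matrix_matrix_mult_def distrib_right sum.distrib)

lemma matrix_mult_scaleR_right:
  fixes A B :: "'a::real_algebra_1 ^ 'n ^ 'n"
  shows "A ** (c *\<^sub>R B) = c *\<^sub>R (A ** B)"
  by (simp add: vec_eq_iff matrix_matrix_mult_def scaleR_sum_right)

lemma matrix_mult_scaleR_left:
  fixes A B :: "'a::real_algebra_1 ^ 'n ^ 'n"
  shows "(c *\<^sub>R A) ** B = c *\<^sub>R (A ** B)"
  by (simp add: vec_eq_iff matrix_matrix_mult_def scaleR_sum_right)

text \<open>Writing \<open>P = U R\<close> with \<open>U\<close> an isometry and \<open>R\<close> triangular, the pivots of \<open>A P\<close> are those of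
  \<open>P\<close> times those of \<open>U\<^sup>-\<^sup>1 A U\<close>, and conjugation by an isometry preserves the Gaussian measure.\<close>

lemma nn_integral_pivot_mult:
  fixes P :: "'a::{euclidean_space, real_normed_div_algebra} ^ 'n ^ 'n"
  assumes r: "inj r" and inj: "\<And>x. P *v x = 0 \<Longrightarrow> x = 0"
    and [measurable]: "H \<in> borel_measurable borel"
  shows "(\<integral>\<^sup>+X. H (pivot r k ((mat 1 + c *\<^sub>R X) ** P)) \<partial>gauss \<sigma>) =
    (\<integral>\<^sup>+X. H (pivot r k P * pivot r k (mat 1 + c *\<^sub>R X)) \<partial>(gauss \<sigma> :: ('a ^ 'n ^ 'n) measure))"
proof -
  obtain U where U: "\<And>x. norm (U *v x) = norm x"
    and PU: "\<And>A k. pivot r k (A ** P) = pivot r k P * pivot r k (A ** U)"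
    using pivot_mult_eq[OF r inj] by metis
  obtain W where WU: "W ** U = mat 1" and W: "\<And>x. norm (W *v x) = norm x"
    using isometry_matrix_inverse[OF U] by metis
  have T: "orthogonal_transformation (\<lambda>X. W ** (X ** U))"
    unfolding orthogonal_transformation
    by (auto simp: linear_iff matrix_add_rdistrib matrix_add_ldistrib matrix_mult_scaleR_right matrix_mult_scaleR_left
        norm_matrix_mult_isometry[OF U] norm_matrix_mult_isometry[OF W])
  have "pivot r k ((mat 1 + c *\<^sub>R X) ** U) = pivot r k (mat 1 + c *\<^sub>R (W ** (X ** U)))" for X
  proof -
    have "W ** ((mat 1 + c *\<^sub>R X) ** U) = mat 1 + c *\<^sub>R (W ** (X ** U))"
      by (simp add: matrix_add_rdistrib matrix_add_ldistrib matrix_mult_scaleR_right matrix_mult_scaleR_left WU)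
    then show ?thesis using pivot_isometry_mult[OF W, of r k "(mat 1 + c *\<^sub>R X) ** U"] by simp
  qed
  then have "(\<integral>\<^sup>+X. H (pivot r k ((mat 1 + c *\<^sub>R X) ** P)) \<partial>gauss \<sigma>) =
      (\<integral>\<^sup>+X. H (pivot r k P * pivot r k (mat 1 + c *\<^sub>R (W ** (X ** U)))) \<partial>gauss \<sigma>)"
    by (simp add: PU)
  also have "\<dots> = (\<integral>\<^sup>+X. H (pivot r k P * pivot r k (mat 1 + c *\<^sub>R X)) \<partial>(gauss \<sigma> :: ('a ^ 'n ^ 'n) measure))"
    by (rule nn_integral_gauss_orthogonal_transformation[OF T,
          where h="\<lambda>X. H (pivot r k P * pivot r k (mat 1 + c *\<^sub>R X))"]) measurable
  finally show ?thesis .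
qed

section \<open>Resampling one column\<close>

definition replace_column :: "'n \<Rightarrow> 'a ^ 'n ^ 'm \<Rightarrow> 'a ^ 'n ^ 'm \<Rightarrow> 'a ^ 'n ^ 'm" where
  "replace_column k A B = (\<chi> i j. if j = k then B $ i $ j else A $ i $ j)"

lemma replace_column_nth [simp]: "replace_column k A B $ i $ j = (if j = k then B $ i $ j else A $ i $ j)"
  by (simp add: replace_column_def)

lemma orthogonal_transformation_swap_column:
  "orthogonal_transformation (\<lambda>(A :: 'a::euclidean_space ^ 'n ^ 'm, B). (replace_column k A B, replace_column k B A))"
  unfolding orthogonal_transformation
proof (intro conjI allI)
  show "linear (\<lambda>(A :: 'a ^ 'n ^ 'm, B). (replace_column k A B, replace_column k B A))"
    by (auto simp: linear_iff vec_eq_iff)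
  fix z :: "('a ^ 'n ^ 'm) \<times> ('a ^ 'n ^ 'm)"
  obtain A B where z: "z = (A, B)" by fastforce
  have "(norm (replace_column k A B))\<^sup>2 + (norm (replace_column k B A))\<^sup>2 = (norm A)\<^sup>2 + (norm B)\<^sup>2"
    by (simp add: power2_norm_vec sum.distrib[symmetric])
      (intro sum.cong refl, simp)
  then show "norm ((\<lambda>(A :: 'a ^ 'n ^ 'm, B). (replace_column k A B, replace_column k B A)) z) = norm z"
    by (simp add: z norm_Pair)
qed

text \<open>Exchanging the \<open>k\<close>-th columns of two independent copies is an isometry, so
  it preserves their joint law. The inner integral then runs over the \<open>k\<close>-th column
  with the others frozen, which replaces conditioning.\<close>

lemma nn_integral_gauss_replace_column:
  fixes h :: "'a::euclidean_space ^ 'n ^ 'm \<Rightarrow> ennreal"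
  assumes \<sigma>: "\<sigma> > 0" and [measurable]: "h \<in> borel_measurable borel"
  shows "(\<integral>\<^sup>+A. h A \<partial>gauss \<sigma>) = (\<integral>\<^sup>+A. \<integral>\<^sup>+B. h (replace_column k A B) \<partial>gauss \<sigma> \<partial>gauss \<sigma>)"
proof -
  interpret G: prob_space "gauss \<sigma> :: ('a ^ 'n ^ 'm) measure" by (rule prob_space_gauss[OF \<sigma>])
  have [measurable]: "(\<lambda>z. fst z) \<in> borel_measurable (borel :: (('a ^ 'n ^ 'm) \<times> ('a ^ 'n ^ 'm)) measure)"
    by (intro borel_measurable_continuous_onI continuous_intros)
  let ?T = "\<lambda>(A :: 'a ^ 'n ^ 'm, B). (replace_column k A B, replace_column k B A)"
  have mT[measurable]: "?T \<in> borel_measurable borel"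
    by (rule orthogonal_transformation_measurable[OF orthogonal_transformation_swap_column])
  have "(\<integral>\<^sup>+A. h A \<partial>gauss \<sigma>) = (\<integral>\<^sup>+A. \<integral>\<^sup>+B. h (fst (A, B)) \<partial>(gauss \<sigma> :: ('a ^ 'n ^ 'm) measure) \<partial>(gauss \<sigma> :: ('a ^ 'n ^ 'm) measure))"
    using G.emeasure_space_1 by simp
  also have "\<dots> = (\<integral>\<^sup>+z. h (fst z) \<partial>(gauss \<sigma> \<Otimes>\<^sub>M (gauss \<sigma> :: ('a ^ 'n ^ 'm) measure)))"
    by (rule G.nn_integral_fst) (subst gauss_pair[OF \<sigma>], measurable)
  also have "\<dots> = (\<integral>\<^sup>+z. h (fst z) \<partial>(gauss \<sigma> :: (('a ^ 'n ^ 'm) \<times> ('a ^ 'n ^ 'm)) measure))" by (simp add: gauss_pair[OF \<sigma>])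
  also have "\<dots> = (\<integral>\<^sup>+z. h (fst (?T z)) \<partial>gauss \<sigma>)"
    by (rule nn_integral_gauss_orthogonal_transformation[OF orthogonal_transformation_swap_column, symmetric]) measurable
  also have "\<dots> = (\<integral>\<^sup>+z. h (fst (?T z)) \<partial>(gauss \<sigma> \<Otimes>\<^sub>M (gauss \<sigma> :: ('a ^ 'n ^ 'm) measure)))"
    by (simp add: gauss_pair[OF \<sigma>])
  also have "\<dots> = (\<integral>\<^sup>+A. \<integral>\<^sup>+B. h (fst (?T (A, B))) \<partial>gauss \<sigma> \<partial>(gauss \<sigma> :: ('a ^ 'n ^ 'm) measure))"
    by (rule G.nn_integral_fst[symmetric]) (subst gauss_pair[OF \<sigma>], measurable)
  finally show ?thesis by simp
qed

section \<open>Inverse square root moments of normal variables and of pivots\<close>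

lemma orthogonal_transformation_reflection:
  fixes w :: "'b::real_inner"
  shows "orthogonal_transformation (\<lambda>x. x - (2 * (x \<bullet> w) / (w \<bullet> w)) *\<^sub>R w)"
  unfolding orthogonal_transformation_def
proof (intro conjI allI)
  show "linear (\<lambda>x. x - (2 * (x \<bullet> w) / (w \<bullet> w)) *\<^sub>R w)"
    by (simp add: linear_iff algebra_simps inner_add_left add_divide_distrib)
  fix x y
  show "(x - (2 * (x \<bullet> w) / (w \<bullet> w)) *\<^sub>R w) \<bullet> (y - (2 * (y \<bullet> w) / (w \<bullet> w)) *\<^sub>R w) = x \<bullet> y"
  proof (cases "w = 0")
    case False
    define p where "p = x \<bullet> w / (w \<bullet> w)"
    define q where "q = y \<bullet> w / (w \<bullet> w)"
    have pq: "x \<bullet> w = p * (w \<bullet> w)" "y \<bullet> w = q * (w \<bullet> w)" using False by (simp_all add: p_def q_def)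
    have "(x - (2 * p) *\<^sub>R w) \<bullet> (y - (2 * q) *\<^sub>R w) = x \<bullet> y"
      by (simp add: inner_diff_left inner_diff_right inner_commute[of w y] pq)
    then show ?thesis by (simp add: p_def q_def)
  qed simp
qed

text \<open>The reflection along \<open>a - b\<close> exchanges the two unit vectors. For
  \<open>a = b\<close> division by zero turns the formula into the identity, which also
  fits.\<close>

lemma orthogonal_transformation_exists_unit:
  fixes a b :: "'b::euclidean_space"
  assumes "norm a = 1" "norm b = 1"
  obtains T where "orthogonal_transformation T" "T a = b"
proof
  let ?w = "a - b"
  let ?T = "\<lambda>x. x - (2 * (x \<bullet> ?w) / (?w \<bullet> ?w)) *\<^sub>R ?w"
  show "orthogonal_transformation ?T" by (rule orthogonal_transformation_reflection)
  show "?T a = b"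
  proof (cases "a = b")
    case False
    have aa: "a \<bullet> a = 1" "b \<bullet> b = 1" using assms by (simp_all add: dot_square_norm)
    have "?w \<bullet> ?w = 2 * (a \<bullet> ?w)" by (simp add: inner_diff_left inner_diff_right aa inner_commute)
    moreover have "?w \<bullet> ?w \<noteq> 0" using False by simp
    ultimately have e: "2 * (a \<bullet> ?w) / (?w \<bullet> ?w) = 1" by (metis divide_self)
    show ?thesis unfolding e by simp
  qed simp
qed

text \<open>Rotating \<open>B\<close> to a basis vector reduces any unit direction to a
  coordinate.\<close>

lemma nn_integral_gauss_inner:
  fixes B :: "'b::euclidean_space" and h :: "real \<Rightarrow> ennreal"
  assumes \<sigma>: "\<sigma> > 0" and B: "norm B = 1" and [measurable]: "h \<in> borel_measurable borel"
  shows "(\<integral>\<^sup>+x. h (x \<bullet> B) \<partial>gauss \<sigma>) = (\<integral>\<^sup>+x. normal_density 0 \<sigma> x * h x \<partial>lborel)"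
proof -
  obtain v :: 'b where v: "v \<in> Basis" using nonempty_Basis by blast
  obtain T where T: "orthogonal_transformation T" "T B = v"
    using orthogonal_transformation_exists_unit[OF B norm_Basis[OF v]] by metis
  have "(\<integral>\<^sup>+x. h (x \<bullet> B) \<partial>gauss \<sigma>) = (\<integral>\<^sup>+x. h (T x \<bullet> v) \<partial>gauss \<sigma>)"
  proof (rule nn_integral_cong)
    fix x
    have "T x \<bullet> T B = x \<bullet> B" using T(1) by (simp add: orthogonal_transformation_def)
    then show "h (x \<bullet> B) = h (T x \<bullet> v)" by (simp add: T(2))
  qed
  also have "\<dots> = (\<integral>\<^sup>+x. h (x \<bullet> v) \<partial>gauss \<sigma>)"
    by (rule nn_integral_gauss_orthogonal_transformation[OF T(1)]) measurable
  also have "\<dots> = (\<integral>\<^sup>+x. h x \<partial>distr (gauss \<sigma>) borel (\<lambda>x. x \<bullet> v))" by (simp add: nn_integral_distr)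
  also have "\<dots> = (\<integral>\<^sup>+x. normal_density 0 \<sigma> x * h x \<partial>lborel)"
    unfolding distr_gauss_Basis[OF \<sigma> v] by (rule nn_integral_density) auto
  finally show ?thesis .
qed

lemma inverse_ennreal_antimono:
  assumes "a \<le> b" shows "inverse (ennreal b) \<le> inverse (ennreal a)"
proof (cases "a \<le> 0")
  case True
  then show ?thesis by (simp add: ennreal_neg)
next
  case False
  then show ?thesis using assms by (simp add: inverse_ennreal ennreal_leI le_imp_inverse_le)
qed

lemma nn_integral_inverse_sqrt_finite:
  "(\<integral>\<^sup>+y. inverse (ennreal (sqrt \<bar>y\<bar>)) * indicator {-1..1} y \<partial>lborel) < \<infinity>"
proof -
  let ?f = "\<lambda>y. inverse (ennreal (sqrt \<bar>y\<bar>)) * indicator {0..1} y"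
  have "((\<lambda>y::real. y powr (- 1 / 2)) has_integral (1 powr (- 1 / 2 + 1) / (- 1 / 2 + 1))) {0..1}"
    by (rule has_integral_powr_from_0) auto
  then have hi: "((\<lambda>y::real. if y \<in> {0..1} then y powr (- 1 / 2) else 0) has_integral 2) UNIV"
    by (subst has_integral_restrict_UNIV) simp
  have "(\<integral>\<^sup>+y. ?f y \<partial>lborel) = (\<integral>\<^sup>+y. ennreal (if y \<in> {0..1} then y powr (- 1 / 2) else 0) \<partial>lborel)"
  proof (rule nn_integral_cong_AE)
    \<comment> \<open>At 0 the two integrands differ: the inverse in \<open>ennreal\<close> is
      infinite there, whereas \<open>0 powr _ = 0\<close>.\<close>
    have "AE y in lborel. y \<noteq> (0::real)" by (rule AE_lborel_singleton)
    then show "AE y in lborel. ?f y = ennreal (if y \<in> {0..1} then y powr (- 1 / 2) else 0)"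
    proof eventually_elim
      case (elim y)
      show ?case
      proof (cases "y \<in> {0..1}")
        case True
        then have "y > 0" using elim by auto
        then show ?thesis using True by (simp add: inverse_ennreal powr_minus powr_half_sqrt)
      qed auto
    qed
  qed
  also have "\<dots> = ennreal 2"
    by (rule nn_integral_has_integral_lborel[OF _ _ hi]) auto
  finally have I: "(\<integral>\<^sup>+y. ?f y \<partial>lborel) = 2" by simp
  have "(\<integral>\<^sup>+y. inverse (ennreal (sqrt \<bar>y\<bar>)) * indicator {-1..1} y \<partial>lborel) \<le> (\<integral>\<^sup>+y. ?f y + ?f (- y) \<partial>lborel)"
    by (intro nn_integral_mono) (auto simp: indicator_def)
  also have "\<dots> = (\<integral>\<^sup>+y. ?f y \<partial>lborel) + (\<integral>\<^sup>+y. ?f (- y) \<partial>lborel)" by (rule nn_integral_add) measurable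
  also have "(\<integral>\<^sup>+y. ?f (- y) \<partial>lborel) = (\<integral>\<^sup>+y. ?f y \<partial>lborel)"
    by (subst (2) nn_integral_real_affine[where c="-1" and t=0]) auto
  finally show ?thesis unfolding I by (rule le_less_trans) simp
qed

lemma gauss_inverse_sqrt_bound:
  assumes \<sigma>: "\<sigma> > 0" and c: "c > 0"
  obtains K where "K < (\<infinity> :: ennreal)"
    "\<And>a (B :: 'b::euclidean_space). norm B = 1 \<Longrightarrow> (\<integral>\<^sup>+x. inverse (ennreal (sqrt \<bar>a + c * (x \<bullet> B)\<bar>)) \<partial>gauss \<sigma>) \<le> K"
proof -
  let ?f = "\<lambda>y::real. inverse (ennreal (sqrt \<bar>y\<bar>)) * indicator {-1..1} y"
  let ?M = "1 / sqrt (2 * pi * \<sigma>\<^sup>2)"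
  define K where "K = 1 + ennreal ?M * (ennreal (1 / c) * (\<integral>\<^sup>+y. ?f y \<partial>lborel))"
  have "K < \<infinity>"
    using nn_integral_inverse_sqrt_finite by (simp add: K_def ennreal_mult_less_top)
  moreover have "(\<integral>\<^sup>+x. inverse (ennreal (sqrt \<bar>a + c * (x \<bullet> B)\<bar>)) \<partial>gauss \<sigma>) \<le> K" if B: "norm B = 1" for a and B :: 'b
  proof -
    interpret N: prob_space "density lborel (normal_density 0 \<sigma>)" using \<sigma> by (rule prob_space_normal_density)
    have N1: "(\<integral>\<^sup>+x. ennreal (normal_density 0 \<sigma> x) \<partial>lborel) = 1"
      using N.emeasure_space_1 by (simp add: emeasure_density)
    have le: "inverse (ennreal (sqrt \<bar>y\<bar>)) \<le> 1 + ?f y" for y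
    proof (cases "y \<in> {-1..1}")
      case False
      then have "1 \<le> sqrt \<bar>y\<bar>" by auto
      then have "inverse (ennreal (sqrt \<bar>y\<bar>)) \<le> 1"
        by (subst inverse_ennreal) (auto simp: field_simps)
      then show ?thesis using False by simp
    qed simp
    have "(\<integral>\<^sup>+x. inverse (ennreal (sqrt \<bar>a + c * (x \<bullet> B)\<bar>)) \<partial>gauss \<sigma>) =
        (\<integral>\<^sup>+x. normal_density 0 \<sigma> x * inverse (ennreal (sqrt \<bar>a + c * x\<bar>)) \<partial>lborel)"
      by (rule nn_integral_gauss_inner[OF \<sigma> B]) measurable
    also have "\<dots> \<le> (\<integral>\<^sup>+x. normal_density 0 \<sigma> x + ennreal ?M * ?f (a + c * x) \<partial>lborel)"
    proof (rule nn_integral_mono)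
      fix x
      have "ennreal (normal_density 0 \<sigma> x) \<le> ennreal ?M"
        using \<sigma> by (intro ennreal_leI) (simp add: normal_density_def divide_right_mono)
      then have "ennreal (normal_density 0 \<sigma> x) * ?f (a + c * x) \<le> ennreal ?M * ?f (a + c * x)"
        by (rule mult_right_mono) simp
      moreover have "ennreal (normal_density 0 \<sigma> x) * inverse (ennreal (sqrt \<bar>a + c * x\<bar>)) \<le>
          ennreal (normal_density 0 \<sigma> x) * (1 + ?f (a + c * x))"
        by (intro mult_left_mono le) simp
      ultimately show "ennreal (normal_density 0 \<sigma> x) * inverse (ennreal (sqrt \<bar>a + c * x\<bar>)) \<le>
          ennreal (normal_density 0 \<sigma> x) + ennreal ?M * ?f (a + c * x)"
        by (simp only: distrib_left mult_1_right) (meson add_left_mono order_trans)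
    qed
    also have "\<dots> = 1 + ennreal ?M * (\<integral>\<^sup>+x. ?f (a + c * x) \<partial>lborel)"
      by (subst nn_integral_add) (auto simp: N1 nn_integral_cmult)
    also have "(\<integral>\<^sup>+x. ?f (a + c * x) \<partial>lborel) = ennreal (1 / c) * (\<integral>\<^sup>+y. ?f y \<partial>lborel)"
    proof -
      have "(\<integral>\<^sup>+y. ?f y \<partial>lborel) = ennreal c * (\<integral>\<^sup>+x. ?f (a + c * x) \<partial>lborel)"
        using c by (subst nn_integral_real_affine[where c=c and t=a]) auto
      then show ?thesis using c by (simp add: mult.assoc[symmetric] ennreal_mult'[symmetric])
    qed
    finally show ?thesis unfolding K_def .
  qed
  ultimately show ?thesis using that by blast
qed

text \<open>Freeze all columns except the \<open>k\<close>-th. The distance of that column from the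
  span of the earlier ones is at least its component along a unit normal \<open>n\<close> of the
  span, and this component is an affine function of one normal variable.\<close>

lemma nn_integral_pivot_inverse_sqrt_finite:
  fixes r :: "'n::finite \<Rightarrow> nat"
  assumes r: "inj r" and \<sigma>: "\<sigma> > 0" and c: "c > 0"
  shows "(\<integral>\<^sup>+X. inverse (ennreal (sqrt (pivot r k (mat 1 + c *\<^sub>R X))))
    \<partial>(gauss \<sigma> :: ('a::{euclidean_space, real_normed_div_algebra} ^ 'n ^ 'n) measure)) < \<infinity>"
proof -
  interpret G: prob_space "gauss \<sigma> :: ('a ^ 'n ^ 'n) measure" by (rule prob_space_gauss[OF \<sigma>])
  obtain K where K: "K < (\<infinity> :: ennreal)"
    "\<And>a (B :: ('a ^ 'n ^ 'n)). norm B = 1 \<Longrightarrow> (\<integral>\<^sup>+x. inverse (ennreal (sqrt \<bar>a + c * (x \<bullet> B)\<bar>)) \<partial>gauss \<sigma>) \<le> K"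
    using gauss_inverse_sqrt_bound[OF \<sigma> c] by metis
  have inner_le: "(\<integral>\<^sup>+B. inverse (ennreal (sqrt (pivot r k (mat 1 + c *\<^sub>R replace_column k A B)))) \<partial>gauss \<sigma>) \<le> K" for A :: "'a ^ 'n ^ 'n"
  proof -
    let ?A0 = "mat 1 + c *\<^sub>R A"
    \<comment> \<open>\<open>W\<close> depends only on the columns ranked before \<open>k\<close>,
      so resampling column \<open>k\<close> leaves it and its normal \<open>n\<close> fixed.\<close>
    define W where "W = (*v) ?A0 ` below r (r k)"
    have sW: "subspace W" unfolding W_def by (rule linear_subspace_image[OF matrix_vector_mul_linear subspace_below])
    have "below r (r k) \<noteq> (UNIV :: ('a ^ 'n) set)"
    proof
      assume "below r (r k) = (UNIV :: ('a ^ 'n) set)"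
      then have "(axis k 1 :: 'a ^ 'n) \<in> below r (r k)" by simp
      then show False by (auto simp: below_def axis_def)
    qed
    then have "dim (below r (r k) :: ('a ^ 'n) set) \<noteq> DIM('a ^ 'n)"
      using subspace_below[of r "r k"] by (metis dim_eq_full span_eq_iff)
    then have "dim (below r (r k) :: ('a ^ 'n) set) < DIM('a ^ 'n)"
      using dim_subset_UNIV[of "below r (r k) :: ('a ^ 'n) set"] by linarith
    moreover have "dim W \<le> dim (below r (r k) :: ('a ^ 'n) set)"
      unfolding W_def by (rule dim_image_le[OF matrix_vector_mul_linear])
    ultimately have lt: "dim W < DIM('a ^ 'n)" by linarith
    obtain n0 where n0: "n0 \<noteq> 0" "\<And>y. y \<in> span W \<Longrightarrow> orthogonal n0 y"
      using orthogonal_to_subspace_exists[OF lt] by metis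
    define n where "n = n0 /\<^sub>R norm n0"
    have n: "norm n = 1" "\<And>y. y \<in> W \<Longrightarrow> n \<bullet> y = 0"
      using n0 by (auto simp: n_def orthogonal_def span_base)
    \<comment> \<open>\<open>B\<close> carries \<open>n\<close> as its \<open>k\<close>-th column
      and zeros elsewhere, so that \<open>X \<bullet> B\<close> is the component of the
      \<open>k\<close>-th column of \<open>X\<close> along \<open>n\<close>.\<close>
    define B where "B = (\<chi> i. axis k (n $ i))"
    have "(norm B)\<^sup>2 = (norm n)\<^sup>2"
      unfolding power2_norm_vec[of B] power2_norm_vec[of n] by (simp add: B_def norm_axis)
    then have "norm B = norm n" by (metis norm_ge_zero power2_eq_iff_nonneg)
    then have B: "norm B = 1" using n by simp
    define a where "a = axis k 1 \<bullet> n"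
    have "\<bar>a + c * (X \<bullet> B)\<bar> \<le> pivot r k (mat 1 + c *\<^sub>R replace_column k A X)" for X :: "'a ^ 'n ^ 'n"
      unfolding pivot_def
    proof (rule cINF_greatest)
      show "lead r k \<noteq> ({} :: ('a ^ 'n) set)" using axis_in_lead by blast
      fix x :: "'a ^ 'n" assume x: "x \<in> lead r k"
      let ?R = "mat 1 + c *\<^sub>R replace_column k A X"
      let ?y = "x - axis k 1"
      have y: "?y \<in> below r (r k)"
        using x r by (auto simp: below_def lead_def axis_def dest: injD le_neq_implies_less)
      have "?R $ i $ j * ?y $ j = ?A0 $ i $ j * ?y $ j" for i j
        using x by (cases "j = k") (simp_all add: lead_def)
      then have "?R *v ?y = ?A0 *v ?y"
        by (simp only: vec_eq_iff matrix_vector_mult_def vec_lambda_beta) simp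
      then have "n \<bullet> (?R *v ?y) = 0" using n(2) y by (auto simp: W_def)
      moreover have "?R *v axis k 1 = axis k 1 + c *\<^sub>R column k X"
        unfolding matrix_vector_mult_axis by (simp add: column_def vec_eq_iff axis_def mat_def)
      moreover have "column k X \<bullet> n = X \<bullet> B"
        by (simp add: inner_vec_def[of "\<chi> i. X $ i $ k"] inner_vec_def[of X] B_def inner_axis column_def)
      moreover have "?R *v x = ?R *v axis k 1 + ?R *v ?y"
        by (simp add: matrix_vector_right_distrib[symmetric])
      ultimately have "(?R *v x) \<bullet> n = (axis k 1 + c *\<^sub>R column k X) \<bullet> n"
        by (simp only: inner_add_left inner_add_right inner_commute[of _ n] add_0_right)
      then have "a + c * (X \<bullet> B) = (?R *v x) \<bullet> n"
        using \<open>column k X \<bullet> n = X \<bullet> B\<close> by (simp only: a_def inner_add_left inner_scaleR_left)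
      also have "\<bar>\<dots>\<bar> \<le> norm (?R *v x) * norm n" by (rule Cauchy_Schwarz_ineq2)
      finally show "\<bar>a + c * (X \<bullet> B)\<bar> \<le> norm (?R *v x)" using n by simp
    qed
    then have "(\<integral>\<^sup>+X. inverse (ennreal (sqrt (pivot r k (mat 1 + c *\<^sub>R replace_column k A X)))) \<partial>gauss \<sigma>) \<le>
        (\<integral>\<^sup>+X. inverse (ennreal (sqrt \<bar>a + c * (X \<bullet> B)\<bar>)) \<partial>gauss \<sigma>)"
      by (intro nn_integral_mono inverse_ennreal_antimono real_sqrt_le_mono)
    also have "\<dots> \<le> K" by (rule K(2)[OF B])
    finally show ?thesis .
  qed
  have "(\<integral>\<^sup>+X. inverse (ennreal (sqrt (pivot r k (mat 1 + c *\<^sub>R X)))) \<partial>(gauss \<sigma> :: ('a ^ 'n ^ 'n) measure)) =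
      (\<integral>\<^sup>+A. \<integral>\<^sup>+B. inverse (ennreal (sqrt (pivot r k (mat 1 + c *\<^sub>R replace_column k A B)))) \<partial>gauss \<sigma> \<partial>(gauss \<sigma> :: ('a ^ 'n ^ 'n) measure))"
    by (rule nn_integral_gauss_replace_column[OF \<sigma>]) measurable
  also have "\<dots> \<le> (\<integral>\<^sup>+A. K \<partial>(gauss \<sigma> :: ('a ^ 'n ^ 'n) measure))" by (intro nn_integral_mono inner_le)
  also have "\<dots> = K" using G.emeasure_space_1 by simp
  finally show ?thesis using K(1) by (rule le_less_trans)
qed

lemma nn_integral_gauss_norm_finite:
  assumes \<sigma>: "\<sigma> > 0"
  shows "(\<integral>\<^sup>+x. ennreal (norm x) \<partial>(gauss \<sigma> :: 'b::euclidean_space measure)) < \<infinity>"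
proof -
  have "(\<integral>\<^sup>+x. ennreal (norm x) \<partial>(gauss \<sigma> :: 'b measure)) \<le> (\<integral>\<^sup>+x. (\<Sum>b\<in>Basis. ennreal \<bar>x \<bullet> b\<bar>) \<partial>(gauss \<sigma> :: 'b measure))"
    by (intro nn_integral_mono) (simp add: sum_ennreal norm_le_l1 ennreal_leI)
  also have "\<dots> = (\<Sum>b\<in>Basis. \<integral>\<^sup>+x. ennreal \<bar>x \<bullet> b\<bar> \<partial>(gauss \<sigma> :: 'b measure))"
    by (rule nn_integral_sum) measurable
  also have "\<dots> = (\<Sum>b\<in>(Basis :: 'b set). \<integral>\<^sup>+x. normal_density 0 \<sigma> x * ennreal \<bar>x\<bar> \<partial>lborel)"
    by (intro sum.cong refl nn_integral_gauss_inner[OF \<sigma>]) auto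
  also have "(\<integral>\<^sup>+x. normal_density 0 \<sigma> x * ennreal \<bar>x\<bar> \<partial>lborel) < \<infinity>"
    using integrable_normal_moment_abs[OF \<sigma>, of 0 1]
    by (simp add: integrable_iff_bounded abs_mult ennreal_mult'[symmetric])
  then have "(\<Sum>b\<in>(Basis :: 'b set). \<integral>\<^sup>+x. normal_density 0 \<sigma> x * ennreal \<bar>x\<bar> \<partial>lborel) < \<infinity>"
    by (simp add: ennreal_mult_less_top of_nat_less_top)
  finally show ?thesis .
qed


section \<open>Large deviation bounds\<close>

lemma exp_bounded_eventuallyI:
  assumes "\<And>\<epsilon>. \<epsilon> > 0 \<Longrightarrow> \<forall>\<^sub>F m in sequentially. \<bar>f m\<bar> \<le> exp ((\<mu> + \<epsilon>) * real m)"
  shows "exp_bounded f \<mu>"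
  unfolding exp_bounded_def
proof (intro allI impI)
  fix \<epsilon> :: real assume "\<epsilon> > 0"
  then obtain N where N: "\<And>m. m \<ge> N \<Longrightarrow> \<bar>f m\<bar> \<le> exp ((\<mu> + \<epsilon>) * real m)"
    using assms unfolding eventually_sequentially by blast
  define C where "C = 1 + (\<Sum>m<N. \<bar>f m\<bar> / exp ((\<mu> + \<epsilon>) * real m))"
  have "\<bar>f m\<bar> \<le> C * exp ((\<mu> + \<epsilon>) * real m)" for m
  proof (cases "m < N")
    case True
    then have "\<bar>f m\<bar> / exp ((\<mu> + \<epsilon>) * real m) \<le> (\<Sum>m<N. \<bar>f m\<bar> / exp ((\<mu> + \<epsilon>) * real m))"
      by (intro member_le_sum) auto
    then have "\<bar>f m\<bar> / exp ((\<mu> + \<epsilon>) * real m) \<le> C" by (simp add: C_def)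
    then show ?thesis by (simp add: divide_le_eq)
  next
    case False
    then have "\<bar>f m\<bar> \<le> 1 * exp ((\<mu> + \<epsilon>) * real m)" using N by simp
    also have "\<dots> \<le> C * exp ((\<mu> + \<epsilon>) * real m)"
      unfolding C_def by (intro mult_right_mono) (auto intro: sum_nonneg)
    finally show ?thesis .
  qed
  then show "\<exists>C. \<forall>m. \<bar>f m\<bar> \<le> C * exp ((\<mu> + \<epsilon>) * real m)" by blast
qed

text \<open>Markov's inequality bounds the probability that \<open>f m\<close> exceeds
  \<open>exp ((a + \<epsilon>) * real m)\<close> by \<open>K * exp (- \<epsilon>) ^ m\<close>. This
  is summable, and Borel-Cantelli applies.\<close>

lemma (in prob_space) AE_exp_bounded:
  fixes f :: "nat \<Rightarrow> 'a \<Rightarrow> real"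
  assumes [measurable]: "\<And>m. f m \<in> borel_measurable M" and nonneg: "\<And>m \<omega>. f m \<omega> \<ge> 0"
    and K: "K \<ge> 0" and bd: "\<forall>\<^sub>F m in sequentially. (\<integral>\<^sup>+\<omega>. ennreal (f m \<omega>) \<partial>M) \<le> ennreal (K * exp (a * real m))"
  shows "AE \<omega> in M. exp_bounded (\<lambda>m. f m \<omega>) a"
proof -
  have ae: "AE \<omega> in M. \<forall>\<^sub>F m in sequentially. f m \<omega> < exp ((a + \<epsilon>) * real m)" if e: "\<epsilon> > 0" for \<epsilon>
  proof -
    define A where "A m = {\<omega>\<in>space M. f m \<omega> \<ge> exp ((a + \<epsilon>) * real m)}" for m
    have [measurable]: "A m \<in> sets M" for m unfolding A_def by measurable
    obtain N where N: "\<And>m. m \<ge> N \<Longrightarrow> (\<integral>\<^sup>+\<omega>. ennreal (f m \<omega>) \<partial>M) \<le> ennreal (K * exp (a * real m))"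
      using bd unfolding eventually_sequentially by blast
    have mA: "measure M (A m) \<le> K * exp (- \<epsilon>) ^ m" if m: "m \<ge> N" for m
    proof -
      have eq: "A m = {\<omega>\<in>space M. 1 \<le> ennreal (exp (- (a + \<epsilon>) * real m)) * ennreal (f m \<omega>)}"
      proof -
        have h: "exp (- (a + \<epsilon>) * real m) = 1 / exp ((a + \<epsilon>) * real m)"
          by (simp only: mult_minus_left exp_minus inverse_eq_divide)
        have iff: "1 \<le> ennreal (exp (- (a + \<epsilon>) * real m)) * ennreal (f m \<omega>) \<longleftrightarrow> exp ((a + \<epsilon>) * real m) \<le> f m \<omega>" for \<omega>
          unfolding h using nonneg[of m \<omega>] by (subst ennreal_mult'[symmetric]) (auto simp: le_divide_eq)
        show ?thesis unfolding A_def by (simp only: iff)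
      qed
      have "emeasure M (A m) \<le> ennreal (exp (- (a + \<epsilon>) * real m)) * (\<integral>\<^sup>+\<omega>. ennreal (f m \<omega>) * indicator (space M) \<omega> \<partial>M)"
        unfolding eq by (rule nn_integral_Markov_inequality) measurable
      also have "(\<integral>\<^sup>+\<omega>. ennreal (f m \<omega>) * indicator (space M) \<omega> \<partial>M) = (\<integral>\<^sup>+\<omega>. ennreal (f m \<omega>) \<partial>M)"
        by (intro nn_integral_cong) auto
      also have "ennreal (exp (- (a + \<epsilon>) * real m)) * \<dots> \<le> ennreal (exp (- (a + \<epsilon>) * real m)) * ennreal (K * exp (a * real m))"
        by (intro mult_left_mono N m) simp
      also have "\<dots> = ennreal (K * (exp (- (a + \<epsilon>) * real m) * exp (a * real m)))"
        using K by (simp add: ennreal_mult'[symmetric] mult_ac)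
      also have "exp (- (a + \<epsilon>) * real m) * exp (a * real m) = exp (- \<epsilon>) ^ m"
        by (simp add: exp_add[symmetric] exp_of_nat_mult[symmetric] algebra_simps)
      finally show ?thesis using K by (simp add: emeasure_eq_measure)
    qed
    have "summable (\<lambda>m. measure M (A m))"
    proof (rule summable_comparison_test'[where N=N])
      show "summable (\<lambda>m. K * exp (- \<epsilon>) ^ m)" using e by (intro summable_mult summable_geometric) simp
    qed (use mA in simp)
    then have "AE \<omega> in M. \<forall>\<^sub>F m in sequentially. \<omega> \<in> space M - A m"
      by (intro borel_cantelli_AE1) (auto simp: emeasure_eq_measure)
    then show ?thesis
      by eventually_elim (elim eventually_mono, auto simp: A_def)
  qed
  \<comment> \<open>Countably many \<epsilon> suffice, so the exceptional set stays null.\<close>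
  have "AE \<omega> in M. \<forall>n::nat. \<forall>\<^sub>F m in sequentially. f m \<omega> < exp ((a + 1 / real (Suc n)) * real m)"
    unfolding AE_all_countable by (intro allI ae) simp
  then show ?thesis
  proof eventually_elim
    case (elim \<omega>)
    show ?case
    proof (rule exp_bounded_eventuallyI)
      fix \<epsilon> :: real assume "\<epsilon> > 0"
      then obtain n where n: "1 / real (Suc n) < \<epsilon>" using nat_approx_posE by blast
      show "\<forall>\<^sub>F m in sequentially. \<bar>f m \<omega>\<bar> \<le> exp ((a + \<epsilon>) * real m)"
        using elim[rule_format, of n]
      proof eventually_elim
        case (elim m)
        have "(a + 1 / real (Suc n)) * real m \<le> (a + \<epsilon>) * real m"
          using n by (intro mult_right_mono) auto
        then show ?case using elim nonneg[of m \<omega>] by (smt (verit) exp_le_cancel_iff)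
      qed
    qed
  qed
qed

text \<open>The quotients \<open>(exp (s * G x) - 1) / s\<close> converge to \<open>G x\<close> as
  \<open>s\<close> tends to 0, and by domination so do their means. For small \<open>s\<close> the
  generating function is thus at most \<open>1 + s * (expectation G + \<epsilon>)\<close>, which is
  below the exponential.\<close>

lemma (in prob_space) mgf_first_order:
  fixes G :: "'a \<Rightarrow> real"
  assumes [measurable]: "G \<in> borel_measurable M" and s0: "s0 > 0"
    and fin: "(\<integral>\<^sup>+x. ennreal (exp (s0 * \<bar>G x\<bar>)) \<partial>M) < \<infinity>"
  shows "integrable M G"
    "\<And>\<epsilon>. \<epsilon> > 0 \<Longrightarrow> \<exists>s>0. (\<integral>\<^sup>+x. ennreal (exp (s * G x)) \<partial>M) \<le> ennreal (exp (s * (expectation G + \<epsilon>)))"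
proof -
  have iE: "integrable M (\<lambda>x. exp (s0 * \<bar>G x\<bar>))"
    using fin by (simp add: integrable_iff_bounded)
  have t_le: "t \<le> exp t" for t :: real using exp_ge_add_one_self[of t] by linarith
  have G_le: "\<bar>g\<bar> \<le> (2 / s0) * exp (s0 / 2 * \<bar>g\<bar>)" for g
    using t_le[of "s0 / 2 * \<bar>g\<bar>"] s0 by (simp add: field_simps)
  have le1: "exp (s0 / 2 * \<bar>g\<bar>) * exp (s0 / 2 * \<bar>g\<bar>) = exp (s0 * \<bar>g\<bar>)" for g
    by (simp add: exp_add[symmetric])
  have G_le2: "\<bar>g\<bar> \<le> (2 / s0) * exp (s0 * \<bar>g\<bar>)" for g
  proof -
    have "(2 / s0) * exp (s0 / 2 * \<bar>g\<bar>) \<le> (2 / s0) * exp (s0 * \<bar>g\<bar>)"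
      using s0 by (intro mult_left_mono) auto
    then show ?thesis using G_le[of g] by linarith
  qed
  show "integrable M G"
    by (rule Bochner_Integration.integrable_bound[OF integrable_mult_right[OF iE, of "2 / s0"]])
      (use G_le2 s0 in auto)
  fix \<epsilon> :: real assume e: "\<epsilon> > 0"
  \<comment> \<open>Keeping \<open>s n\<close> below \<open>s0 / 2\<close> saves half of the
    exponential moment, which then dominates the factor \<open>\<bar>G x\<bar>\<close>.\<close>
  define s where "s n = s0 / (2 * real (Suc n))" for n
  have s: "s n > 0" "s n \<le> s0 / 2" for n using s0 by (auto simp: s_def field_simps)
  have slim: "s \<longlonglongrightarrow> 0"
  proof -
    have "(\<lambda>n. s0 / 2 * inverse (real (Suc n))) \<longlonglongrightarrow> s0 / 2 * 0"
      by (intro tendsto_mult tendsto_const LIMSEQ_inverse_real_of_nat)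
    then show ?thesis by (simp add: s_def[abs_def] field_simps)
  qed
  define f where "f n x = (exp (s n * G x) - 1) / s n" for n x
  have [measurable]: "f n \<in> borel_measurable M" for n unfolding f_def by measurable
  have bound: "norm (f n x) \<le> (2 / s0) * exp (s0 * \<bar>G x\<bar>)" for n x
  proof -
    have eb: "\<bar>exp t - 1\<bar> \<le> \<bar>t\<bar> * exp \<bar>t\<bar>" for t :: real
    proof (cases "t \<ge> 0")
      case True
      have "exp t * (1 - t) \<le> exp t * exp (- t)"
        using exp_ge_add_one_self[of "- t"] by (intro mult_left_mono) auto
      then show ?thesis using True by (simp add: exp_minus algebra_simps)
    next
      case False
      have "1 - exp t \<le> - t" using exp_ge_add_one_self[of t] by linarith
      also have "\<dots> \<le> - t * exp (- t)" using False by (simp add: mult_le_cancel_left1)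
      finally show ?thesis using False by simp
    qed
    have "norm (f n x) \<le> (\<bar>s n * G x\<bar> * exp \<bar>s n * G x\<bar>) / s n"
      using eb[of "s n * G x"] s[of n] by (simp add: f_def abs_divide divide_right_mono)
    also have "\<dots> = \<bar>G x\<bar> * exp (s n * \<bar>G x\<bar>)" using s[of n] by (simp add: abs_mult)
    also have "\<dots> \<le> ((2 / s0) * exp (s0 / 2 * \<bar>G x\<bar>)) * exp (s0 / 2 * \<bar>G x\<bar>)"
    proof (rule mult_mono[OF G_le])
      show "exp (s n * \<bar>G x\<bar>) \<le> exp (s0 / 2 * \<bar>G x\<bar>)"
        unfolding exp_le_cancel_iff by (rule mult_right_mono[OF s(2)]) simp
    qed (use s0 in auto)
    also have "\<dots> = (2 / s0) * exp (s0 * \<bar>G x\<bar>)" by (simp only: mult.assoc le1)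
    finally show ?thesis .
  qed
  have lim: "(\<lambda>n. f n x) \<longlonglongrightarrow> G x" for x
  proof -
    have "((\<lambda>h. exp (h * G x)) has_real_derivative G x) (at 0)"
      by (auto intro!: derivative_eq_intros)
    then have "((\<lambda>h. (exp (h * G x) - 1) / h) \<longlongrightarrow> G x) (at 0)"
      by (simp add: DERIV_def)
    moreover have "filterlim s (at 0) sequentially"
    proof -
      have "s n \<noteq> 0" for n using s(1)[of n] by simp
      then show ?thesis by (simp add: filterlim_at slim)
    qed
    ultimately show ?thesis unfolding f_def by (rule filterlim_compose)
  qed
  have "(\<lambda>n. expectation (f n)) \<longlonglongrightarrow> expectation G"
    by (rule integral_dominated_convergence[where w="\<lambda>x. (2 / s0) * exp (s0 * \<bar>G x\<bar>)"])
      (use iE lim bound in auto)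
  then have "\<forall>\<^sub>F n in sequentially. expectation (f n) < expectation G + \<epsilon>"
    by (rule order_tendstoD) (use e in simp)
  then obtain n where n: "expectation (f n) < expectation G + \<epsilon>"
    unfolding eventually_sequentially by blast
  have iexp: "integrable M (\<lambda>x. exp (s n * G x))"
  proof (rule Bochner_Integration.integrable_bound[OF iE])
    have "s n * g \<le> s0 * \<bar>g\<bar>" for g
    proof -
      have "s n * g \<le> s n * \<bar>g\<bar>" using s(1)[of n] by (intro mult_left_mono) auto
      also have "\<dots> \<le> s0 * \<bar>g\<bar>" using s(2)[of n] s0 by (intro mult_right_mono) auto
      finally show ?thesis .
    qed
    then show "AE x in M. norm (exp (s n * G x)) \<le> norm (exp (s0 * \<bar>G x\<bar>))" by simp
  qed measurable
  have "expectation (\<lambda>x. exp (s n * G x)) = 1 + s n * expectation (f n)"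
  proof -
    have "exp (s n * G x) = 1 + s n * f n x" for x using s[of n] by (simp add: f_def)
    moreover have "integrable M (f n)" unfolding f_def using iexp by auto
    ultimately show ?thesis by (simp add: prob_space)
  qed
  also have "\<dots> \<le> 1 + s n * (expectation G + \<epsilon>)" using n s[of n] by simp
  also have "\<dots> \<le> exp (s n * (expectation G + \<epsilon>))" by (rule exp_ge_add_one_self)
  finally have "expectation (\<lambda>x. exp (s n * G x)) \<le> exp (s n * (expectation G + \<epsilon>))" .
  then have "(\<integral>\<^sup>+x. ennreal (exp (s n * G x)) \<partial>M) \<le> ennreal (exp (s n * (expectation G + \<epsilon>)))"
    by (subst nn_integral_eq_integral[OF iexp]) (auto intro: ennreal_leI)
  then show "\<exists>s>0. (\<integral>\<^sup>+x. ennreal (exp (s * G x)) \<partial>M) \<le> ennreal (exp (s * (expectation G + \<epsilon>)))"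
    using s[of n] by blast
qed

lemma exp_bounded_rescale:
  assumes "exp_bounded (\<lambda>m. exp (s * S m)) (s * \<mu>)" and s: "s > 0"
  shows "exp_bounded (\<lambda>m. exp (S m)) \<mu>"
  unfolding exp_bounded_def
proof (intro allI impI)
  fix \<epsilon> :: real assume "\<epsilon> > 0"
  then have "s * \<epsilon> > 0" using s by simp
  then obtain C where C: "C > 0" "\<And>m. \<bar>exp (s * S m)\<bar> \<le> C * exp ((s * \<mu> + s * \<epsilon>) * real m)"
    using exp_boundedE[OF assms(1)] by blast
  have "\<bar>exp (S m)\<bar> \<le> exp (ln C / s) * exp ((\<mu> + \<epsilon>) * real m)" for m
  proof -
    have "exp (s * S m) \<le> exp (ln C + (s * \<mu> + s * \<epsilon>) * real m)" using C by (simp add: exp_add)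
    then have "s * S m \<le> ln C + (s * \<mu> + s * \<epsilon>) * real m" by simp
    then have "S m \<le> ln C / s + (\<mu> + \<epsilon>) * real m" using s by (simp add: field_simps)
    then show ?thesis by (simp add: exp_add[symmetric])
  qed
  then show "\<exists>C. \<forall>m. \<bar>exp (S m)\<bar> \<le> C * exp ((\<mu> + \<epsilon>) * real m)" by blast
qed

text \<open>Chernoff's bound from generating functions alone: \<open>S m\<close> need not be given
  as a sum of independent terms, as long as its generating function is an \<open>m\<close>-th power.
  Applying it to \<open>G\<close> and to \<open>- G\<close> yields an exact rate.\<close>

lemma AE_exp_bounded_of_mgf:
  fixes G :: "'b \<Rightarrow> real" and S :: "nat \<Rightarrow> 'a \<Rightarrow> real"
  assumes N: "prob_space N" and M: "prob_space M"
    and G: "G \<in> borel_measurable N" and s0: "s0 > 0"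
    and fin: "(\<integral>\<^sup>+x. ennreal (exp (s0 * \<bar>G x\<bar>)) \<partial>N) < \<infinity>"
    and S: "\<And>m. S m \<in> borel_measurable M"
    and mgf: "\<And>s m. (\<integral>\<^sup>+\<omega>. ennreal (exp (s * S m \<omega>)) \<partial>M) = (\<integral>\<^sup>+x. ennreal (exp (s * G x)) \<partial>N) ^ m"
  shows "AE \<omega> in M. exp_bounded (\<lambda>m. exp (S m \<omega>)) (integral\<^sup>L N G)"
proof -
  interpret N: prob_space N by fact
  interpret M: prob_space M by fact
  note [measurable] = S
  let ?\<mu> = "integral\<^sup>L N G"
  have "AE \<omega> in M. exp_bounded (\<lambda>m. exp (S m \<omega>)) (?\<mu> + \<epsilon>)" if e: "\<epsilon> > 0" for \<epsilon>
  proof -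
    obtain s where s: "s > 0" "(\<integral>\<^sup>+x. ennreal (exp (s * G x)) \<partial>N) \<le> ennreal (exp (s * (?\<mu> + \<epsilon>)))"
      using N.mgf_first_order(2)[OF G s0 fin e] by blast
    have "AE \<omega> in M. exp_bounded (\<lambda>m. exp (s * S m \<omega>)) (s * (?\<mu> + \<epsilon>))"
    proof (rule M.AE_exp_bounded[where K=1])
      have "(\<integral>\<^sup>+\<omega>. ennreal (exp (s * S m \<omega>)) \<partial>M) \<le> ennreal (1 * exp (s * (?\<mu> + \<epsilon>) * real m))" for m
      proof -
        have "(\<integral>\<^sup>+\<omega>. ennreal (exp (s * S m \<omega>)) \<partial>M) \<le> ennreal (exp (s * (?\<mu> + \<epsilon>))) ^ m"
          unfolding mgf by (intro power_mono s) simp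
        then show ?thesis by (simp add: ennreal_power exp_of_nat_mult[symmetric] mult.commute)
      qed
      then show "\<forall>\<^sub>F m in sequentially. (\<integral>\<^sup>+\<omega>. ennreal (exp (s * S m \<omega>)) \<partial>M) \<le> ennreal (1 * exp (s * (?\<mu> + \<epsilon>) * real m))"
        by simp
    qed auto
    then show ?thesis by eventually_elim (rule exp_bounded_rescale[OF _ s(1)])
  qed
  then have "AE \<omega> in M. \<forall>n::nat. exp_bounded (\<lambda>m. exp (S m \<omega>)) (?\<mu> + 1 / real (Suc n))"
    unfolding AE_all_countable by (intro allI) simp
  then show ?thesis
  proof eventually_elim
    case (elim \<omega>)
    show ?case
      unfolding exp_bounded_def
    proof (intro allI impI)
      fix \<epsilon> :: real assume "\<epsilon> > 0"
      then obtain n where n: "1 / real (Suc n) < \<epsilon>" using nat_approx_posE by blast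
      then have "\<epsilon> - 1 / real (Suc n) > 0" by simp
      from exp_boundedE[OF elim[rule_format, of n] this]
      show "\<exists>C. \<forall>m. \<bar>exp (S m \<omega>)\<bar> \<le> C * exp ((?\<mu> + \<epsilon>) * real m)" by (metis add.assoc add_diff_cancel_left' diff_add_cancel add.commute)
    qed
  qed
qed


section \<open>Products of independent matrices\<close>

lemma borel_measurable_matrix_mult [measurable (raw)]:
  fixes f :: "'w \<Rightarrow> 'a::{euclidean_space, real_normed_div_algebra} ^ 'n ^ 'n"
  assumes "f \<in> borel_measurable M" "g \<in> borel_measurable M"
  shows "(\<lambda>\<omega>. f \<omega> ** g \<omega>) \<in> borel_measurable M"
  by (rule borel_measurable_continuous_Pair[OF assms])
    (unfold matrix_matrix_mult_def, intro continuous_intros)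

lemma borel_measurable_matrix_prod:
  fixes Y :: "nat \<Rightarrow> 'w \<Rightarrow> 'a::{euclidean_space, real_normed_div_algebra} ^ 'n ^ 'n"
  assumes "\<And>i. i \<in> {1..m} \<Longrightarrow> Y i \<in> borel_measurable M"
  shows "(\<lambda>\<omega>. matrix_prod (\<lambda>i. Y i \<omega>) m) \<in> borel_measurable M"
  using assms by (induction m) (auto intro!: borel_measurable_matrix_mult)

lemma matrix_prod_cong:
  assumes "\<And>i. i \<in> {1..m} \<Longrightarrow> A i = B i"
  shows "matrix_prod A m = matrix_prod B m"
  using assms by (induction m) auto

lemma (in prob_space) indep_var_matrix_prod:
  fixes Y :: "nat \<Rightarrow> 'a \<Rightarrow> 'k::{euclidean_space, real_normed_div_algebra} ^ 'n ^ 'n"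
  assumes "indep_vars (\<lambda>_. borel) Y {1..}"
  shows "indep_var borel (\<lambda>\<omega>. matrix_prod (\<lambda>i. Y i \<omega>) m) borel (Y (Suc m))"
proof -
  have "indep_var borel ((\<lambda>f. matrix_prod f m) \<circ> (\<lambda>\<omega>. restrict (\<lambda>i. Y i \<omega>) {1..m}))
      borel ((\<lambda>f. f (Suc m)) \<circ> (\<lambda>\<omega>. restrict (\<lambda>i. Y i \<omega>) {Suc m}))"
  proof (rule indep_var_compose[OF indep_var_restrict[OF assms]])
    show "(\<lambda>f. matrix_prod f m) \<in> borel_measurable (Pi\<^sub>M {1..m} (\<lambda>_. borel :: ('k ^ 'n ^ 'n) measure))"
      by (rule borel_measurable_matrix_prod[of m "\<lambda>i f. f i"]) measurable
  qed auto
  also have "(\<lambda>f. matrix_prod f m) \<circ> (\<lambda>\<omega>. restrict (\<lambda>i. Y i \<omega>) {1..m}) = (\<lambda>\<omega>. matrix_prod (\<lambda>i. Y i \<omega>) m)"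
    by (auto simp: fun_eq_iff intro!: matrix_prod_cong)
  also have "(\<lambda>f. f (Suc m)) \<circ> (\<lambda>\<omega>. restrict (\<lambda>i. Y i \<omega>) {Suc m}) = Y (Suc m)"
    by auto
  finally show ?thesis .
qed

text \<open>Here \<open>c\<close> is the factor in front of \<open>X\<close>, that is, the
  reciprocal of the constant \<open>c\<close> of the final theorem. Nothing is assumed about
  \<open>Y 0\<close>, not even measurability.\<close>

locale gaussian_product = prob_space M for M :: "'w measure" +
  fixes \<sigma> c :: real and Y :: "nat \<Rightarrow> 'w \<Rightarrow> 'a::{euclidean_space, real_normed_div_algebra} ^ 'n ^ 'n"
  assumes \<sigma>: "\<sigma> > 0" and c: "c > 0"
    and indep: "indep_vars (\<lambda>_. borel) Y {1..}"
    and law: "\<And>i. i \<ge> 1 \<Longrightarrow> distr M borel (Y i) = distr (gauss \<sigma>) borel (\<lambda>X. mat 1 + c *\<^sub>R X)"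
begin

abbreviation \<nu> :: "('a ^ 'n ^ 'n) measure" where
  "\<nu> \<equiv> distr (gauss \<sigma>) borel (\<lambda>X. mat 1 + c *\<^sub>R X)"

abbreviation P :: "nat \<Rightarrow> 'w \<Rightarrow> 'a ^ 'n ^ 'n" where
  "P m \<omega> \<equiv> matrix_prod (\<lambda>i. Y i \<omega>) m"

lemma Y_measurable: "i \<ge> 1 \<Longrightarrow> Y i \<in> borel_measurable M"
  using indep by (auto simp: indep_vars_def)

lemma P_measurable [measurable]: "P m \<in> borel_measurable M"
  by (rule borel_measurable_matrix_prod) (auto intro: Y_measurable)

lemma prob_space_\<nu>: "prob_space \<nu>"
  by (rule prob_space.prob_space_distr[OF prob_space_gauss[OF \<sigma>]]) measurable

lemma nn_integral_\<nu>:
  assumes [measurable]: "f \<in> borel_measurable borel"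
  shows "(\<integral>\<^sup>+A. f A \<partial>\<nu>) = (\<integral>\<^sup>+X. f (mat 1 + c *\<^sub>R X) \<partial>gauss \<sigma>)"
  by (rule nn_integral_distr) measurable

lemma nn_integral_\<nu>_norm: "(\<integral>\<^sup>+A. ennreal (norm A) \<partial>\<nu>) < \<infinity>"
proof -
  interpret G: prob_space "gauss \<sigma> :: ('a ^ 'n ^ 'n) measure" by (rule prob_space_gauss[OF \<sigma>])
  have "(\<integral>\<^sup>+A. ennreal (norm A) \<partial>\<nu>) = (\<integral>\<^sup>+X. ennreal (norm (mat 1 + c *\<^sub>R X :: 'a ^ 'n ^ 'n)) \<partial>gauss \<sigma>)"
    by (rule nn_integral_\<nu>) measurable
  also have "\<dots> \<le> (\<integral>\<^sup>+X. ennreal (norm (mat 1 :: 'a ^ 'n ^ 'n)) + ennreal c * ennreal (norm X) \<partial>(gauss \<sigma> :: ('a ^ 'n ^ 'n) measure))"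
  proof (intro nn_integral_mono)
    fix X :: "'a ^ 'n ^ 'n"
    have "norm (mat 1 + c *\<^sub>R X) \<le> norm (mat 1 :: 'a ^ 'n ^ 'n) + c * norm X"
      using norm_triangle_ineq[of "mat 1" "c *\<^sub>R X"] c by simp
    then show "ennreal (norm (mat 1 + c *\<^sub>R X)) \<le> ennreal (norm (mat 1 :: 'a ^ 'n ^ 'n)) + ennreal c * ennreal (norm X)"
      using c by (simp add: ennreal_mult'[symmetric] ennreal_plus[symmetric] ennreal_leI del: ennreal_plus)
  qed
  also have "\<dots> = ennreal (norm (mat 1 :: 'a ^ 'n ^ 'n)) + ennreal c * (\<integral>\<^sup>+X. ennreal (norm X) \<partial>(gauss \<sigma> :: ('a ^ 'n ^ 'n) measure))"
    using G.emeasure_space_1 by (subst nn_integral_add) (auto simp: nn_integral_cmult)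
  also have "\<dots> < \<infinity>"
    using nn_integral_gauss_norm_finite[OF \<sigma>, where 'b="'a ^ 'n ^ 'n"] by (simp add: ennreal_mult_less_top)
  finally show ?thesis .
qed

lemma nn_integral_\<nu>_pivot_mult:
  assumes r: "inj r" and inj: "\<And>x. B *v x = 0 \<Longrightarrow> x = 0" and [measurable]: "H \<in> borel_measurable borel"
  shows "(\<integral>\<^sup>+A. H (pivot r k (A ** B)) \<partial>\<nu>) = (\<integral>\<^sup>+A. H (pivot r k B * pivot r k A) \<partial>\<nu>)"
proof -
  have "(\<integral>\<^sup>+A. H (pivot r k (A ** B)) \<partial>\<nu>) = (\<integral>\<^sup>+X. H (pivot r k ((mat 1 + c *\<^sub>R X) ** B)) \<partial>gauss \<sigma>)"
    by (rule nn_integral_\<nu>) measurable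
  also have "\<dots> = (\<integral>\<^sup>+X. H (pivot r k B * pivot r k (mat 1 + c *\<^sub>R X)) \<partial>(gauss \<sigma> :: ('a ^ 'n ^ 'n) measure))"
    by (rule nn_integral_pivot_mult[OF r inj]) measurable
  also have "\<dots> = (\<integral>\<^sup>+A. H (pivot r k B * pivot r k A) \<partial>\<nu>)"
    by (rule nn_integral_\<nu>[symmetric]) measurable
  finally show ?thesis .
qed

lemma nn_integral_\<nu>_inverse_sqrt_pivot:
  assumes r: "inj r"
  shows "(\<integral>\<^sup>+A. inverse (ennreal (sqrt (pivot r k A))) \<partial>\<nu>) < \<infinity>"
proof -
  have "(\<integral>\<^sup>+A. inverse (ennreal (sqrt (pivot r k A))) \<partial>\<nu>) =
      (\<integral>\<^sup>+X. inverse (ennreal (sqrt (pivot r k (mat 1 + c *\<^sub>R X)))) \<partial>(gauss \<sigma> :: ('a ^ 'n ^ 'n) measure))"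
    by (rule nn_integral_\<nu>) measurable
  then show ?thesis using nn_integral_pivot_inverse_sqrt_finite[OF r \<sigma> c] by simp
qed

text \<open>A finite integral of the inverse square root, infinite where the pivot is 0, makes zero
  pivots a null event.\<close>

lemma AE_\<nu>_pivot_pos:
  assumes r: "inj r"
  shows "AE A in \<nu>. \<forall>k. pivot r k A > 0"
proof -
  have "AE A in \<nu>. pivot r k A > 0" for k
  proof -
    have "AE A in \<nu>. inverse (ennreal (sqrt (pivot r k A))) \<noteq> \<infinity>"
      by (rule nn_integral_PInf_AE) (use nn_integral_\<nu>_inverse_sqrt_pivot[OF r, of k] in auto)
    then show ?thesis
    proof eventually_elim
      case (elim A)
      then have "pivot r k A \<noteq> 0" by auto
      then show ?case using pivot_nonneg[of r k A] by simp
    qed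
  qed
  then show ?thesis by (simp add: AE_all_countable)
qed

text \<open>Positive pivots make each factor injective, products stay injective, and injectivity
  gives back positive pivots through \<open>pivot_mult_eq\<close>.\<close>

lemma AE_P_pivot_pos:
  assumes r: "inj r"
  shows "AE \<omega> in M. \<forall>m k. pivot r k (P m \<omega>) > 0"
proof -
  have "AE \<omega> in M. \<forall>k. pivot r k (Y i \<omega>) > 0" if "i \<ge> 1" for i
  proof (rule AE_distrD[OF Y_measurable[OF that]])
    show "AE A in distr M borel (Y i). \<forall>k. pivot r k A > 0"
      unfolding law[OF that] by (rule AE_\<nu>_pivot_pos[OF r])
  qed
  then have "AE \<omega> in M. \<forall>i\<in>{1..}. \<forall>k. pivot r k (Y i \<omega>) > 0"
    by (subst AE_ball_countable) auto
  then show ?thesis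
  proof eventually_elim
    case (elim \<omega>)
    have "\<forall>x. P m \<omega> *v x = 0 \<longrightarrow> x = 0" for m
    proof (induction m)
      case (Suc m)
      then show ?case
        using pivot_pos_imp_inj[of r "Y (Suc m) \<omega>"] elim by (auto simp: matrix_vector_mul_assoc[symmetric])
    qed simp
    then show ?case using pivot_mult_eq[OF r] by metis
  qed
qed

text \<open>Given \<open>P m = B\<close>, the pivot of the next product is distributed like
  \<open>pivot r k B * pivot r k A\<close> with a fresh factor \<open>A\<close>. By Fubini each step
  multiplies the generating function by the same constant, possibly infinite.\<close>

lemma mgf_ln_pivot:
  assumes r: "inj r"
  shows "(\<integral>\<^sup>+\<omega>. ennreal (exp (s * ln (pivot r k (P m \<omega>)))) \<partial>M) =
    (\<integral>\<^sup>+A. ennreal (exp (s * ln (pivot r k A))) \<partial>\<nu>) ^ m"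
proof (induction m)
  case 0
  show ?case by (simp add: pivot_mat_1 emeasure_space_1)
next
  case (Suc m)
  interpret N: prob_space \<nu> by (rule prob_space_\<nu>)
  let ?h = "\<lambda>x. ennreal (exp (s * ln x))"
  let ?\<phi> = "\<integral>\<^sup>+A. ?h (pivot r k A) \<partial>\<nu>"
  have Ym: "Y (Suc m) \<in> borel_measurable M" by (rule Y_measurable) simp
  have "distr M borel (P m) \<Otimes>\<^sub>M distr M borel (Y (Suc m)) = distr M (borel \<Otimes>\<^sub>M borel) (\<lambda>\<omega>. (P m \<omega>, Y (Suc m) \<omega>))"
    using indep_var_matrix_prod[OF indep, of m] unfolding indep_var_distribution_eq by blast
  then have joint: "distr M (borel \<Otimes>\<^sub>M borel) (\<lambda>\<omega>. (P m \<omega>, Y (Suc m) \<omega>)) = distr M borel (P m) \<Otimes>\<^sub>M \<nu>"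
    by (simp add: law)
  have "(\<integral>\<^sup>+\<omega>. ?h (pivot r k (P (Suc m) \<omega>)) \<partial>M) =
      (\<integral>\<^sup>+z. ?h (pivot r k (snd z ** fst z)) \<partial>distr M (borel \<Otimes>\<^sub>M borel) (\<lambda>\<omega>. (P m \<omega>, Y (Suc m) \<omega>)))"
    using Ym by (subst nn_integral_distr) auto
  also have "\<dots> = (\<integral>\<^sup>+B. \<integral>\<^sup>+A. ?h (pivot r k (A ** B)) \<partial>\<nu> \<partial>distr M borel (P m))"
    unfolding joint by (subst N.nn_integral_fst[symmetric]) auto
  also have "\<dots> = (\<integral>\<^sup>+B. ?h (pivot r k B) * ?\<phi> \<partial>distr M borel (P m))"
  proof (rule nn_integral_cong_AE)
    \<comment> \<open>Splitting \<open>ln\<close> of a product requires positive pivots, which hold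
      almost everywhere only.\<close>
    have "AE B in distr M borel (P m). \<forall>k. pivot r k B > 0"
      by (subst AE_distr_iff) (use AE_P_pivot_pos[OF r] in auto)
    then show "AE B in distr M borel (P m). (\<integral>\<^sup>+A. ?h (pivot r k (A ** B)) \<partial>\<nu>) = ?h (pivot r k B) * ?\<phi>"
    proof eventually_elim
      case (elim B)
      then have inj: "\<And>x. B *v x = 0 \<Longrightarrow> x = 0" using pivot_pos_imp_inj[of r B] by blast
      have "(\<integral>\<^sup>+A. ?h (pivot r k (A ** B)) \<partial>\<nu>) = (\<integral>\<^sup>+A. ?h (pivot r k B * pivot r k A) \<partial>\<nu>)"
        by (rule nn_integral_\<nu>_pivot_mult[OF r inj]) measurable
      also have "\<dots> = (\<integral>\<^sup>+A. ?h (pivot r k B) * ?h (pivot r k A) \<partial>\<nu>)"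
      proof (rule nn_integral_cong_AE)
        show "AE A in \<nu>. ?h (pivot r k B * pivot r k A) = ?h (pivot r k B) * ?h (pivot r k A)"
          using AE_\<nu>_pivot_pos[OF r]
        proof eventually_elim
          case (elim A)
          then have "pivot r k A > 0" "pivot r k B > 0" using \<open>\<forall>k. pivot r k B > 0\<close> by blast+
          then show ?case
            by (simp add: ln_mult distrib_left exp_add ennreal_mult'[symmetric])
        qed
      qed
      also have "\<dots> = ?h (pivot r k B) * ?\<phi>" by (rule nn_integral_cmult) measurable
      finally show ?case .
    qed
  qed
  also have "\<dots> = (\<integral>\<^sup>+B. ?h (pivot r k B) \<partial>distr M borel (P m)) * ?\<phi>" by (rule nn_integral_multc) measurable
  also have "(\<integral>\<^sup>+B. ?h (pivot r k B) \<partial>distr M borel (P m)) = (\<integral>\<^sup>+\<omega>. ?h (pivot r k (P m \<omega>)) \<partial>M)"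
    by (subst nn_integral_distr) auto
  finally show ?case using Suc.IH by (simp add: mult.commute)
qed

text \<open>With \<open>p\<close> the pivot, the integrand is the square root of \<open>p\<close>
  for \<open>p \<ge> 1\<close>, at most \<open>norm A\<close>, and the inverse square root of
  \<open>p\<close> for 0 < p < 1.\<close>

lemma exp_ln_pivot_finite:
  assumes r: "inj r"
  shows "(\<integral>\<^sup>+A. ennreal (exp (1 / 2 * \<bar>ln (pivot r k A)\<bar>)) \<partial>\<nu>) < \<infinity>"
proof -
  interpret N: prob_space \<nu> by (rule prob_space_\<nu>)
  have "(\<integral>\<^sup>+A. ennreal (exp (1 / 2 * \<bar>ln (pivot r k A)\<bar>)) \<partial>\<nu>) \<le>
      (\<integral>\<^sup>+A. (1 + ennreal (norm A)) + inverse (ennreal (sqrt (pivot r k A))) \<partial>\<nu>)"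
  proof (intro nn_integral_mono)
    fix A :: "'a ^ 'n ^ 'n"
    let ?p = "pivot r k A"
    have le: "?p \<le> norm A"
      using pivot_le_lead[OF axis_in_lead, of r k A] norm_matrix_vector_mult_le[of A "axis k 1"] by (simp add: norm_axis)
    consider "?p = 0" | "0 < ?p" "?p < 1" | "1 \<le> ?p" using pivot_nonneg[of r k A] by linarith
    then show "ennreal (exp (1 / 2 * \<bar>ln ?p\<bar>)) \<le> (1 + ennreal (norm A)) + inverse (ennreal (sqrt ?p))"
    proof cases
      case 1
      then show ?thesis by simp
    next
      case 2
      have "exp (1 / 2 * \<bar>ln ?p\<bar>) = exp (- ln (sqrt ?p))" using 2 by (simp add: ln_sqrt)
      also have "\<dots> = inverse (sqrt ?p)" using 2 by (simp add: exp_minus)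
      finally have "ennreal (exp (1 / 2 * \<bar>ln ?p\<bar>)) = inverse (ennreal (sqrt ?p))"
        using 2 by (simp add: inverse_ennreal)
      then show ?thesis by simp
    next
      case 3
      have "exp (1 / 2 * \<bar>ln ?p\<bar>) = exp (ln (sqrt ?p))" using 3 by (simp add: ln_sqrt)
      also have "\<dots> = sqrt ?p" using 3 by simp
      also have "\<dots> \<le> ?p" using 3 by (simp add: real_sqrt_le_iff' real_le_lsqrt sqrt_le_D self_le_power)
      also have "\<dots> \<le> 1 + norm A" using le by simp
      finally have "ennreal (exp (1 / 2 * \<bar>ln ?p\<bar>)) \<le> ennreal (1 + norm A)" by (rule ennreal_leI)
      also have "\<dots> = 1 + ennreal (norm A)" by (simp add: ennreal_plus)
      finally show ?thesis by (simp add: add_increasing2)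
    qed
  qed
  also have "\<dots> = (1 + (\<integral>\<^sup>+A. ennreal (norm A) \<partial>\<nu>)) + (\<integral>\<^sup>+A. inverse (ennreal (sqrt (pivot r k A))) \<partial>\<nu>)"
    using N.emeasure_space_1 by (simp add: nn_integral_add)
  also have "\<dots> < \<infinity>" using nn_integral_\<nu>_norm nn_integral_\<nu>_inverse_sqrt_pivot[OF r] by simp
  finally show ?thesis .
qed

section \<open>Exponents of the Gaussian product\<close>

definition \<mu> :: "('n \<Rightarrow> nat) \<Rightarrow> 'n \<Rightarrow> real" where
  "\<mu> r k = integral\<^sup>L \<nu> (\<lambda>A. ln (pivot r k A))"

lemma AE_triangular_exponents:
  assumes r: "inj r"
  shows "AE \<omega> in M. triangular_exponents r (\<lambda>m. P m \<omega>) (\<mu> r) (\<lambda>m. norm (Y m \<omega>))"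
proof -
  have M: "prob_space M" by (rule prob_space_axioms)
  have up: "AE \<omega> in M. exp_bounded (\<lambda>m. exp (ln (pivot r k (P m \<omega>)))) (\<mu> r k)" for k
    unfolding \<mu>_def
    by (rule AE_exp_bounded_of_mgf[OF prob_space_\<nu> M _ _ exp_ln_pivot_finite[OF r] _ mgf_ln_pivot[OF r]]) auto
  have lo: "AE \<omega> in M. exp_bounded (\<lambda>m. exp (- ln (pivot r k (P m \<omega>)))) (- \<mu> r k)" for k
  proof -
    have "AE \<omega> in M. exp_bounded (\<lambda>m. exp (- ln (pivot r k (P m \<omega>)))) (integral\<^sup>L \<nu> (\<lambda>A. - ln (pivot r k A)))"
    proof (rule AE_exp_bounded_of_mgf[OF prob_space_\<nu> M])
      show "(\<integral>\<^sup>+A. ennreal (exp (1 / 2 * \<bar>- ln (pivot r k A)\<bar>)) \<partial>\<nu>) < \<infinity>"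
        using exp_ln_pivot_finite[OF r, of k] by simp
      show "(\<integral>\<^sup>+\<omega>. ennreal (exp (s * - ln (pivot r k (P m \<omega>)))) \<partial>M) =
          (\<integral>\<^sup>+A. ennreal (exp (s * - ln (pivot r k A))) \<partial>\<nu>) ^ m" for s m
        using mgf_ln_pivot[OF r, of "- s" k m] by simp
    qed auto
    then show ?thesis by (simp add: \<mu>_def)
  qed
  \<comment> \<open>The index is shifted because the law of \<open>Y i\<close> is prescribed from
    \<open>i = 1\<close> on. A common first moment is enough for subexponential growth.\<close>
  have nY: "AE \<omega> in M. exp_bounded (\<lambda>m. norm (Y (m + 1) \<omega>)) 0"
  proof (rule AE_exp_bounded)
    define K where "K = enn2real (\<integral>\<^sup>+A. ennreal (norm A) \<partial>\<nu>)"
    show "0 \<le> K" by (simp add: K_def)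
    show "\<forall>\<^sub>F m in sequentially. (\<integral>\<^sup>+\<omega>. ennreal (norm (Y (m + 1) \<omega>)) \<partial>M) \<le> ennreal (K * exp (0 * real m))"
    proof (intro always_eventually allI)
      fix m
      have Ym: "Y (m + 1) \<in> borel_measurable M" by (rule Y_measurable) simp
      have "(\<integral>\<^sup>+\<omega>. ennreal (norm (Y (m + 1) \<omega>)) \<partial>M) = (\<integral>\<^sup>+A. ennreal (norm A) \<partial>distr M borel (Y (m + 1)))"
        using Ym by (subst nn_integral_distr) auto
      also have "\<dots> = (\<integral>\<^sup>+A. ennreal (norm A) \<partial>\<nu>)" by (subst law) auto
      also have "\<dots> = ennreal K" using nn_integral_\<nu>_norm by (simp add: K_def)
      finally show "(\<integral>\<^sup>+\<omega>. ennreal (norm (Y (m + 1) \<omega>)) \<partial>M) \<le> ennreal (K * exp (0 * real m))" by simp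
    qed
    fix m
    have [measurable]: "Y (m + 1) \<in> borel_measurable M" by (rule Y_measurable) simp
    show "(\<lambda>\<omega>. norm (Y (m + 1) \<omega>)) \<in> borel_measurable M" by measurable
  qed simp
  from up lo have "AE \<omega> in M. \<forall>k. exp_bounded (\<lambda>m. exp (ln (pivot r k (P m \<omega>)))) (\<mu> r k)"
    "AE \<omega> in M. \<forall>k. exp_bounded (\<lambda>m. exp (- ln (pivot r k (P m \<omega>)))) (- \<mu> r k)"
    by (simp_all add: AE_all_countable)
  with nY AE_P_pivot_pos[OF r] show ?thesis
  proof eventually_elim
    case (elim \<omega>)
    show ?case
    proof
      show "inj r" by fact
      show pos: "pivot r k (P m \<omega>) > 0" for k m using elim by blast
      show "exp_bounded (\<lambda>m. pivot r k (P m \<omega>)) (\<mu> r k)" for k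
        using elim(3)[rule_format, of k] pos by simp
      show "exp_bounded (\<lambda>m. 1 / pivot r k (P m \<omega>)) (- \<mu> r k)" for k
        using elim(4)[rule_format, of k] pos by (simp add: exp_minus inverse_eq_divide)
      show "norm (P (Suc m) \<omega> *v x) \<le> norm (Y (Suc m) \<omega>) * norm (P m \<omega> *v x)" for m x
        by (simp add: matrix_vector_mul_assoc[symmetric] norm_matrix_vector_mult_le)
      \<comment> \<open>Undoing the shift: \<open>m - 1 + 1\<close> equals \<open>m\<close> except
        at \<open>m = 0\<close>, which the constant \<open>norm (Y 0 \<omega>)\<close>
        covers.\<close>
      have "exp_bounded (\<lambda>m. norm (Y (m - 1 + 1) \<omega>) + norm (Y 0 \<omega>)) 0"
        using exp_bounded_pred[OF elim(1)] by (intro exp_bounded_add exp_bounded_const) auto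
      then show "exp_bounded (\<lambda>m. norm (Y m \<omega>)) 0"
        by (rule exp_bounded_le) (case_tac m, auto)
    qed
  qed
qed

lemma integrable_ln_pivot: "inj r \<Longrightarrow> integrable \<nu> (\<lambda>A. ln (pivot r k A))"
  using prob_space.mgf_first_order(1)[OF prob_space_\<nu> _ _ exp_ln_pivot_finite[of r k]] by auto

lemma pivot_first:
  fixes A :: "'a ^ 'n ^ 'n"
  assumes "\<forall>j. j \<noteq> k \<longrightarrow> r k < r j"
  shows "pivot r k A = norm (A *v axis k 1)"
proof -
  have "lead r k = {axis k 1 :: 'a ^ 'n}" using assms by (auto simp: lead_def axis_def vec_eq_iff)
  then show ?thesis by (simp add: pivot_def)
qed

lemma ranking_exists:
  obtains r :: "'n \<Rightarrow> nat" where "inj r" "\<forall>j. j \<noteq> k \<longrightarrow> r k < r j"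
proof -
  obtain f :: "'n \<Rightarrow> nat" where f: "inj f" using finite_imp_inj_to_nat_seg[of "UNIV :: 'n set"] by auto
  show ?thesis
    by (rule that[of "\<lambda>j. if j = k then 0 else Suc (f j)"]) (use f in \<open>auto simp: inj_def\<close>)
qed

text \<open>In a ranking that puts \<open>k0\<close> first, its pivot is the length of the column
  \<open>k0\<close>, so its rate is \<open>L\<close>. Every other pivot is at most the length of its
  own column, whose mean logarithm is again \<open>L\<close>. Hence \<open>L\<close> is the largest
  rate, attained at \<open>axis k0 1\<close>.\<close>

theorem AE_has_largest_lyapunov_exponent:
  assumes L: "\<And>k. integral\<^sup>L \<nu> (\<lambda>A. ln (norm (A *v axis k 1))) = L"
  shows "AE \<omega> in M. has_largest_lyapunov_exponent (\<lambda>m. P m \<omega>) L"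
proof -
  fix k0 :: 'n
  obtain r :: "'n \<Rightarrow> nat" where r: "inj r" and r0: "\<forall>j. j \<noteq> k0 \<longrightarrow> r k0 < r j"
    using ranking_exists[of k0] by metis
  have \<mu>0: "\<mu> r k0 = L" unfolding \<mu>_def L[of k0, symmetric] by (simp add: pivot_first[OF r0])
  have \<mu>_le: "\<mu> r k \<le> L" for k
  proof -
    \<comment> \<open>The second ranking makes the length of column \<open>k\<close> a pivot, and so
      supplies the integrability of its logarithm.\<close>
    obtain r' :: "'n \<Rightarrow> nat" where r': "inj r'" "\<forall>j. j \<noteq> k \<longrightarrow> r' k < r' j"
      using ranking_exists[of k] by metis
    have "\<mu> r k \<le> integral\<^sup>L \<nu> (\<lambda>A. ln (norm (A *v axis k 1)))"
      unfolding \<mu>_def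
    proof (rule integral_mono_AE)
      show "integrable \<nu> (\<lambda>A. ln (norm (A *v axis k 1)))"
        using integrable_ln_pivot[OF r'(1), of k] by (simp add: pivot_first[OF r'(2)])
      show "AE A in \<nu>. ln (pivot r k A) \<le> ln (norm (A *v axis k 1))"
        using AE_\<nu>_pivot_pos[OF r]
      proof eventually_elim
        case (elim A)
        then show ?case using pivot_le_lead[OF axis_in_lead, of r k A]
          by (metis ln_le_cancel_iff order_less_le_trans)
      qed
    qed (rule integrable_ln_pivot[OF r])
    then show ?thesis by (simp add: L)
  qed
  show ?thesis
    using AE_triangular_exponents[OF r]
  proof eventually_elim
    case (elim \<omega>)
    then interpret triangular_exponents r "\<lambda>m. P m \<omega>" "\<mu> r" "\<lambda>m. norm (Y m \<omega>)" .
    let ?g = "growth_rate (\<lambda>m. P m \<omega>)"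
    have conv: "\<exists>k. ?g y \<longlonglongrightarrow> \<mu> r k" if "y \<noteq> 0" for y using exponents_exist[OF that] .
    have le: "lim (?g y) \<le> L" if "y \<noteq> 0" for y
      using conv[OF that] \<mu>_le limI by metis
    have ax: "(axis k0 1 :: 'a ^ 'n) \<noteq> 0" by (simp add: axis_eq_0_iff)
    have "(\<lambda>m. 1 / real m * ln (pivot r k0 (P m \<omega>))) \<longlonglongrightarrow> \<mu> r k0"
      by (rule exp_bounded_limit_ln[OF upper lower pivot_pos])
    then have "?g (axis k0 1) \<longlonglongrightarrow> L"
      by (simp add: growth_rate_def[abs_def] pivot_first[OF r0] \<mu>0)
    then have eq: "lim (?g (axis k0 1)) = L" by (rule limI)
    show ?case
      unfolding has_largest_lyapunov_exponent_def
    proof (intro conjI allI impI)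
      show "convergent (?g y)" if "y \<noteq> 0" for y using conv[OF that] by (auto simp: convergent_def)
      show "bdd_above ((\<lambda>y. lim (?g y)) ` {y. y \<noteq> 0})" using le by (intro bdd_aboveI[of _ L]) auto
      show "L = (SUP y\<in>{y. y \<noteq> 0}. lim (?g y))"
        by (rule cSup_eq_maximum[symmetric]) (use le eq ax in auto)
    qed
  qed
qed

end


section \<open>The noncentral chi-squared law\<close>

definition chisq_density :: "real \<Rightarrow> real \<Rightarrow> real" where
  "chisq_density k t = (if t > 0 then t powr (k / 2 - 1) * exp (- t / 2) / (2 powr (k / 2) * Gamma (k / 2)) else 0)"

text \<open>The noncentral chi-squared law is the mixture of the chi-squared laws with \<open>k + 2 j\<close> degrees of
  freedom, \<open>j\<close> being Poisson distributed with mean \<open>l / 2\<close>. Working in \<^typ>\<open>ennreal\<close> postpones all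
  questions of convergence.\<close>

definition noncentral_mixture :: "real \<Rightarrow> real \<Rightarrow> real \<Rightarrow> ennreal" where
  "noncentral_mixture k l t = (\<Sum>j. ennreal (exp (- l / 2) * (l / 2) ^ j / fact j * chisq_density (k + 2 * real j) t))"

lemma borel_measurable_chisq_density [measurable]: "chisq_density k \<in> borel_measurable borel"
  unfolding chisq_density_def by measurable

lemma borel_measurable_noncentral_mixture [measurable]: "noncentral_mixture k l \<in> borel_measurable borel"
  unfolding noncentral_mixture_def by measurable

lemma chisq_density_nonneg: "k > 0 \<Longrightarrow> chisq_density k t \<ge> 0"
  by (auto simp: chisq_density_def intro!: divide_nonneg_nonneg mult_nonneg_nonneg)

lemma noncentral_mixture_0: "noncentral_mixture k 0 t = ennreal (chisq_density k t)"
proof -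
  have "noncentral_mixture k 0 t = (\<Sum>j. if j = 0 then ennreal (chisq_density k t) else 0)"
    unfolding noncentral_mixture_def by (intro suminf_cong) (simp add: power_0_left)
  also have "\<dots> = (\<Sum>j\<in>{0::nat}. if j = 0 then ennreal (chisq_density k t) else 0)"
    by (rule suminf_finite) auto
  finally show ?thesis by simp
qed

section \<open>Convolutions of chi-squared densities\<close>

lemma nn_integral_Beta:
  assumes "a > 0" "b > (0::real)"
  shows "(\<integral>\<^sup>+u. ennreal (u powr (a - 1) * (1 - u) powr (b - 1)) * indicator {0..1} u \<partial>lborel) = ennreal (Beta a b)"
proof -
  have hi: "((\<lambda>u. if u \<in> {0..1} then u powr (a - 1) * (1 - u) powr (b - 1) else 0) has_integral Beta a b) UNIV"
    using has_integral_Beta_real[OF assms] by (subst has_integral_restrict_UNIV)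
  have "(\<integral>\<^sup>+u. ennreal (u powr (a - 1) * (1 - u) powr (b - 1)) * indicator {0..1} u \<partial>lborel) =
      (\<integral>\<^sup>+u. ennreal (if u \<in> {0..1} then u powr (a - 1) * (1 - u) powr (b - 1) else 0) \<partial>lborel)"
    by (intro nn_integral_cong) (auto simp: indicator_def)
  also have "\<dots> = ennreal (Beta a b)"
    by (rule nn_integral_has_integral_lborel[OF _ _ hi]) auto
  finally show ?thesis .
qed

text \<open>The substitution \<open>y = x * u\<close> turns the convolution into a Beta
  integral.\<close>

lemma chisq_density_convolution:
  assumes a: "a > 0" and b: "b > 0"
  shows "(\<integral>\<^sup>+y. ennreal (chisq_density a (x - y)) * ennreal (chisq_density b y) \<partial>lborel) = ennreal (chisq_density (a + b) x)"
proof (cases "x > 0")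
  case False
  then have z: "ennreal (chisq_density a (x - y)) * ennreal (chisq_density b y) = 0" for y
    by (simp add: chisq_density_def)
  show ?thesis unfolding z using False by (simp add: chisq_density_def)
next
  case True
  \<comment> \<open>\<open>C\<close> collects all factors free of \<open>u\<close>. The exponent of
    \<open>x\<close> is one less than in the target density; the Jacobian \<open>x\<close> makes up
    for it.\<close>
  define C where "C = exp (- x / 2) * x powr ((a + b) / 2 - 2) / (2 powr ((a + b) / 2) * Gamma (a / 2) * Gamma (b / 2))"
  have Ga: "Gamma (a / 2) > 0" "Gamma (b / 2) > 0" "Gamma ((a + b) / 2) > 0" using a b by auto
  have C: "C \<ge> 0" unfolding C_def using Ga by (intro divide_nonneg_nonneg mult_nonneg_nonneg) auto
  have pt: "ennreal (chisq_density a (x - x * u)) * ennreal (chisq_density b (x * u)) =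
      ennreal C * (ennreal (u powr (b / 2 - 1) * (1 - u) powr (a / 2 - 1)) * indicator {0..1} u)" for u
  proof -
    consider "u \<le> 0 \<or> u \<ge> 1" | "0 < u" "u < 1" by linarith
    then show ?thesis
    proof cases
      case 1
      \<comment> \<open>The endpoints belong here: at u = 0 and u = 1 the Beta integrand vanishes
        too, since \<open>0 powr _ = 0\<close>.\<close>
      then have "x - x * u \<le> 0 \<or> x * u \<le> 0" using True by (auto simp: mult_le_0_iff)
      moreover have "u powr (b / 2 - 1) * (1 - u) powr (a / 2 - 1) * indicator {0..1} u = (0 :: real)"
        using 1 by (auto simp: indicator_def)
      then have "ennreal (u powr (b / 2 - 1) * (1 - u) powr (a / 2 - 1)) * indicator {0..1} u = 0"
        by (auto simp: indicator_def)
      ultimately show ?thesis by (auto simp: chisq_density_def)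
    next
      case 2
      have e: "x - x * u = x * (1 - u)" by (simp add: algebra_simps)
      have pos: "x - x * u > 0" "x * u > 0" "1 - u > 0" using 2 True by (auto simp: e)
      have ex: "exp (- (x - x * u) / 2) * exp (- (x * u) / 2) = exp (- x / 2)"
        by (simp add: exp_add[symmetric] field_simps)
      have px: "x powr (a / 2 - 1) * x powr (b / 2 - 1) = x powr ((a + b) / 2 - 2)"
        by (simp add: powr_add[symmetric] add_divide_distrib)
      have p2: "2 powr (a / 2) * 2 powr (b / 2) = (2 :: real) powr ((a + b) / 2)"
        by (simp add: powr_add[symmetric] add_divide_distrib)
      have "chisq_density a (x - x * u) * chisq_density b (x * u) =
          ((x - x * u) powr (a / 2 - 1) * (x * u) powr (b / 2 - 1)) * (exp (- (x - x * u) / 2) * exp (- (x * u) / 2)) /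
          ((2 powr (a / 2) * 2 powr (b / 2)) * Gamma (a / 2) * Gamma (b / 2))"
        using pos by (simp add: chisq_density_def mult_ac)
      also have "(x - x * u) powr (a / 2 - 1) * (x * u) powr (b / 2 - 1) =
          (x powr (a / 2 - 1) * x powr (b / 2 - 1)) * (u powr (b / 2 - 1) * (1 - u) powr (a / 2 - 1))"
        unfolding e using True 2 by (simp add: powr_mult)
      finally have "chisq_density a (x - x * u) * chisq_density b (x * u) = C * (u powr (b / 2 - 1) * (1 - u) powr (a / 2 - 1))"
        unfolding ex px p2 C_def by simp
      then show ?thesis
        using 2 C a b by (simp add: ennreal_mult'[symmetric] chisq_density_nonneg)
    qed
  qed
  have "(\<integral>\<^sup>+y. ennreal (chisq_density a (x - y)) * ennreal (chisq_density b y) \<partial>lborel) =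
      ennreal x * (\<integral>\<^sup>+u. ennreal (chisq_density a (x - x * u)) * ennreal (chisq_density b (x * u)) \<partial>lborel)"
    using True by (subst nn_integral_real_affine[where c=x and t=0]) auto
  also have "\<dots> = ennreal x * (ennreal C * ennreal (Beta (b / 2) (a / 2)))"
    unfolding pt using a b by (simp add: nn_integral_cmult nn_integral_Beta)
  also have "\<dots> = ennreal (x * (C * Beta (b / 2) (a / 2)))"
    using True C by (simp add: ennreal_mult')
  also have "x * (C * Beta (b / 2) (a / 2)) = chisq_density (a + b) x"
  proof -
    have "x * x powr ((a + b) / 2 - 2) = x powr ((a + b) / 2 - 1)"
      using True powr_add[of x 1 "(a + b) / 2 - 2"] by simp
    then show ?thesis
      using True Ga by (simp add: C_def chisq_density_def Beta_def add_divide_distrib[symmetric] add.commute[of b a] mult_ac field_simps)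
  qed
  finally show ?thesis .
qed

text \<open>Adding the square of a standard normal variable raises the degrees of freedom of each
  component by one and leaves the Poisson weights alone.\<close>

lemma noncentral_mixture_convolution:
  assumes k: "k > 0" and l: "l \<ge> 0"
  shows "(\<integral>\<^sup>+y. ennreal (chisq_density 1 (x - y)) * noncentral_mixture k l y \<partial>lborel) = noncentral_mixture (k + 1) l x"
proof -
  let ?p = "\<lambda>j. exp (- l / 2) * (l / 2) ^ j / fact j"
  have p: "?p j \<ge> 0" for j using l by simp
  have "(\<integral>\<^sup>+y. ennreal (chisq_density 1 (x - y)) * noncentral_mixture k l y \<partial>lborel) =
      (\<integral>\<^sup>+y. (\<Sum>j. ennreal (?p j) * (ennreal (chisq_density 1 (x - y)) * ennreal (chisq_density (k + 2 * real j) y))) \<partial>lborel)"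
  proof (rule nn_integral_cong)
    fix y
    show "ennreal (chisq_density 1 (x - y)) * noncentral_mixture k l y =
        (\<Sum>j. ennreal (?p j) * (ennreal (chisq_density 1 (x - y)) * ennreal (chisq_density (k + 2 * real j) y)))"
      unfolding noncentral_mixture_def ennreal_suminf_cmult[symmetric]
      by (intro suminf_cong) (subst ennreal_mult'[OF p], rule mult.left_commute)
  qed
  also have "\<dots> = (\<Sum>j. \<integral>\<^sup>+y. ennreal (?p j) * (ennreal (chisq_density 1 (x - y)) * ennreal (chisq_density (k + 2 * real j) y)) \<partial>lborel)"
    by (rule nn_integral_suminf) measurable
  also have "\<dots> = (\<Sum>j. ennreal (?p j) * ennreal (chisq_density (1 + (k + 2 * real j)) x))"
    using k by (intro suminf_cong) (simp add: nn_integral_cmult chisq_density_convolution)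
  also have "\<dots> = noncentral_mixture (k + 1) l x"
    unfolding noncentral_mixture_def
    by (intro suminf_cong) (subst ennreal_mult'[OF p, symmetric], simp add: add_ac)
  finally show ?thesis .
qed

section \<open>The square of a shifted normal variable\<close>

lemma nn_integral_square_substitution:
  assumes [measurable]: "w \<in> borel_measurable borel" "h \<in> borel_measurable borel"
  shows "(\<integral>\<^sup>+x. h (x\<^sup>2) * ennreal (w x) * indicator {0<..} x \<partial>lborel) =
    (\<integral>\<^sup>+t. h t * ennreal (w (sqrt t) / (2 * sqrt t)) * indicator {0<..} t \<partial>lborel)"
proof -
  let ?F = "\<lambda>x::real. h (x\<^sup>2) * ennreal (w x)"
  let ?f = "\<lambda>t::real. h t * ennreal (w (sqrt t) / (2 * sqrt t))"
  \<comment> \<open>Compact intervals away from the singularity at 0 exhaust the half-line, and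
    continuity from below passes to the limit. The offset 2 makes every interval nondegenerate, as
    1/(n+2) < 1 < n+2.\<close>
  define A where "A n = {1 / real (n + 2)..real (n + 2)}" for n
  define B where "B n = {(1 / real (n + 2))\<^sup>2..(real (n + 2))\<^sup>2}" for n
  have inc: "1 / real (m + 2) \<le> 1 / real (n + 2)" if "n \<le> m" for m n
    using that by (intro divide_left_mono) auto
  have U: "(\<Union>n. A n) = {0<..}" and U': "(\<Union>n. B n) = {0<..}"
  proof -
    have "\<exists>n. x \<in> A n" if "x > 0" for x
    proof -
      obtain n1 where n1: "1 / real (Suc n1) < x" using nat_approx_posE[OF \<open>x > 0\<close>] by blast
      obtain n2 :: nat where n2: "x < n2" using reals_Archimedean2 by blast
      let ?n = "max n1 n2"
      have "1 / real (?n + 2) \<le> 1 / real (Suc n1)" by (intro divide_left_mono) auto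
      then have "x \<in> A ?n" using n1 n2 by (auto simp: A_def)
      then show ?thesis by blast
    qed
    moreover have "0 < x" if "x \<in> A n" for x n
      using that less_le_trans[of 0 "1 / real (n + 2)" x] by (simp add: A_def)
    ultimately show UA: "(\<Union>n. A n) = {0<..}" by auto
    have AB: "sqrt x \<in> A n \<Longrightarrow> x \<in> B n" if "x > 0" for x n
      using that real_le_rsqrt[of "1 / real (n+2)"] unfolding A_def B_def atLeastAtMost_iff
      by (metis order_less_imp_le power_mono real_sqrt_pow2 of_nat_0_le_iff zero_le_divide_1_iff real_sqrt_ge_zero)
    have "\<exists>n. x \<in> B n" if "x > 0" for x
    proof -
      have "sqrt x \<in> (\<Union>n. A n)" using UA that by simp
      then show ?thesis using AB[OF that] by blast
    qed
    moreover have "0 < x" if "x \<in> B n" for x n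
      using that less_le_trans[of 0 "(1 / real (n + 2))\<^sup>2" x] by (simp add: B_def)
    ultimately show "(\<Union>n. B n) = {0<..}" by auto
  qed
  have iA: "incseq A" unfolding incseq_def A_def
  proof (intro allI impI)
    fix m n :: nat assume "m \<le> n"
    then show "{1 / real (m + 2)..real (m + 2)} \<subseteq> {1 / real (n + 2)..real (n + 2)}"
      using inc[of m n] by auto
  qed
  have iB: "incseq B" unfolding incseq_def B_def
  proof (intro allI impI)
    fix m n :: nat assume mn: "m \<le> n"
    have "(1 / real (n + 2))\<^sup>2 \<le> (1 / real (m + 2))\<^sup>2" by (intro power_mono inc mn) auto
    moreover have "(real (m + 2))\<^sup>2 \<le> (real (n + 2))\<^sup>2" using mn by (intro power_mono) auto
    ultimately show "{(1 / real (m + 2))\<^sup>2..(real (m + 2))\<^sup>2} \<subseteq> {(1 / real (n + 2))\<^sup>2..(real (n + 2))\<^sup>2}"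
      by auto
  qed
  have eq: "emeasure (density lborel ?f) (B n) = emeasure (density lborel ?F) (A n)" for n
  proof -
    have lt: "1 / real (n + 2) < real (n + 2)" by (rule less_trans[of _ 1]) auto
    have "emeasure (density lborel ?f) (B n) = (\<integral>\<^sup>+t. ?f t * indicator {(1 / real (n + 2))\<^sup>2..(real (n + 2))\<^sup>2} t \<partial>lborel)"
      unfolding B_def by (rule emeasure_density) auto
    also have "\<dots> = (\<integral>\<^sup>+x. ?f (x\<^sup>2) * ennreal (2 * x) * indicator {1 / real (n + 2)..real (n + 2)} x \<partial>lborel)"
      by (rule nn_integral_substitution_aux[OF _ _ _ _ _ lt])
        (auto intro!: derivative_eq_intros continuous_intros intro: order_trans[rotated])
    also have "\<dots> = (\<integral>\<^sup>+x. ?F x * indicator (A n) x \<partial>lborel)"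
    proof (rule nn_integral_cong)
      fix x
      show "?f (x\<^sup>2) * ennreal (2 * x) * indicator {1 / real (n + 2)..real (n + 2)} x = ?F x * indicator (A n) x"
      proof (cases "x \<in> A n")
        case True
        then have x: "x > 0" using U by blast
        then have "ennreal (w x / (2 * x)) * ennreal (2 * x) = ennreal (w x)"
          by (subst ennreal_mult''[symmetric]) auto
        then show ?thesis using True x by (simp add: A_def mult.assoc)
      qed (simp add: A_def)
    qed
    also have "\<dots> = emeasure (density lborel ?F) (A n)"
      by (rule emeasure_density[symmetric]) (auto simp: A_def)
    finally show ?thesis .
  qed
  have "emeasure (density lborel ?F) {0<..} = (SUP n. emeasure (density lborel ?F) (A n))"
    unfolding U[symmetric] by (rule SUP_emeasure_incseq[OF _ iA, symmetric]) (auto simp: A_def)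
  also have "\<dots> = (SUP n. emeasure (density lborel ?f) (B n))" by (simp only: eq)
  also have "\<dots> = emeasure (density lborel ?f) {0<..}"
    unfolding U'[symmetric] by (rule SUP_emeasure_incseq[OF _ iB]) (auto simp: B_def)
  finally show ?thesis by (simp add: emeasure_density)
qed

text \<open>Legendre's duplication formula at half-integers, free of division. It turns the Gamma
  values of odd degrees of freedom into the factorials (2j)! of the cosh series.\<close>

lemma Gamma_half_fact: "4 ^ j * fact j * Gamma (real j + 1 / 2) = sqrt pi * fact (2 * j)"
proof (induction j)
  case 0
  show ?case by (simp add: Gamma_one_half_real)
next
  case (Suc j)
  have "Gamma (real (Suc j) + 1 / 2) = (real j + 1 / 2) * Gamma (real j + 1 / 2)"
  proof -
    have "real j + 1 / 2 \<notin> \<int>\<^sub>\<le>\<^sub>0" by (force dest: nonpos_Ints_nonpos)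
    from Gamma_plus1[OF this] show ?thesis by (simp add: add_ac)
  qed
  then have "4 ^ Suc j * fact (Suc j) * Gamma (real (Suc j) + 1 / 2) =
      (4 * real (Suc j) * (real j + 1 / 2)) * (4 ^ j * fact j * Gamma (real j + 1 / 2))"
    by simp
  also have "\<dots> = (real (2 * j + 2) * real (2 * j + 1)) * (sqrt pi * fact (2 * j))"
    unfolding Suc.IH by (simp add: algebra_simps)
  also have "\<dots> = sqrt pi * fact (2 * Suc j)" by (simp add: algebra_simps)
  finally show ?case .
qed

text \<open>Both square roots of \<open>t\<close> contribute. Expanding the squares in the exponents
  leaves a multiple of \<open>cosh (a * sqrt t)\<close>, and the even powers in its series are the
  Poisson-weighted chi-squared densities.\<close>

lemma noncentral_mixture_1:
  assumes t: "t > 0"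
  shows "ennreal ((std_normal_density (sqrt t - a) + std_normal_density (sqrt t + a)) / (2 * sqrt t)) = noncentral_mixture 1 (a\<^sup>2) t"
proof -
  let ?K = "exp (- (t + a\<^sup>2) / 2) / (sqrt (2 * pi) * sqrt t)"
  have s2: "(sqrt t)\<^sup>2 = t" using t by simp
  have e1: "- (sqrt t - a)\<^sup>2 / 2 = - (t + a\<^sup>2) / 2 + a * sqrt t" "- (sqrt t + a)\<^sup>2 / 2 = - (t + a\<^sup>2) / 2 + - (a * sqrt t)"
    by (simp_all add: power2_diff power2_sum s2 field_simps)
  have lhs: "(std_normal_density (sqrt t - a) + std_normal_density (sqrt t + a)) / (2 * sqrt t) = ?K * cosh (a * sqrt t)"
    unfolding std_normal_density_def e1 exp_add cosh_def by (simp add: field_simps)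
  have "(\<lambda>n. if even n then (a * sqrt t) ^ n /\<^sub>R fact n else 0) sums cosh (a * sqrt t)" by (rule cosh_converges)
  then have "(\<lambda>j. (a * sqrt t) ^ (2 * j) /\<^sub>R fact (2 * j)) sums cosh (a * sqrt t)"
    by (subst (asm) sums_mono_reindex[of "\<lambda>j. 2 * j", symmetric]) (auto simp: strict_mono_def elim!: evenE)
  then have "(\<lambda>j. ?K * ((a * sqrt t) ^ (2 * j) /\<^sub>R fact (2 * j))) sums (?K * cosh (a * sqrt t))"
    by (rule sums_mult)
  also have "(\<lambda>j. ?K * ((a * sqrt t) ^ (2 * j) /\<^sub>R fact (2 * j))) =
      (\<lambda>j. exp (- a\<^sup>2 / 2) * (a\<^sup>2 / 2) ^ j / fact j * chisq_density (1 + 2 * real j) t)"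
  proof
    fix j
    have g: "Gamma (real j + 1 / 2) > 0" by auto
    have pt: "t powr ((1 + 2 * real j) / 2 - 1) = t ^ j / sqrt t"
    proof -
      have "t powr ((1 + 2 * real j) / 2 - 1) = t powr (real j - 1 / 2)" by (simp add: field_simps)
      also have "\<dots> = t ^ j / sqrt t" using t by (simp add: powr_diff powr_realpow powr_half_sqrt)
      finally show ?thesis .
    qed
    have p2: "2 powr ((1 + 2 * real j) / 2) = 2 ^ j * sqrt 2"
    proof -
      have "(2::real) powr ((1 + 2 * real j) / 2) = 2 powr (real j + 1 / 2)" by (simp add: field_simps)
      also have "\<dots> = 2 ^ j * sqrt 2" by (simp add: powr_add powr_realpow powr_half_sqrt)
      finally show ?thesis .
    qed
    have gj: "Gamma ((1 + 2 * real j) / 2) = sqrt pi * fact (2 * j) / (4 ^ j * fact j)"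
    proof -
      have "(1 + 2 * real j) / 2 = real j + 1 / 2" by (simp add: field_simps)
      then show ?thesis using Gamma_half_fact[of j] by (simp add: field_simps)
    qed
    have "exp (- a\<^sup>2 / 2) * (a\<^sup>2 / 2) ^ j / fact j * chisq_density (1 + 2 * real j) t =
        (exp (- a\<^sup>2 / 2) * exp (- t / 2)) * ((a\<^sup>2) ^ j * t ^ j) * ((4 ^ j) / (2 ^ j * 2 ^ j)) / (sqrt t * sqrt 2 * sqrt pi * fact (2 * j))"
      using t unfolding chisq_density_def pt p2 gj by (simp add: power_divide field_simps)
    also have "exp (- a\<^sup>2 / 2) * exp (- t / 2) = exp (- (t + a\<^sup>2) / 2)" by (simp add: exp_add[symmetric] field_simps)
    also have "(4::real) ^ j / (2 ^ j * 2 ^ j) = 1" by (simp add: power_mult_distrib[symmetric])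
    also have "(a\<^sup>2) ^ j * t ^ j = (a * sqrt t) ^ (2 * j)"
      using t by (simp add: power_mult power_mult_distrib)
    finally show "?K * ((a * sqrt t) ^ (2 * j) /\<^sub>R fact (2 * j)) =
        exp (- a\<^sup>2 / 2) * (a\<^sup>2 / 2) ^ j / fact j * chisq_density (1 + 2 * real j) t"
      by (simp add: real_sqrt_mult field_simps)
  qed
  finally have "(\<lambda>j. exp (- a\<^sup>2 / 2) * (a\<^sup>2 / 2) ^ j / fact j * chisq_density (1 + 2 * real j) t) sums (?K * cosh (a * sqrt t))" .
  then have "noncentral_mixture 1 (a\<^sup>2) t = ennreal (?K * cosh (a * sqrt t))"
    unfolding noncentral_mixture_def
    by (intro suminf_ennreal_eq) (intro mult_nonneg_nonneg divide_nonneg_nonneg chisq_density_nonneg, auto)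
  then show ?thesis by (simp only: lhs)
qed

lemma (in prob_space) distributed_square_shifted_normal:
  assumes g: "distributed M lborel g std_normal_density"
  shows "distributed M lborel (\<lambda>\<omega>. (a + g \<omega>)\<^sup>2) (noncentral_mixture 1 (a\<^sup>2))"
proof -
  have [measurable]: "g \<in> borel_measurable M" using distributed_measurable[OF g] by simp
  have "distr M lborel (\<lambda>\<omega>. (a + g \<omega>)\<^sup>2) = density lborel (noncentral_mixture 1 (a\<^sup>2))"
  proof (rule measure_eqI)
    fix A assume "A \<in> sets (distr M lborel (\<lambda>\<omega>. (a + g \<omega>)\<^sup>2))"
    then have [measurable]: "A \<in> sets borel" by simp
    let ?h = "indicator A :: real \<Rightarrow> ennreal"
    let ?\<phi> = std_normal_density
    have "emeasure (distr M lborel (\<lambda>\<omega>. (a + g \<omega>)\<^sup>2)) A = (\<integral>\<^sup>+t. ?h t \<partial>distr M lborel (\<lambda>\<omega>. (a + g \<omega>)\<^sup>2))"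
      by simp
    also have "\<dots> = (\<integral>\<^sup>+\<omega>. ?h ((a + g \<omega>)\<^sup>2) \<partial>M)" by (rule nn_integral_distr) auto
    also have "\<dots> = (\<integral>\<^sup>+x. ennreal (?\<phi> x) * ?h ((a + x)\<^sup>2) \<partial>lborel)"
      by (rule distributed_nn_integral[OF g, symmetric]) auto
    also have "\<dots> = (\<integral>\<^sup>+x. ennreal (?\<phi> (x - a)) * ?h (x\<^sup>2) \<partial>lborel)"
      by (subst nn_integral_real_affine[where c=1 and t="-a"]) auto
    \<comment> \<open>The negative half-line is to be reflected onto the positive one, so that both
      branches of the square root share one substitution.\<close>
    also have "\<dots> = (\<integral>\<^sup>+x. ?h (x\<^sup>2) * ennreal (?\<phi> (x - a)) * indicator {0<..} x +
        ?h ((- x)\<^sup>2) * ennreal (?\<phi> (x - a)) * indicator {0<..} (- x) \<partial>lborel)"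
    proof (rule nn_integral_cong_AE)
      have "AE x in lborel. x \<noteq> (0::real)" by (rule AE_lborel_singleton)
      then show "AE x in lborel. ennreal (?\<phi> (x - a)) * ?h (x\<^sup>2) =
        ?h (x\<^sup>2) * ennreal (?\<phi> (x - a)) * indicator {0<..} x + ?h ((- x)\<^sup>2) * ennreal (?\<phi> (x - a)) * indicator {0<..} (- x)"
        by eventually_elim (auto simp: indicator_def mult.commute)
    qed
    also have "\<dots> = (\<integral>\<^sup>+x. ?h (x\<^sup>2) * ennreal (?\<phi> (x - a)) * indicator {0<..} x \<partial>lborel) +
        (\<integral>\<^sup>+x. ?h ((- x)\<^sup>2) * ennreal (?\<phi> (x - a)) * indicator {0<..} (- x) \<partial>lborel)"
      by (rule nn_integral_add) auto
    also have "(\<integral>\<^sup>+x. ?h ((- x)\<^sup>2) * ennreal (?\<phi> (x - a)) * indicator {0<..} (- x) \<partial>lborel) =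
        (\<integral>\<^sup>+x. ?h (x\<^sup>2) * ennreal (?\<phi> (- x - a)) * indicator {0<..} x \<partial>lborel)"
      by (subst nn_integral_real_affine[where c="-1" and t=0]) auto
    also have "(\<integral>\<^sup>+x. ?h (x\<^sup>2) * ennreal (?\<phi> (x - a)) * indicator {0<..} x \<partial>lborel) + \<dots> =
        (\<integral>\<^sup>+x. ?h (x\<^sup>2) * ennreal (?\<phi> (x - a)) * indicator {0<..} x + ?h (x\<^sup>2) * ennreal (?\<phi> (- x - a)) * indicator {0<..} x \<partial>lborel)"
      by (rule nn_integral_add[symmetric]) auto
    also have "\<dots> = (\<integral>\<^sup>+x. ?h (x\<^sup>2) * ennreal (?\<phi> (x - a) + ?\<phi> (x + a)) * indicator {0<..} x \<partial>lborel)"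
    proof (rule nn_integral_cong)
      fix x
      have "?\<phi> (- x - a) = ?\<phi> (x + a)"
        using power2_minus[of "x + a"] by (simp add: std_normal_density_def)
      then show "?h (x\<^sup>2) * ennreal (?\<phi> (x - a)) * indicator {0<..} x + ?h (x\<^sup>2) * ennreal (?\<phi> (- x - a)) * indicator {0<..} x =
          ?h (x\<^sup>2) * ennreal (?\<phi> (x - a) + ?\<phi> (x + a)) * indicator {0<..} x"
        by (simp add: ennreal_plus distrib_left distrib_right)
    qed
    also have "\<dots> = (\<integral>\<^sup>+t. ?h t * ennreal ((?\<phi> (sqrt t - a) + ?\<phi> (sqrt t + a)) / (2 * sqrt t)) * indicator {0<..} t \<partial>lborel)"
      by (rule nn_integral_square_substitution) auto
    also have "\<dots> = (\<integral>\<^sup>+t. noncentral_mixture 1 (a\<^sup>2) t * ?h t \<partial>lborel)"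
    proof (rule nn_integral_cong)
      fix t :: real
      show "?h t * ennreal ((?\<phi> (sqrt t - a) + ?\<phi> (sqrt t + a)) / (2 * sqrt t)) * indicator {0<..} t = noncentral_mixture 1 (a\<^sup>2) t * ?h t"
      proof (cases "t > 0")
        case True
        then show ?thesis unfolding noncentral_mixture_1[OF True] by (simp add: mult.commute)
      next
        case False
        then show ?thesis by (simp add: noncentral_mixture_def chisq_density_def)
      qed
    qed
    also have "\<dots> = emeasure (density lborel (noncentral_mixture 1 (a\<^sup>2))) A"
      by (rule emeasure_density[symmetric]) auto
    finally show "emeasure (distr M lborel (\<lambda>\<omega>. (a + g \<omega>)\<^sup>2)) A = emeasure (density lborel (noncentral_mixture 1 (a\<^sup>2))) A" .
  qed simp
  then show ?thesis by (simp add: distributed_def)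
qed

text \<open>All noncentrality sits in the summand \<open>i0\<close>. The others have shift 0 and add
  one central degree of freedom each by convolution.\<close>

lemma (in prob_space) distributed_noncentral_chisq:
  assumes "finite S" "i0 \<notin> S"
    and "indep_vars (\<lambda>_. borel) g (insert i0 S)"
    and "\<And>i. i \<in> insert i0 S \<Longrightarrow> distributed M lborel (g i) std_normal_density"
  shows "distributed M lborel (\<lambda>\<omega>. \<Sum>i\<in>insert i0 S. ((if i = i0 then a else 0) + g i \<omega>)\<^sup>2) (noncentral_mixture (1 + real (card S)) (a\<^sup>2))"
  using assms
proof (induction S rule: finite_induct)
  case empty
  then show ?case using distributed_square_shifted_normal[of "g i0" a] by simp
next
  case (insert i S)
  let ?X = "\<lambda>i \<omega>. ((if i = i0 then a else 0) + g i \<omega>)\<^sup>2"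
  have ne: "i \<noteq> i0" using insert by auto
  have "indep_vars (\<lambda>_. borel) ?X (insert i0 (insert i S))"
    using indep_vars_compose2[OF insert.prems(2), of "\<lambda>i x. ((if i = i0 then a else 0) + x)\<^sup>2" "\<lambda>_. borel"] by simp
  then have "indep_vars (\<lambda>_. borel) ?X (insert i (insert i0 S))" by (simp add: insert_commute)
  then have ind: "indep_var borel (?X i) borel (\<lambda>\<omega>. \<Sum>j\<in>insert i0 S. ?X j \<omega>)"
    using insert.hyps ne by (intro indep_vars_sum) auto
  have d1: "distributed M lborel (?X i) (\<lambda>t. ennreal (chisq_density 1 t))"
    using distributed_square_shifted_normal[of "g i" 0] insert.prems(3)[of i] ne by (simp add: noncentral_mixture_0[abs_def])
  have d2: "distributed M lborel (\<lambda>\<omega>. \<Sum>j\<in>insert i0 S. ?X j \<omega>) (noncentral_mixture (1 + real (card S)) (a\<^sup>2))"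
    using insert.prems by (intro insert.IH) (auto intro: indep_vars_subset)
  have "distributed M lborel (\<lambda>\<omega>. ?X i \<omega> + (\<Sum>j\<in>insert i0 S. ?X j \<omega>))
      (\<lambda>x. \<integral>\<^sup>+y. ennreal (chisq_density 1 (x - y)) * noncentral_mixture (1 + real (card S)) (a\<^sup>2) y \<partial>lborel)"
    by (rule distributed_convolution[OF ind d1 d2])
  also have "(\<lambda>x. \<integral>\<^sup>+y. ennreal (chisq_density 1 (x - y)) * noncentral_mixture (1 + real (card S)) (a\<^sup>2) y \<partial>lborel) =
      noncentral_mixture (1 + real (card (insert i S))) (a\<^sup>2)"
    using insert.hyps by (simp add: noncentral_mixture_convolution fun_eq_iff add_ac)
  also have "(\<lambda>\<omega>. ?X i \<omega> + (\<Sum>j\<in>insert i0 S. ?X j \<omega>)) = (\<lambda>\<omega>. \<Sum>j\<in>insert i0 (insert i S). ?X j \<omega>)"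
    using insert.hyps ne by (subst insert_commute) (simp add: fun_eq_iff)
  finally show ?case .
qed

text \<open>The mixture and the Bessel series agree term by term up to the common factor
  \<open>?K\<close>. Summability is read off from \<open>fin\<close>, which holds for almost every
  \<open>t\<close> when the mixture is a probability density.\<close>

lemma noncentral_mixture_eq_density:
  assumes t: "t > 0" and k: "k > 0" and l: "l > 0" and fin: "noncentral_mixture k l t \<noteq> \<infinity>"
  shows "noncentral_mixture k l t = ennreal (noncentral_chisq_density t k l)"
    "noncentral_chisq_density t k l \<ge> 0"
proof -
  let ?u = "\<lambda>j. exp (- l / 2) * (l / 2) ^ j / fact j * chisq_density (k + 2 * real j) t"
  let ?v = "\<lambda>j. (sqrt (l * t) / 2) powr (2 * real j + (k / 2 - 1)) * rGamma (real j + (k / 2 - 1) + 1) / fact j"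
  let ?K = "1 / 2 * exp (- (t + l) / 2) * (t / l) powr (k / 4 - 1 / 2)"
  have u: "?u j \<ge> 0" for j using l k by (intro mult_nonneg_nonneg chisq_density_nonneg) auto
  have K: "?K > 0" using t l by simp
  have sm: "summable ?u"
    using fin u by (intro summable_suminf_not_top) (auto simp: noncentral_mixture_def)
  have uv: "?u j = ?K * ?v j" for j
  proof -
    have s: "sqrt (l * t) / 2 = (l * t / 4) powr (1 / 2)"
      using l t by (simp add: powr_half_sqrt real_sqrt_divide)
    have "(sqrt (l * t) / 2) powr (2 * real j + (k / 2 - 1)) = (l * t / 4) powr (real j + (k / 4 - 1 / 2))"
      unfolding s powr_powr by (simp add: field_simps)
    also have "\<dots> = (l * t / 4) ^ j * (l * t / 4) powr (k / 4 - 1 / 2)"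
      using l t by (simp add: powr_add powr_realpow)
    finally have p1: "(sqrt (l * t) / 2) powr (2 * real j + (k / 2 - 1)) = (l * t / 4) ^ j * (l * t / 4) powr (k / 4 - 1 / 2)" .
    \<comment> \<open>Since (t/l) * (l*t/4) is the square of t/2, the exponent k/4 - 1/2 doubles to
      the chi-squared exponent k/2 - 1.\<close>
    have "(t / l) powr (k / 4 - 1 / 2) * (l * t / 4) powr (k / 4 - 1 / 2) = ((t / 2) powr 2) powr (k / 4 - 1 / 2)"
      using l t by (subst powr_mult[symmetric]) (auto simp: power2_eq_square)
    also have "\<dots> = (t / 2) powr (k / 2 - 1)" 
    proof -
      have "2 * (k / 4 - 1 / 2) = k / 2 - 1" by simp
      then show ?thesis by (simp only: powr_powr)
    qed
    also have "\<dots> = t powr (k / 2 - 1) / 2 powr (k / 2 - 1)" using t by (simp add: powr_divide)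
    also have "2 powr (k / 2 - 1) = 2 powr (k / 2) / (2::real)" by (simp add: powr_diff)
    finally have p2: "(t / l) powr (k / 4 - 1 / 2) * (l * t / 4) powr (k / 4 - 1 / 2) = 2 * t powr (k / 2 - 1) / 2 powr (k / 2)"
      by simp
    have rg: "rGamma (real j + (k / 2 - 1) + 1) = 1 / Gamma (k / 2 + real j)"
      by (simp add: rGamma_inverse_Gamma inverse_eq_divide add.commute)
    have "?K * ?v j = 1 / 2 * exp (- (t + l) / 2) * ((t / l) powr (k / 4 - 1 / 2) * (l * t / 4) powr (k / 4 - 1 / 2)) * (l * t / 4) ^ j
        * (1 / Gamma (k / 2 + real j)) / fact j"
      unfolding p1 rg by (simp add: mult_ac)
    also have "\<dots> = exp (- (t + l) / 2) * (t powr (k / 2 - 1) / 2 powr (k / 2)) * (l * t / 4) ^ j * (1 / Gamma (k / 2 + real j)) / fact j"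
      unfolding p2 by simp
    also have "\<dots> = (exp (- l / 2) * exp (- t / 2)) * (t powr (k / 2 - 1) / 2 powr (k / 2)) * ((l / 2) ^ j * (t ^ j / 2 ^ j)) * (1 / Gamma (k / 2 + real j)) / fact j"
    proof -
      have "l * t / 4 = (l / 2) * (t / 2)" by simp
      then have "(l * t / 4) ^ j = (l / 2) ^ j * (t ^ j / 2 ^ j)" by (simp only: power_mult_distrib power_divide)
      moreover have "exp (- (t + l) / 2) = exp (- l / 2) * exp (- t / 2)" by (simp add: exp_add[symmetric] field_simps)
      ultimately show ?thesis by (simp only:)
    qed
    finally have "?K * ?v j = exp (- l / 2) * (l / 2) ^ j / fact j * ((t powr (k / 2 - 1) * t ^ j) * exp (- t / 2) / ((2 powr (k / 2) * 2 ^ j) * Gamma (k / 2 + real j)))"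
      by (simp only: times_divide_eq_left times_divide_eq_right divide_divide_eq_left divide_divide_eq_right mult_1_right mult_ac)
    moreover have "t powr (k / 2 - 1) * t ^ j = t powr ((k + 2 * real j) / 2 - 1)"
    proof -
      have "(k + 2 * real j) / 2 - 1 = (k / 2 - 1) + real j" by (simp add: field_simps)
      then show ?thesis by (simp only: powr_add powr_realpow[OF t])
    qed
    moreover have "2 powr (k / 2) * 2 ^ j = (2::real) powr ((k + 2 * real j) / 2)"
      by (simp add: powr_realpow[symmetric] powr_add[symmetric] add_divide_distrib)
    moreover have "k / 2 + real j = (k + 2 * real j) / 2" by simp
    ultimately show ?thesis using t by (simp add: chisq_density_def)
  qed
  have "summable (\<lambda>j. (1 / ?K) * ?u j)" by (rule summable_mult[OF sm])
  moreover have inv: "1 / x * (x * y) = y" if "x > 0" for x y :: real using that by simp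
  have "1 / ?K * ?u j = ?v j" for j unfolding uv by (rule inv[OF K])
  ultimately have sv: "summable ?v" by (simp only:)
  have "noncentral_mixture k l t = ennreal (suminf ?u)"
    unfolding noncentral_mixture_def using u sm by (rule suminf_ennreal2)
  moreover have "suminf ?u = noncentral_chisq_density t k l"
    unfolding uv noncentral_chisq_density_def bessel_I_def by (rule suminf_mult[OF sv])
  moreover have "suminf ?u \<ge> 0" by (rule suminf_nonneg[OF sm u])
  ultimately show "noncentral_mixture k l t = ennreal (noncentral_chisq_density t k l)"
    "noncentral_chisq_density t k l \<ge> 0" by simp_all
qed

lemma (in prob_space) expectation_ln_noncentral_chisq:
  assumes T: "distributed M lborel T (noncentral_mixture k l)" and k: "k > 0" and l: "l > 0"
  shows "expectation (\<lambda>\<omega>. ln (T \<omega> / l)) = (LBINT t:{0<..}. ln (t / l) * noncentral_chisq_density t k l)"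
proof -
  let ?f = "\<lambda>t. enn2real (noncentral_mixture k l t)"
  interpret D: prob_space "density lborel (noncentral_mixture k l)"
    using distributed_distr_eq_density[OF T, symmetric] distributed_measurable[OF T] by (simp add: prob_space_distr)
  have "(\<integral>\<^sup>+t. noncentral_mixture k l t \<partial>lborel) = 1"
    using D.emeasure_space_1 by (simp add: emeasure_density)
  \<comment> \<open>As the density of a law, the mixture integrates to 1 and so is finite almost
    everywhere.\<close>
  then have fin: "AE t in lborel. noncentral_mixture k l t \<noteq> \<infinity>"
    by (intro nn_integral_PInf_AE) auto
  have "distributed M lborel T (\<lambda>t. ennreal (?f t))"
    using T by (rule distributed_cong_density[THEN iffD1, rotated -1])
      (use fin in \<open>auto simp: less_top\<close>)
  then have "expectation (\<lambda>\<omega>. ln (T \<omega> / l)) = (\<integral>t. ?f t * ln (t / l) \<partial>lborel)"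
    by (intro distributed_integral[symmetric]) auto
  also have "\<dots> = (\<integral>t. indicator {0<..} t *\<^sub>R (ln (t / l) * noncentral_chisq_density t k l) \<partial>lborel)"
  proof (rule integral_cong_AE)
    show "(\<lambda>t. indicator {0<..} t *\<^sub>R (ln (t / l) * noncentral_chisq_density t k l)) \<in> borel_measurable lborel"
      unfolding noncentral_chisq_density_def bessel_I_def by measurable
    show "AE t in lborel. ?f t * ln (t / l) = indicator {0<..} t *\<^sub>R (ln (t / l) * noncentral_chisq_density t k l)"
      using fin
    proof eventually_elim
      case (elim t)
      show ?case
      proof (cases "t > 0")
        case True
        have "noncentral_mixture k l t = ennreal (noncentral_chisq_density t k l)"
          by (rule noncentral_mixture_eq_density(1)[OF True k l elim])
        moreover have "noncentral_chisq_density t k l \<ge> 0"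
          by (rule noncentral_mixture_eq_density(2)[OF True k l elim])
        ultimately show ?thesis using True by simp
      next
        case False
        then show ?thesis by (simp add: noncentral_mixture_def chisq_density_def)
      qed
    qed
  qed measurable
  finally show ?thesis by (simp add: set_lebesgue_integral_def)
qed


section \<open>Quaternions and the largest Lyapunov exponent\<close>

instantiation quat :: real_normed_div_algebra
begin

definition "inverse x = Quat (qRe x) (- qI x) (- qJ x) (- qK x) /\<^sub>R (x \<bullet> x)"
definition "x div y = x * inverse (y :: quat)"

instance
proof
  fix x y :: quat
  \<comment> \<open>Euler's four-square identity.\<close>
  have mult: "(x * y) \<bullet> (x * y) = (x \<bullet> x) * (y \<bullet> y)"
    by (simp add: inner_quat_def times_quat_def algebra_simps)
  show "norm (x * y) = norm x * norm y"
    unfolding norm_quat_def mult by (rule real_sqrt_mult)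
  show "inverse (0 :: quat) = 0" by (simp add: inverse_quat_def)
  show "x div y = x * inverse y" by (rule divide_quat_def)
  assume "x \<noteq> 0"
  then have n: "x \<bullet> x \<noteq> 0" by simp
  have "Quat (qRe x) (- qI x) (- qJ x) (- qK x) * x = (x \<bullet> x) *\<^sub>R 1" "x * Quat (qRe x) (- qI x) (- qJ x) (- qK x) = (x \<bullet> x) *\<^sub>R 1"
    by (simp_all add: inner_quat_def times_quat_def one_quat_def scaleR_quat_def mult.commute)
  then show "inverse x * x = 1" "x * inverse x = 1"
    using n by (simp_all add: inverse_quat_def)
qed

end

section \<open>Column norms and the exponent\<close>

lemma indep_vars_reindex:
  assumes M: "prob_space M" and ind: "prob_space.indep_vars M (\<lambda>_. N) X I" and f: "inj_on f J" "f ` J \<subseteq> I"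
  shows "prob_space.indep_vars M (\<lambda>_. N) (\<lambda>j. X (f j)) J"
proof -
  interpret prob_space M by fact
  have "indep_vars (\<lambda>j. PiM {f j} (\<lambda>_. N)) (\<lambda>j \<omega>. restrict (\<lambda>t. X t \<omega>) {f j}) J"
    by (rule indep_vars_restrict[OF ind]) (use f in \<open>auto simp: disjoint_family_on_def inj_on_def\<close>)
  then have "indep_vars (\<lambda>_. N) (\<lambda>j \<omega>. (restrict (\<lambda>t. X t \<omega>) {f j}) (f j)) J"
    by (rule indep_vars_compose2) auto
  then show ?thesis by simp
qed

text \<open>The \<open>k\<close>-th column is \<sigma>/c times a vector of standard normal
  components, exactly one of which is shifted, by a = c/\<sigma>. That component is the coordinate
  of 1 in the diagonal entry, whence the hypothesis \<open>one\<close>. So the squared norm is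
  \<open>T \<omega> / l\<close> with \<open>T\<close> noncentral chi-squared and l the square of
  a.\<close>

lemma expectation_ln_norm_column:
  fixes X :: "'v \<Rightarrow> 'a::{euclidean_space, real_normed_div_algebra} ^ 'n ^ 'n"
  assumes one: "(1 :: 'a) \<in> Basis" and \<sigma>: "\<sigma> > 0" and c: "c > 0" and l: "l = (c / \<sigma>)\<^sup>2"
    and gm: "gaussian_matrix M \<sigma> X"
  shows "(\<integral>\<omega>. ln (norm ((mat 1 + (1 / c) *\<^sub>R X \<omega>) *v axis k 1)) \<partial>M) =
    1 / 2 * (LBINT t:{0<..}. ln (t / l) * noncentral_chisq_density t (real DIM('a) * real CARD('n)) l)"
proof -
  interpret prob_space M using gm by (simp add: gaussian_matrix_def)
  let ?I = "UNIV \<times> Basis :: ('n \<times> 'a) set"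
  define a where "a = c / \<sigma>"
  define g where "g = (\<lambda>(i, b) \<omega>. (X \<omega> $ i $ k \<bullet> b) / \<sigma>)"
  define S where "S = ?I - {(k, 1)}"
  define T where "T \<omega> = (\<Sum>t\<in>insert (k, 1) S. ((if t = (k, 1) then a else 0) + g t \<omega>)\<^sup>2)" for \<omega>
  have I: "insert (k, 1) S = ?I" using one by (auto simp: S_def)
  have S: "finite S" "(k, 1) \<notin> S" by (auto simp: S_def)
  have "card ?I = Suc (card S)" unfolding I[symmetric] using S by simp
  then have "1 + real (card S) = real (card ?I)" by simp
  then have card: "1 + real (card S) = real DIM('a) * real CARD('n)"
    by (simp add: card_cartesian_product mult.commute)
  have l0: "l > 0" using \<sigma> c by (simp add: l)
  have ind: "indep_vars (\<lambda>_. borel) (\<lambda>(i, j, b) \<omega>. X \<omega> $ i $ j \<bullet> b) (UNIV \<times> UNIV \<times> Basis)"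
    and dist: "\<And>i j b. b \<in> Basis \<Longrightarrow> distributed M lborel (\<lambda>\<omega>. X \<omega> $ i $ j \<bullet> b) (normal_density 0 \<sigma>)"
    using gm by (auto simp: gaussian_matrix_def)
  have "indep_vars (\<lambda>_. borel) (\<lambda>t. (\<lambda>(i, j, b) \<omega>. X \<omega> $ i $ j \<bullet> b) ((\<lambda>(i, b). (i, k, b)) t)) ?I"
    by (rule indep_vars_reindex[OF prob_space_axioms ind]) (auto simp: inj_on_def)
  then have "indep_vars (\<lambda>_. borel) (\<lambda>t \<omega>. (\<lambda>(i, j, b) \<omega>. X \<omega> $ i $ j \<bullet> b) ((\<lambda>(i, b). (i, k, b)) t) \<omega> / \<sigma>) ?I"
    by (rule indep_vars_compose2) auto
  then have indg: "indep_vars (\<lambda>_. borel) g (insert (k, 1) S)"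
    unfolding I g_def by (simp add: case_prod_unfold)
  have distg: "distributed M lborel (g t) std_normal_density" if "t \<in> insert (k, 1) S" for t
  proof -
    obtain i b where t: "t = (i, b)" "b \<in> Basis" using \<open>t \<in> insert (k, 1) S\<close> I by auto
    have "distributed M lborel (\<lambda>\<omega>. (X \<omega> $ i $ k \<bullet> b - 0) / \<sigma>) std_normal_density"
      using dist[OF t(2), of i k] \<sigma> by (subst normal_standard_normal_convert[symmetric]) auto
    then show ?thesis by (simp add: g_def t)
  qed
  have T: "distributed M lborel T (noncentral_mixture (real DIM('a) * real CARD('n)) l)"
    using distributed_noncentral_chisq[OF S indg distg, of a] by (simp add: T_def[abs_def] card l a_def)
  have "ln (norm ((mat 1 + (1 / c) *\<^sub>R X \<omega>) *v axis k 1)) = 1 / 2 * ln (T \<omega> / l)" for \<omega>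
  proof -
    let ?z = "(mat 1 + (1 / c) *\<^sub>R X \<omega>) *v axis k 1"
    have comp: "?z $ i \<bullet> b = (\<sigma> / c) * ((if (i, b) = (k, 1) then a else 0) + g (i, b) \<omega>)" if "b \<in> Basis" for i b
    proof -
      have "?z $ i = (if i = k then 1 else 0) + (1 / c) *\<^sub>R (X \<omega> $ i $ k)"
        by (simp add: matrix_vector_mult_axis column_def mat_def)
      then have "?z $ i \<bullet> b = (if i = k \<and> b = 1 then 1 else 0) + (X \<omega> $ i $ k \<bullet> b) / c"
        using inner_Basis[OF one that] inner_same_Basis[OF one] by (simp add: inner_add_left)
      then show ?thesis using \<sigma> c by (simp add: a_def g_def field_simps)
    qed
    have nz: "(norm z)\<^sup>2 = (\<Sum>b\<in>Basis. (z \<bullet> b)\<^sup>2)" for z :: 'a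
      using euclidean_inner[of z z] unfolding power2_norm_eq_inner by (simp only: power2_eq_square)
    have "(norm ?z)\<^sup>2 = (\<Sum>i\<in>UNIV. \<Sum>b\<in>Basis. (?z $ i \<bullet> b)\<^sup>2)"
      unfolding power2_norm_vec[of ?z] nz ..
    also have "\<dots> = (\<Sum>t\<in>?I. (\<sigma> / c)\<^sup>2 * ((if t = (k, 1) then a else 0) + g t \<omega>)\<^sup>2)"
      unfolding sum.cartesian_product
    proof (rule sum.cong[OF refl])
      fix t assume "t \<in> ?I"
      then obtain i b where t: "t = (i, b)" "b \<in> Basis" by auto
      show "(case t of (i, b) \<Rightarrow> (?z $ i \<bullet> b)\<^sup>2) = (\<sigma> / c)\<^sup>2 * ((if t = (k, 1) then a else 0) + g t \<omega>)\<^sup>2"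
        unfolding t(1) prod.case comp[OF t(2)] power_mult_distrib ..
    qed
    also have "\<dots> = T \<omega> / l"
      unfolding T_def I l sum_distrib_left[symmetric] by (simp add: power_divide)
    finally have sq: "(norm ?z)\<^sup>2 = T \<omega> / l" .
    show ?thesis
    \<comment> \<open>The identity holds for every \<omega>: at a zero column both sides vanish by
      \<open>ln 0 = 0\<close>.\<close>
    proof (cases "norm ?z = 0")
      case True
      then show ?thesis unfolding sq[symmetric] by simp
    next
      case False
      then have "ln ((norm ?z)\<^sup>2) = 2 * ln (norm ?z)" by (simp add: ln_realpow)
      then show ?thesis by (simp add: sq)
    qed
  qed
  then have "(\<integral>\<omega>. ln (norm ((mat 1 + (1 / c) *\<^sub>R X \<omega>) *v axis k 1)) \<partial>M) = 1 / 2 * expectation (\<lambda>\<omega>. ln (T \<omega> / l))"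
    by (simp only: integral_mult_right_zero)
  also have "expectation (\<lambda>\<omega>. ln (T \<omega> / l)) =
      (LBINT t:{0<..}. ln (t / l) * noncentral_chisq_density t (real DIM('a) * real CARD('n)) l)"
    by (rule expectation_ln_noncentral_chisq[OF T _ l0]) simp
  finally show ?thesis .
qed

text \<open>The value found for the mean logarithm of a column length is the same for every
  \<open>k\<close>, as the criterion for the largest exponent demands. The matrix \<open>X\<close>
  enters only through its law \<open>gauss \<sigma>\<close>.\<close>

theorem AE_largest_lyapunov_exponent_noncentral_chisq:
  fixes X :: "'v \<Rightarrow> 'a::{euclidean_space, real_normed_div_algebra} ^ 'n ^ 'n"
  assumes one: "(1 :: 'a) \<in> Basis" and \<sigma>: "\<sigma> > 0" and c: "c > 0" and l: "l = (c / \<sigma>)\<^sup>2"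
    and gm: "gaussian_matrix M' \<sigma> X"
    and copies: "indep_copies M Y M' (\<lambda>\<omega>. mat 1 + (1 / c) *\<^sub>R X \<omega>)"
  shows "AE \<omega> in M. has_largest_lyapunov_exponent (matrix_prod (\<lambda>i. Y i \<omega>))
    (1 / 2 * (LBINT t:{0<..}. ln (t / l) * noncentral_chisq_density t (real DIM('a) * real CARD('n)) l))"
proof -
  note [measurable] = gaussian_matrix_measurable[OF gm \<sigma>]
  have X: "distr M' borel X = gauss \<sigma>" by (rule gaussian_matrix_distr(2)[OF gm \<sigma>])
  interpret G: gaussian_product M \<sigma> "1 / c" Y
  proof (intro gaussian_product.intro gaussian_product_axioms.intro)
    show "prob_space M" "prob_space.indep_vars M (\<lambda>_. borel) Y {1..}"
      using copies by (auto simp: indep_copies_def)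
    fix i :: nat assume "i \<ge> 1"
    then have "distr M borel (Y i) = distr M' borel (\<lambda>\<omega>. mat 1 + (1 / c) *\<^sub>R X \<omega>)"
      using copies by (auto simp: indep_copies_def)
    also have "\<dots> = distr (distr M' borel X) borel (\<lambda>x. mat 1 + (1 / c) *\<^sub>R x)"
      by (subst distr_distr) (auto simp: comp_def)
    finally show "distr M borel (Y i) = distr (gauss \<sigma>) borel (\<lambda>x. mat 1 + (1 / c) *\<^sub>R x)" by (simp only: X)
  qed (use \<sigma> c in auto)
  have meas: "(\<lambda>A :: 'a ^ 'n ^ 'n. ln (norm (A *v axis k 1))) \<in> borel_measurable borel" for k
  proof -
    have [measurable]: "(\<lambda>A :: 'a ^ 'n ^ 'n. A *v axis k 1) \<in> borel_measurable borel"
      by (rule borel_measurable_continuous_onI[OF continuous_matrix_vector_mult_left])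
    show ?thesis by measurable
  qed
  show ?thesis
  proof (rule G.AE_has_largest_lyapunov_exponent)
    fix k
    have "integral\<^sup>L G.\<nu> (\<lambda>A. ln (norm (A *v axis k 1))) =
        (\<integral>x. ln (norm ((mat 1 + (1 / c) *\<^sub>R x) *v axis k 1)) \<partial>(gauss \<sigma> :: ('a ^ 'n ^ 'n) measure))"
      by (rule integral_distr[OF _ meas]) measurable
    also have "\<dots> = (\<integral>\<omega>. ln (norm ((mat 1 + (1 / c) *\<^sub>R X \<omega>) *v axis k 1)) \<partial>M')"
      unfolding X[symmetric]
      by (rule integral_distr) (use measurable_compose[OF _ meas, of "\<lambda>x. mat 1 + (1 / c) *\<^sub>R x" borel k] in auto)
    also have "\<dots> = 1 / 2 * (LBINT t:{0<..}. ln (t / l) * noncentral_chisq_density t (real DIM('a) * real CARD('n)) l)"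
      by (rule expectation_ln_norm_column[OF one \<sigma> c l gm])
    finally show "integral\<^sup>L G.\<nu> (\<lambda>A. ln (norm (A *v axis k 1))) =
      1 / 2 * (LBINT t:{0<..}. ln (t / l) * noncentral_chisq_density t (real DIM('a) * real CARD('n)) l)" .
  qed
qed

lemma DIM_quat: "DIM(quat) = 4"
  by (simp add: Basis_quat_def)

theorem mainTheorem11:
  fixes M :: "'w measure" and M' :: "'v measure" and \<sigma> c l :: real
  assumes "\<sigma> > 0" and "c > 0" and "l = (c / \<sigma>)\<^sup>2"
  shows
    "(\<forall>(X :: 'v \<Rightarrow> real ^ 'n ^ 'n) (Y :: nat \<Rightarrow> 'w \<Rightarrow> real ^ 'n ^ 'n).
        gaussian_matrix M' \<sigma> X \<longrightarrow>
        indep_copies M Y M' (\<lambda>\<omega>. mat 1 + (1 / c) *\<^sub>R X \<omega>) \<longrightarrow>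
        (AE \<omega> in M. has_largest_lyapunov_exponent (matrix_prod (\<lambda>i. Y i \<omega>))
          (1 / 2 * (LBINT t:{0<..}. ln (t / l) *
            noncentral_chisq_density t (1 * real CARD('n)) l)))) \<and>
     (\<forall>(X :: 'v \<Rightarrow> complex ^ 'n ^ 'n) (Y :: nat \<Rightarrow> 'w \<Rightarrow> complex ^ 'n ^ 'n).
        gaussian_matrix M' \<sigma> X \<longrightarrow>
        indep_copies M Y M' (\<lambda>\<omega>. mat 1 + (1 / c) *\<^sub>R X \<omega>) \<longrightarrow>
        (AE \<omega> in M. has_largest_lyapunov_exponent (matrix_prod (\<lambda>i. Y i \<omega>))
          (1 / 2 * (LBINT t:{0<..}. ln (t / l) *
            noncentral_chisq_density t (2 * real CARD('n)) l)))) \<and>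
     (\<forall>(X :: 'v \<Rightarrow> quat ^ 'n ^ 'n) (Y :: nat \<Rightarrow> 'w \<Rightarrow> quat ^ 'n ^ 'n).
        gaussian_matrix M' \<sigma> X \<longrightarrow>
        indep_copies M Y M' (\<lambda>\<omega>. mat 1 + (1 / c) *\<^sub>R X \<omega>) \<longrightarrow>
        (AE \<omega> in M. has_largest_lyapunov_exponent (matrix_prod (\<lambda>i. Y i \<omega>))
          (1 / 2 * (LBINT t:{0<..}. ln (t / l) *
            noncentral_chisq_density t (4 * real CARD('n)) l))))"
proof (intro conjI allI impI)
  note main = AE_largest_lyapunov_exponent_noncentral_chisq[OF _ assms]
  have one: "(1 :: real) \<in> Basis" "(1 :: complex) \<in> Basis" "(1 :: quat) \<in> Basis"
    by (auto simp: Basis_complex_def Basis_quat_def one_quat_def)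
  show "AE \<omega> in M. has_largest_lyapunov_exponent (matrix_prod (\<lambda>i. Y i \<omega>))
      (1 / 2 * (LBINT t:{0<..}. ln (t / l) * noncentral_chisq_density t (1 * real CARD('n)) l))"
    if "gaussian_matrix M' \<sigma> X" "indep_copies M Y M' (\<lambda>\<omega>. mat 1 + (1 / c) *\<^sub>R X \<omega>)"
    for X :: "'v \<Rightarrow> real ^ 'n ^ 'n" and Y
    using main[OF one(1) that] by simp
  show "AE \<omega> in M. has_largest_lyapunov_exponent (matrix_prod (\<lambda>i. Y i \<omega>))
      (1 / 2 * (LBINT t:{0<..}. ln (t / l) * noncentral_chisq_density t (2 * real CARD('n)) l))"
    if "gaussian_matrix M' \<sigma> X" "indep_copies M Y M' (\<lambda>\<omega>. mat 1 + (1 / c) *\<^sub>R X \<omega>)"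
    for X :: "'v \<Rightarrow> complex ^ 'n ^ 'n" and Y
    using main[OF one(2) that] by simp
  show "AE \<omega> in M. has_largest_lyapunov_exponent (matrix_prod (\<lambda>i. Y i \<omega>))
      (1 / 2 * (LBINT t:{0<..}. ln (t / l) * noncentral_chisq_density t (4 * real CARD('n)) l))"
    if "gaussian_matrix M' \<sigma> X" "indep_copies M Y M' (\<lambda>\<omega>. mat 1 + (1 / c) *\<^sub>R X \<omega>)"
    for X :: "'v \<Rightarrow> quat ^ 'n ^ 'n" and Y
    using main[OF one(3) that] by (simp add: DIM_quat)
qed

end
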